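(* Let $n,d\ge1$ and let $\mathcal B_\alpha$, $\alpha\in\{\mathrm D,\mathrm N,\mathrm R\}$, be the bilinear forms of the first-order system defined in the context. There is a constant $C_B>0$ such that for all $\boldsymbol u,\boldsymbol w\in(H^1(\Omega)\times H^1(\Omega)^d)^n$ and all $\alpha\in\{\mathrm D,\mathrm N,\mathrm R\}$, $$\mathcal B_\alpha(\boldsymbol u,\boldsymbol w)\le C_B\|\boldsymbol u\|_{H^1(\Omega)}\|\boldsymbol w\|_{H^1(\Omega)}.$$ Furthermore, for $\alpha=\mathrm N,\mathrm R$ there is a constant $C>0$ such that for all $\boldsymbol u=(\phi_0,\boldsymbol\psi_0,\dots,\phi_{n-1},\boldsymbol\psi_{n-1})\in(H^1(\Omega)\times H^1(\Omega)^d)^n$, $$\mathcal B_\alpha(\boldsymbol u,\boldsymbol u)\ge C\sum_{k=0}^{n-1}\Big(\|\phi_k\|_{H^1(\Omega)}^2+\|\boldsymbol\psi_k\|_{H(\mathrm{div};\Omega)}^2\Big).$$ In addition, for every $E>0$ there is a constant $C_E>0$ such that for all such $\boldsymbol u$ with $\|\boldsymbol u\|_{H^1(\Omega)}\le E$, $$\sqrt{\mathcal B_{\mathrm D}(\boldsymbol u,\boldsymbol u)}\ge C_E\sum_{k=0}^{n-1}\Big(\|\phi_k\|_{H^1(\Omega)}^2+\|\boldsymbol\psi_k\|_{H(\mathrm{div};\Omega)}^2\Big).$$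
   Context: $\Omega=[0,1]^d$, $\boldsymbol n$ is the outer unit normal of $\partial\Omega$, and $\lambda,\mu>0$ are fixed constants. Write $\boldsymbol u=(\phi_0,\boldsymbol\psi_0,\dots,\phi_{n-1},\boldsymbol\psi_{n-1})$ and $\boldsymbol w=(\theta_0,\boldsymbol\xi_0,\dots,\theta_{n-1},\boldsymbol\xi_{n-1})$ with $\phi_i,\theta_i$ scalar and $\boldsymbol\psi_i,\boldsymbol\xi_i$ $\mathbb R^d$-valued. $\|\boldsymbol u\|_{H^1(\Omega)}$ denotes the sum over $k$ of $\|\phi_k\|_{H^1(\Omega)}$ and $\|\boldsymbol\psi_k\|_{H^1(\Omega)}$, and $\|\boldsymbol v\|_{H(\mathrm{div};\Omega)}=(\|\boldsymbol v\|_{L^2(\Omega)}^2+\|\mathrm{div}\,\boldsymbol v\|_{L^2(\Omega)}^2)^{1/2}$. $\mathcal P\boldsymbol u=(\nabla\phi_0-\boldsymbol\psi_0,\ \mathrm{div}\,\boldsymbol\psi_0-\phi_1,\ \nabla\phi_1-\boldsymbol\psi_1,\dots,\mathrm{div}\,\boldsymbol\psi_{n-2}-\phi_{n-1},\ \nabla\phi_{n-1}-\boldsymbol\psi_{n-1},\ \mathrm{div}\,\boldsymbol\psi_{n-1})$. On $\partial\Omega$: $S_{\mathrm D}\boldsymbol u=(\phi_0,\dots,\phi_{n-1})$, $S_{\mathrm N}\boldsymbol u=(\boldsymbol n\cdot\boldsymbol\psi_0,\dots,\boldsymbol n\cdot\boldsymbol\psi_{n-1})$, $S_{\mathrm R}=S_{\mathrm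 D}+S_{\mathrm N}$ (traces). For $\alpha=\mathrm D,\mathrm R$: $\mathcal B_\alpha(\boldsymbol u,\boldsymbol w)=(\mathcal P\boldsymbol u,\mathcal P\boldsymbol w)_{L^2(\Omega)}+\lambda(S_\alpha\boldsymbol u,S_\alpha\boldsymbol w)_{L^2(\partial\Omega)}$. For $\alpha=\mathrm N$: $\mathcal B_{\mathrm N}(\boldsymbol u,\boldsymbol w)=(\mathcal P\boldsymbol u,\mathcal P\boldsymbol w)_{L^2(\Omega)}+\lambda(S_{\mathrm N}\boldsymbol u,S_{\mathrm N}\boldsymbol w)_{L^2(\partial\Omega)}+\mu\int_\Omega\phi_0\,\mathrm dx\int_\Omega\theta_0\,\mathrm dx$. *)

theory Defs
  imports "HOL-Analysis.Analysis"
begin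

section \<open>The cube and its boundary\<close>

abbreviation Omega :: "(real^'d) set" where
  "Omega \<equiv> cbox 0 1"

definition face_proj :: "'d \<Rightarrow> real \<Rightarrow> real^'d \<Rightarrow> real^'d" where
  "face_proj i c x = (\<chi> j. if j = i then c else x $ j)"

text \<open>
  The surface measure on the boundary of the cube. The boundary is the union of the \<open>2 d\<close> faces
  \<open>{x \<in> [0,1]^d. x $ i = c}\<close> with \<open>c \<in> {0,1}\<close>, which overlap in null sets only. As the \<open>i\<close>-th
  coordinate ranges over an interval of length 1, the \<open>(d-1)\<close>-dimensional Lebesgue measure on such
  a face is the image of the Lebesgue measure on the cube under \<open>face_proj i c\<close>; for \<open>d = 1\<close> this
  is the counting measure on \<open>{0,1}\<close>. The surface measure is the sum of these images over all faces
  (see \<open>emeasure_boundary_measure\<close> below).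
\<close>

definition boundary_measure :: "(real^'d) measure" where
  "boundary_measure =
     distr (count_space (UNIV \<times> {0, 1}) \<Otimes>\<^sub>M restrict_space lborel Omega) borel
       (\<lambda>((i, c), x). face_proj i c x)"

lemma measurable_face_proj [measurable]: "face_proj i c \<in> borel_measurable borel"
proof (rule borel_measurable_continuous_onI)
  have "continuous_on UNIV (\<lambda>x :: real^'a. if j = i then c else x $ j)" for j
    by (cases "j = i") (auto intro!: continuous_intros)
  then show "continuous_on UNIV (face_proj i c)"
    unfolding face_proj_def [abs_def] by (rule continuous_on_vec_lambda)
qed

lemma measurable_face_proj_pair:
  "(\<lambda>((i, c), x). face_proj i c x)
     \<in> count_space (UNIV \<times> {0, 1}) \<Otimes>\<^sub>M restrict_space lborel Omega \<rightarrow>\<^sub>M borel"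
proof -
  have "(\<lambda>p. face_proj (fst (fst p)) (snd (fst p)) (snd p))
     \<in> count_space (UNIV \<times> {0, 1::real}) \<Otimes>\<^sub>M restrict_space lborel (Omega :: (real^'d) set) \<rightarrow>\<^sub>M borel"
  proof (rule measurable_compose_countable'[where I = "UNIV \<times> {0, 1}" and g = fst
        and f = "\<lambda>ic p. face_proj (fst ic) (snd ic) (snd p)"])
    fix ic :: "'d \<times> real"
    have "snd \<in> count_space (UNIV \<times> {0, 1::real}) \<Otimes>\<^sub>M restrict_space lborel (Omega :: (real^'d) set)
        \<rightarrow>\<^sub>M (borel :: (real^'d) measure)"
      by (rule measurable_compose[OF measurable_snd]) (simp add: measurable_restrict_space1)
    then show "(\<lambda>p. face_proj (fst ic) (snd ic) (snd p))
        \<in> count_space (UNIV \<times> {0, 1::real}) \<Otimes>\<^sub>M restrict_space lborel (Omega :: (real^'d) set) \<rightarrow>\<^sub>M borel"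
      by (rule measurable_compose) simp
  qed (auto intro: countable_finite)
  then show ?thesis
    by (simp add: case_prod_unfold)
qed

lemma emeasure_boundary_measure:
  fixes A :: "(real^'d) set"
  assumes A: "A \<in> sets borel"
  shows "emeasure boundary_measure A =
    (\<Sum>i\<in>UNIV. \<Sum>c\<in>{0, 1}. emeasure lborel {x \<in> Omega. face_proj i c x \<in> A})"
proof -
  let ?C = "count_space (UNIV \<times> {0, 1::real}) :: ('d \<times> real) measure"
  let ?R = "restrict_space lborel (Omega :: (real^'d) set)"
  interpret R: sigma_finite_measure ?R
    by (intro sigma_finite_measure_restrict_space lborel.sigma_finite_measure_axioms) simp
  let ?f = "\<lambda>((i, c), x). face_proj i c x :: real^'d"
  have "?f -` A \<inter> space (?C \<Otimes>\<^sub>M ?R) \<in> sets (?C \<Otimes>\<^sub>M ?R)"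
    using measurable_face_proj_pair A by (rule measurable_sets)
  then have "emeasure boundary_measure A =
      (\<integral>\<^sup>+ic. emeasure ?R (Pair ic -` (?f -` A \<inter> space (?C \<Otimes>\<^sub>M ?R))) \<partial>?C)"
    unfolding boundary_measure_def
    by (simp add: emeasure_distr[OF measurable_face_proj_pair A] R.emeasure_pair_measure_alt)
  also have "\<dots> = (\<Sum>ic\<in>UNIV \<times> {0, 1}.
      emeasure ?R (Pair ic -` (?f -` A \<inter> space (?C \<Otimes>\<^sub>M ?R))))"
    by (rule nn_integral_count_space_finite) simp
  also have "\<dots> = (\<Sum>(i, c)\<in>UNIV \<times> {0, 1}. emeasure lborel {x \<in> Omega. face_proj i c x \<in> A})"
  proof (rule sum.cong[OF refl], clarify)
    fix i :: 'd and c :: real assume c: "c \<in> {0, 1}"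
    have "Pair (i, c) -` (?f -` A \<inter> space (?C \<Otimes>\<^sub>M ?R)) = {x \<in> Omega. face_proj i c x \<in> A}"
      using c by (auto simp: space_pair_measure space_restrict_space)
    then show "emeasure ?R (Pair (i, c) -` (?f -` A \<inter> space (?C \<Otimes>\<^sub>M ?R))) =
        emeasure lborel {x \<in> Omega. face_proj i c x \<in> A}"
      by (simp add: emeasure_restrict_space)
  qed
  finally show ?thesis
    by (simp only: sum.cartesian_product)
qed

text \<open>
  The outer unit normal. On the edges, a null set, where several faces meet and there is no normal,
  the value is irrelevant.
\<close>

definition outer_normal :: "real^'d \<Rightarrow> real^'d" where
  "outer_normal x = (\<chi> i. if x $ i = 0 then -1 else if x $ i = 1 then 1 else 0)"


section \<open>Square integrable functions\<close>

definition L2 :: "'a measure \<Rightarrow> ('a \<Rightarrow> 'b::euclidean_space) set" where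
  "L2 M = {f \<in> borel_measurable M. integrable M (\<lambda>x. (norm (f x))\<^sup>2)}"

definition L2_inner :: "'a measure \<Rightarrow> ('a \<Rightarrow> 'b::euclidean_space) \<Rightarrow> ('a \<Rightarrow> 'b) \<Rightarrow> real" where
  "L2_inner M f g = (LINT x|M. f x \<bullet> g x)"

definition L2_norm :: "'a measure \<Rightarrow> ('a \<Rightarrow> 'b::euclidean_space) \<Rightarrow> real" where
  "L2_norm M f = sqrt (LINT x|M. (norm (f x))\<^sup>2)"


section \<open>Weak derivatives and Sobolev spaces on the cube\<close>

text \<open>
  Functions on the cube are represented by functions on the whole space, whose values outside the
  cube are ignored. Weak derivatives and traces, being determined up to null sets, are picked by
  Hilbert choice.
\<close>

definition partial :: "'d \<Rightarrow> (real^'d \<Rightarrow> real) \<Rightarrow> real^'d \<Rightarrow> real" where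
  "partial i f x = frechet_derivative f (at x) (axis i 1)"

primrec C_k :: "nat \<Rightarrow> (real^'d \<Rightarrow> real) \<Rightarrow> bool" where
  "C_k 0 f \<longleftrightarrow> continuous_on UNIV f"
| "C_k (Suc k) f \<longleftrightarrow> (\<forall>x. f differentiable at x) \<and> (\<forall>i. C_k k (partial i f))"

definition test_function :: "(real^'d \<Rightarrow> real) \<Rightarrow> bool" where
  "test_function \<eta> \<longleftrightarrow> (\<forall>k. C_k k \<eta>) \<and> (\<exists>K. compact K \<and> K \<subseteq> box 0 1 \<and> (\<forall>x. x \<notin> K \<longrightarrow> \<eta> x = 0))"

definition has_weak_partial :: "'d \<Rightarrow> (real^'d \<Rightarrow> real) \<Rightarrow> (real^'d \<Rightarrow> real) \<Rightarrow> bool" where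
  "has_weak_partial i f g \<longleftrightarrow>
     (\<forall>\<eta>. test_function \<eta> \<longrightarrow>
       (LINT x|lebesgue_on Omega. f x * partial i \<eta> x) = - (LINT x|lebesgue_on Omega. g x * \<eta> x))"

definition H1 :: "(real^'d \<Rightarrow> real) set" where
  "H1 = {f \<in> L2 (lebesgue_on Omega). \<forall>i. \<exists>g \<in> L2 (lebesgue_on Omega). has_weak_partial i f g}"

definition weak_partial :: "'d \<Rightarrow> (real^'d \<Rightarrow> real) \<Rightarrow> real^'d \<Rightarrow> real" where
  "weak_partial i f = (SOME g. g \<in> L2 (lebesgue_on Omega) \<and> has_weak_partial i f g)"

definition grad :: "(real^'d \<Rightarrow> real) \<Rightarrow> real^'d \<Rightarrow> real^'d" where
  "grad f x = (\<chi> i. weak_partial i f x)"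

definition H1_norm :: "(real^'d \<Rightarrow> real) \<Rightarrow> real" where
  "H1_norm f = sqrt ((L2_norm (lebesgue_on Omega) f)\<^sup>2 + (L2_norm (lebesgue_on Omega) (grad f))\<^sup>2)"

abbreviation component :: "(real^'d \<Rightarrow> real^'d) \<Rightarrow> 'd \<Rightarrow> real^'d \<Rightarrow> real" where
  "component v i \<equiv> \<lambda>x. v x $ i"

definition H1_vec :: "(real^'d \<Rightarrow> real^'d) set" where
  "H1_vec = {v. \<forall>i. component v i \<in> H1}"

definition H1_vec_norm :: "(real^'d \<Rightarrow> real^'d) \<Rightarrow> real" where
  "H1_vec_norm v = sqrt (\<Sum>i\<in>UNIV. (H1_norm (component v i))\<^sup>2)"

definition divergence :: "(real^'d \<Rightarrow> real^'d) \<Rightarrow> real^'d \<Rightarrow> real" where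
  "divergence v x = (\<Sum>i\<in>UNIV. weak_partial i (component v i) x)"

definition Hdiv_norm :: "(real^'d \<Rightarrow> real^'d) \<Rightarrow> real" where
  "Hdiv_norm v =
     sqrt ((L2_norm (lebesgue_on Omega) v)\<^sup>2 + (L2_norm (lebesgue_on Omega) (divergence v))\<^sup>2)"

text \<open>
  The trace operator is the continuous extension to \<open>H1\<close>, with values in the square integrable
  functions on the boundary, of the restriction of functions that are continuously differentiable
  up to the boundary.
\<close>

definition is_trace :: "(real^'d \<Rightarrow> real) \<Rightarrow> (real^'d \<Rightarrow> real) \<Rightarrow> bool" where
  "is_trace f g \<longleftrightarrow> f \<in> H1 \<and> g \<in> L2 boundary_measure \<and>
     (\<exists>F :: nat \<Rightarrow> real^'d \<Rightarrow> real. (\<forall>m. C_k 1 (F m)) \<and>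
       (\<lambda>m. H1_norm (\<lambda>x. F m x - f x)) \<longlonglongrightarrow> 0 \<and>
       (\<lambda>m. L2_norm boundary_measure (\<lambda>x. F m x - g x)) \<longlonglongrightarrow> 0)"

definition boundary_trace :: "(real^'d \<Rightarrow> real) \<Rightarrow> real^'d \<Rightarrow> real" where
  "boundary_trace f = (SOME g. is_trace f g)"

definition boundary_trace_vec :: "(real^'d \<Rightarrow> real^'d) \<Rightarrow> real^'d \<Rightarrow> real^'d" where
  "boundary_trace_vec v x = (\<chi> i. boundary_trace (component v i) x)"


section \<open>The first-order system\<close>

text \<open>
  A state \<open>u\<close> consists of the pairs \<open>u k = (phi_k, psi_k)\<close> for \<open>k < n\<close>; all other entries are ignored.
\<close>

type_synonym 'd state = "nat \<Rightarrow> (real^'d \<Rightarrow> real) \<times> (real^'d \<Rightarrow> real^'d)"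

abbreviation phi :: "'d state \<Rightarrow> nat \<Rightarrow> real^'d \<Rightarrow> real" where
  "phi u k \<equiv> fst (u k)"

abbreviation psi :: "'d state \<Rightarrow> nat \<Rightarrow> real^'d \<Rightarrow> real^'d" where
  "psi u k \<equiv> snd (u k)"

definition H1_states :: "nat \<Rightarrow> 'd::finite state set" where
  "H1_states n = {u. \<forall>k<n. phi u k \<in> H1 \<and> psi u k \<in> H1_vec}"

definition state_norm :: "nat \<Rightarrow> 'd::finite state \<Rightarrow> real" where
  "state_norm n u = (\<Sum>k<n. H1_norm (phi u k) + H1_vec_norm (psi u k))"

text \<open>
  \<open>P_op n u k\<close> collects the two consecutive entries
  \<open>(grad phi_k - psi_k, div psi_k - phi_(k+1))\<close>, where \<open>phi_n = 0\<close>.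
\<close>

definition P_op :: "nat \<Rightarrow> 'd::finite state \<Rightarrow> nat \<Rightarrow> real^'d \<Rightarrow> (real^'d) \<times> real" where
  "P_op n u k x =
     (grad (phi u k) x - psi u k x,
      if Suc k < n then divergence (psi u k) x - phi u (Suc k) x else divergence (psi u k) x)"

datatype bc = Dirichlet | Neumann | Robin

fun S_op :: "bc \<Rightarrow> 'd::finite state \<Rightarrow> nat \<Rightarrow> real^'d \<Rightarrow> real" where
  "S_op Dirichlet u k x = boundary_trace (phi u k) x"
| "S_op Neumann u k x = outer_normal x \<bullet> boundary_trace_vec (psi u k) x"
| "S_op Robin u k x = boundary_trace (phi u k) x + outer_normal x \<bullet> boundary_trace_vec (psi u k) x"

definition B_form :: "nat \<Rightarrow> real \<Rightarrow> real \<Rightarrow> bc \<Rightarrow> 'd::finite state \<Rightarrow> 'd state \<Rightarrow> real" where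
  "B_form n lam mu \<alpha> u w =
     (\<Sum>k<n. L2_inner (lebesgue_on Omega) (P_op n u k) (P_op n w k))
     + lam * (\<Sum>k<n. L2_inner boundary_measure (S_op \<alpha> u k) (S_op \<alpha> w k))
     + (if \<alpha> = Neumann
        then mu * (LINT x|lebesgue_on Omega. phi u 0 x) * (LINT x|lebesgue_on Omega. phi w 0 x)
        else 0)"

end

theory Submission
  imports Defs
begin

text \<open>
  With the residuals \<open>F\<^sub>k = grad \<phi>\<^sub>k - \<psi>\<^sub>k\<close>, \<open>G\<^sub>k = div \<psi>\<^sub>k - \<phi>\<^sub>k\<^sub>+\<^sub>1\<close> (and \<open>\<phi>\<^sub>n = 0\<close>), Green's formula gives
  \<open>|grad \<phi>\<^sub>k|\<^sup>2 = (F\<^sub>k, grad \<phi>\<^sub>k) - (\<phi>\<^sub>k, G\<^sub>k) - (\<phi>\<^sub>k, \<phi>\<^sub>k\<^sub>+\<^sub>1) + (\<phi>\<^sub>k, n \<bullet> \<psi>\<^sub>k)\<close>, the last product over the boundary.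
  Together with the inequality of Poincare or Friedrichs this bounds \<open>\<phi>\<^sub>k\<close> in \<open>H\<^sup>1\<close> by the residuals and
  \<open>\<phi>\<^sub>k\<^sub>+\<^sub>1\<close>, and downward induction on \<open>k\<close> bounds all \<open>\<phi>\<^sub>k\<close>, hence all \<open>\<psi>\<^sub>k\<close>. In the Neumann case the
  mean of \<open>\<phi>\<^sub>k\<^sub>+\<^sub>1\<close> is controlled by integrating \<open>G\<^sub>k\<close> and the divergence theorem. In the Dirichlet case
  \<open>n \<bullet> \<psi>\<^sub>k\<close> is only bounded by the a priori bound \<open>E\<close>, which costs the square root.

  Trace, Green, Poincare and Friedrichs are proved for \<open>C\<^sup>1\<close> functions by integrating along coordinate
  lines and extended by density. A mollifier whose kernels are test functions up to the boundary
  yields both this density and the uniqueness of weak derivatives.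
\<close>

section \<open>Square integrable functions\<close>

text \<open>The surface measure parametrises each face by the whole cube through
  \<open>face_proj\<close>, so boundary integrals are sums of volume integrals, and Green, trace and
  Friedrichs reduce to calculus in the single variable \<open>x $ i\<close>. Weak derivatives and
  traces are picked by choice. A chosen derivative is identified up to null sets by uniqueness; a
  chosen trace brings along a C1 sequence converging to the function in \<open>H1\<close> and to the
  trace on the boundary, and identities pass to the limit along it.

  The energy identity bounds a squared gradient by a multiple of the \<open>H1\<close> norm of the
  same \<open>\<phi>\<^sub>k\<close>, a factor that must be absorbed. The three conditions differ in
  what supplies the missing zeroth-order bound. For Robin, \<open>(\<phi>, n \<bullet> \<psi>) =
  (\<phi>, \<phi> + n \<bullet> \<psi>) - |\<phi>|\<^sup>2\<close> yields a boundary norm of the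
  right sign. For Neumann, the \<open>mu\<close> term fixes the mean of
  \<open>\<phi>\<^sub>0\<close>. For Dirichlet, the boundary norm is small, but \<open>E\<close>
  enters twice: in the normal trace and in trading the square of the residual for a multiple of the
  residual.\<close>

lemma L2I: "f \<in> borel_measurable M \<Longrightarrow> integrable M (\<lambda>x. (norm (f x))\<^sup>2) \<Longrightarrow> f \<in> L2 M"
  by (simp add: L2_def)

lemma L2_measurable [measurable_dest]: "f \<in> L2 M \<Longrightarrow> f \<in> borel_measurable M"
  by (simp add: L2_def)

lemma L2_integrable_square: "f \<in> L2 M \<Longrightarrow> integrable M (\<lambda>x. (norm (f x))\<^sup>2)"
  by (simp add: L2_def)

lemma L2_bound:
  fixes f :: "'a \<Rightarrow> 'b::euclidean_space" and g :: "'a \<Rightarrow> 'c::euclidean_space"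
  assumes "g \<in> L2 M" "f \<in> borel_measurable M" "AE x in M. norm (f x) \<le> norm (g x)"
  shows "f \<in> L2 M"
proof (rule L2I[OF assms(2)])
  show "integrable M (\<lambda>x. (norm (f x))\<^sup>2)"
  proof (rule Bochner_Integration.integrable_bound[OF L2_integrable_square[OF assms(1)]])
    show "AE x in M. norm ((norm (f x))\<^sup>2) \<le> norm ((norm (g x))\<^sup>2)"
      using assms(3) by eventually_elim (simp add: power_mono)
  qed (use assms(2) in measurable)
qed

lemma L2_inner_integrable:
  assumes [measurable]: "f \<in> L2 M" "g \<in> L2 M"
  shows "integrable M (\<lambda>x. f x \<bullet> g x)"
proof (rule Bochner_Integration.integrable_bound)
  show "integrable M (\<lambda>x. (norm (f x))\<^sup>2 + (norm (g x))\<^sup>2)"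
    using assms by (intro Bochner_Integration.integrable_add L2_integrable_square)
  have "\<bar>f x \<bullet> g x\<bar> \<le> (norm (f x))\<^sup>2 + (norm (g x))\<^sup>2" for x
  proof -
    have "\<bar>f x \<bullet> g x\<bar> \<le> norm (f x) * norm (g x)" by (rule Cauchy_Schwarz_ineq2)
    moreover have "2 * (norm (f x) * norm (g x)) \<le> (norm (f x))\<^sup>2 + (norm (g x))\<^sup>2"
      using sum_squares_bound[of "norm (f x)" "norm (g x)"] by simp
    moreover have "0 \<le> norm (f x) * norm (g x)" by simp
    ultimately show ?thesis by linarith
  qed
  then show "AE x in M. norm (f x \<bullet> g x) \<le> norm ((norm (f x))\<^sup>2 + (norm (g x))\<^sup>2)"
    by simp
qed measurable

lemma L2_add [intro]:
  assumes [measurable]: "f \<in> L2 M" "g \<in> L2 M"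
  shows "(\<lambda>x. f x + g x) \<in> L2 M"
proof (rule L2I)
  have "(norm (f x + g x))\<^sup>2 = (norm (f x))\<^sup>2 + 2 * (f x \<bullet> g x) + (norm (g x))\<^sup>2" for x
    by (simp add: power2_norm_eq_inner inner_add_left inner_add_right inner_commute)
  then show "integrable M (\<lambda>x. (norm (f x + g x))\<^sup>2)"
    using assms by (simp add: L2_integrable_square L2_inner_integrable)
qed measurable

lemma L2_scaleR [intro]:
  assumes [measurable]: "f \<in> L2 M" shows "(\<lambda>x. c *\<^sub>R f x) \<in> L2 M"
  by (rule L2I) (use L2_integrable_square[OF assms] in \<open>auto simp: power_mult_distrib\<close>)

lemma L2_cmult [intro]:
  fixes f :: "'a \<Rightarrow> real"
  shows "f \<in> L2 M \<Longrightarrow> (\<lambda>x. c * f x) \<in> L2 M"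
  using L2_scaleR[of f M c] by simp

lemma L2_uminus [intro]: "f \<in> L2 M \<Longrightarrow> (\<lambda>x. - f x) \<in> L2 M"
  using L2_scaleR[of f M "-1"] by simp

lemma L2_diff [intro]: "f \<in> L2 M \<Longrightarrow> g \<in> L2 M \<Longrightarrow> (\<lambda>x. f x - g x) \<in> L2 M"
  using L2_add[of f M "\<lambda>x. - g x"] by (simp add: L2_uminus)

lemma L2_zero [simp]: "(\<lambda>x. 0) \<in> L2 M"
  by (simp add: L2_def)

lemma L2_sum [intro]: "(\<And>i. i \<in> I \<Longrightarrow> f i \<in> L2 M) \<Longrightarrow> (\<lambda>x. \<Sum>i\<in>I. f i x) \<in> L2 M"
  by (induction I rule: infinite_finite_induct) auto

lemma L2_norm_fun [intro]:
  "f \<in> L2 M \<Longrightarrow> (\<lambda>x. norm (f x)) \<in> L2 M"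
  by (rule L2_bound[of f]) (auto dest: L2_measurable)

lemma (in finite_measure) L2_const [simp]: "(\<lambda>x. c) \<in> L2 M"
  by (rule L2I) auto

lemma (in finite_measure) L2_bounded:
  fixes f :: "'a \<Rightarrow> 'b::euclidean_space"
  assumes "f \<in> borel_measurable M" "AE x in M. norm (f x) \<le> c"
  shows "f \<in> L2 M"
  by (rule L2_bound[of "\<lambda>x. c"]) (use assms in \<open>auto elim!: eventually_mono\<close>)

lemma (in finite_measure) L2_integrable:
  assumes "f \<in> L2 M" shows "integrable M f"
proof -
  have "integrable M (\<lambda>x. norm (f x) \<bullet> 1)"
    by (rule L2_inner_integrable) (use assms in auto)
  then show ?thesis using L2_measurable[OF assms] by (simp add: integrable_norm_iff)
qed

lemma L2_norm_nonneg [simp]: "L2_norm M f \<ge> 0"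
  by (simp add: L2_norm_def)

lemma L2_norm_square: "(L2_norm M f)\<^sup>2 = (LINT x|M. (norm (f x))\<^sup>2)"
  by (simp add: L2_norm_def)

lemma L2_norm_cong_AE:
  assumes "AE x in M. f x = g x"
    and [measurable]: "f \<in> borel_measurable M" "g \<in> borel_measurable M"
  shows "L2_norm M f = L2_norm M g"
proof -
  have "(LINT x|M. (norm (f x))\<^sup>2) = (LINT x|M. (norm (g x))\<^sup>2)"
    by (rule integral_cong_AE) (use assms(1) in \<open>auto elim: eventually_mono\<close>)
  then show ?thesis by (simp add: L2_norm_def)
qed

lemma L2_norm_mono:
  fixes f :: "'a \<Rightarrow> 'b::euclidean_space" and g :: "'a \<Rightarrow> 'c::euclidean_space"
  assumes "g \<in> L2 M" "AE x in M. norm (f x) \<le> norm (g x)" "f \<in> borel_measurable M"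
  shows "L2_norm M f \<le> L2_norm M g"
  unfolding L2_norm_def
proof (rule real_sqrt_le_mono, rule integral_mono_AE)
  show "integrable M (\<lambda>x. (norm (f x))\<^sup>2)"
    by (rule L2_integrable_square, rule L2_bound[OF assms(1,3,2)])
  show "integrable M (\<lambda>x. (norm (g x))\<^sup>2)"
    by (intro L2_integrable_square assms)
  show "AE x in M. (norm (f x))\<^sup>2 \<le> (norm (g x))\<^sup>2"
    using assms(2) by eventually_elim (simp add: power_mono)
qed

lemma L2_norm_scaleR: "L2_norm M (\<lambda>x. c *\<^sub>R f x) = \<bar>c\<bar> * L2_norm M f"
  by (simp add: L2_norm_def power_mult_distrib real_sqrt_mult)

lemma L2_norm_cmult: "L2_norm M (\<lambda>x. c * f x :: real) = \<bar>c\<bar> * L2_norm M f"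
  using L2_norm_scaleR[of M c f] by simp

lemma L2_norm_minus_commute: "L2_norm M (\<lambda>x. f x - g x) = L2_norm M (\<lambda>x. g x - f x)"
  by (simp add: L2_norm_def norm_minus_commute)

lemma L2_inner_self: "L2_inner M f f = (L2_norm M f)\<^sup>2"
  by (simp add: L2_inner_def L2_norm_square power2_norm_eq_inner)

lemma L2_inner_commute: "L2_inner M f g = L2_inner M g f"
  by (simp add: L2_inner_def inner_commute)

lemma L2_inner_add_left:
  "f \<in> L2 M \<Longrightarrow> g \<in> L2 M \<Longrightarrow> h \<in> L2 M \<Longrightarrow>
    L2_inner M (\<lambda>x. f x + g x) h = L2_inner M f h + L2_inner M g h"
  by (simp add: L2_inner_def inner_add_left L2_inner_integrable)

lemma L2_inner_diff_left:
  "f \<in> L2 M \<Longrightarrow> g \<in> L2 M \<Longrightarrow> h \<in> L2 M \<Longrightarrow>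
    L2_inner M (\<lambda>x. f x - g x) h = L2_inner M f h - L2_inner M g h"
  by (simp add: L2_inner_def inner_diff_left L2_inner_integrable)

lemma L2_inner_diff_right:
  "f \<in> L2 M \<Longrightarrow> g \<in> L2 M \<Longrightarrow> h \<in> L2 M \<Longrightarrow>
    L2_inner M f (\<lambda>x. g x - h x) = L2_inner M f g - L2_inner M f h"
  by (simp add: L2_inner_def inner_diff_right L2_inner_integrable)

lemma L2_inner_cong_AE:
  assumes "AE x in M. f x = f' x" "AE x in M. g x = g' x"
    and [measurable]: "f \<in> borel_measurable M" "g \<in> borel_measurable M"
      "f' \<in> borel_measurable M" "g' \<in> borel_measurable M"
  shows "L2_inner M f g = L2_inner M f' g'"
  unfolding L2_inner_def
  by (rule integral_cong_AE) (use assms(1,2) in \<open>auto elim: eventually_elim2\<close>)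

text \<open>With \<open>c = |g|\<^sup>2\<close> and \<open>b = (f, g)\<close>, the function
  \<open>c f - b g\<close> is a multiple of the part of \<open>f\<close> orthogonal to
  \<open>g\<close>, and its squared norm is \<open>c (c |f|\<^sup>2 - b\<^sup>2)\<close>. Only the
  final cancellation of \<open>c\<close> asks for a nonzero \<open>g\<close>.\<close>

lemma L2_Cauchy_Schwarz:
  assumes fg [measurable]: "f \<in> L2 M" "g \<in> L2 M"
  shows "\<bar>L2_inner M f g\<bar> \<le> L2_norm M f * L2_norm M g"
proof (cases "L2_norm M g = 0")
  case True
  then have "(LINT x|M. (norm (g x))\<^sup>2) = 0"
    by (simp add: L2_norm_square[symmetric])
  then have "AE x in M. g x = 0"
    using integral_nonneg_eq_0_iff_AE[OF L2_integrable_square[OF fg(2)]] by simp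
  then have "L2_inner M f g = L2_inner M f (\<lambda>_. 0)"
    by (intro L2_inner_cong_AE) auto
  then show ?thesis by (simp add: L2_inner_def)
next
  case False
  define c where "c = (L2_norm M g)\<^sup>2"
  define b where "b = L2_inner M f g"
  have c: "c > 0" using False by (simp add: c_def)
  have "0 \<le> (L2_norm M (\<lambda>x. c *\<^sub>R f x - b *\<^sub>R g x))\<^sup>2" by simp
  also have "\<dots> = (LINT x|M. c\<^sup>2 * (norm (f x))\<^sup>2 - 2 * b * c * (f x \<bullet> g x) + b\<^sup>2 * (norm (g x))\<^sup>2)"
    unfolding L2_norm_square
    by (intro arg_cong[where f = "integral\<^sup>L M"] ext)
       (simp only: power2_norm_eq_inner, simp add: inner_diff_left inner_diff_right inner_commute
         power2_eq_square algebra_simps)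
  also have "\<dots> = c\<^sup>2 * (L2_norm M f)\<^sup>2 - 2 * b * c * b + b\<^sup>2 * c"
    using fg by (simp add: L2_integrable_square L2_inner_integrable L2_norm_square b_def c_def
        L2_inner_def)
  also have "\<dots> = c * (c * (L2_norm M f)\<^sup>2 - b\<^sup>2)"
    by (simp add: power2_eq_square algebra_simps)
  finally have "b\<^sup>2 \<le> c * (L2_norm M f)\<^sup>2"
    using c by (simp add: zero_le_mult_iff)
  then have "b\<^sup>2 \<le> (L2_norm M f * L2_norm M g)\<^sup>2"
    by (simp add: c_def power_mult_distrib mult.commute)
  then have "\<bar>b\<bar> \<le> \<bar>L2_norm M f * L2_norm M g\<bar>"
    by (simp only: abs_le_square_iff)
  then show ?thesis by (simp add: b_def)
qed

lemma L2_inner_le: 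
  assumes "f \<in> L2 M" "g \<in> L2 M"
  shows "L2_inner M f g \<le> L2_norm M f * L2_norm M g"
  using L2_Cauchy_Schwarz[OF assms] by simp

lemma L2_norm_triangle:
  assumes "f \<in> L2 M" "g \<in> L2 M"
  shows "L2_norm M (\<lambda>x. f x + g x) \<le> L2_norm M f + L2_norm M g"
proof -
  have "(L2_norm M (\<lambda>x. f x + g x))\<^sup>2 = (L2_norm M f)\<^sup>2 + 2 * L2_inner M f g + (L2_norm M g)\<^sup>2"
  proof -
    have "(L2_norm M (\<lambda>x. f x + g x))\<^sup>2 =
        (LINT x|M. (norm (f x))\<^sup>2 + 2 * (f x \<bullet> g x) + (norm (g x))\<^sup>2)"
      unfolding L2_norm_square
      by (intro arg_cong[where f = "integral\<^sup>L M"] ext)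
         (simp add: power2_norm_eq_inner inner_add_left inner_add_right inner_commute)
    then show ?thesis
      using assms by (simp add: L2_integrable_square L2_inner_integrable L2_norm_square L2_inner_def)
  qed
  also have "\<dots> \<le> (L2_norm M f + L2_norm M g)\<^sup>2"
    using L2_inner_le[OF assms] by (simp add: power2_eq_square algebra_simps)
  finally show ?thesis
    by (rule power2_le_imp_le) simp
qed

lemma L2_norm_triangle_diff:
  assumes "f \<in> L2 M" "g \<in> L2 M"
  shows "L2_norm M (\<lambda>x. f x - g x) \<le> L2_norm M f + L2_norm M g"
  using L2_norm_triangle[OF assms(1) L2_uminus[OF assms(2)]] by (simp add: L2_norm_def del: real_sqrt_le_iff)

lemma L2_norm_triangle_sub:
  assumes "f \<in> L2 M" "g \<in> L2 M"
  shows "L2_norm M f \<le> L2_norm M (\<lambda>x. f x - g x) + L2_norm M g"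
  using L2_norm_triangle[OF L2_diff[OF assms] assms(2)] by simp

lemma L2_norm_sum_le:
  assumes "\<And>i. i \<in> I \<Longrightarrow> f i \<in> L2 M"
  shows "L2_norm M (\<lambda>x. \<Sum>i\<in>I. f i x) \<le> (\<Sum>i\<in>I. L2_norm M (f i))"
  using assms
proof (induction I rule: infinite_finite_induct)
  case (insert i I)
  then have "L2_norm M (\<lambda>x. f i x + (\<Sum>j\<in>I. f j x)) \<le> L2_norm M (f i) + L2_norm M (\<lambda>x. \<Sum>j\<in>I. f j x)"
    by (intro L2_norm_triangle L2_sum) auto
  with insert show ?case by simp
qed (simp_all add: L2_norm_def)

lemma L2_norm_tendsto:
  assumes f: "\<And>m. f m \<in> L2 M" "f' \<in> L2 M" and lim: "(\<lambda>m. L2_norm M (\<lambda>x. f m x - f' x)) \<longlonglongrightarrow> 0"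
  shows "(\<lambda>m. L2_norm M (f m)) \<longlonglongrightarrow> L2_norm M f'"
proof (rule LIM_zero_cancel, rule Lim_null_comparison[OF _ lim], rule always_eventually, rule allI)
  fix m
  show "norm (L2_norm M (f m) - L2_norm M f') \<le> L2_norm M (\<lambda>x. f m x - f' x)"
    using L2_norm_triangle_sub[OF f(1)[of m] f(2)] L2_norm_triangle_sub[OF f(2) f(1)[of m]]
    by (simp add: L2_norm_minus_commute[of M f'] abs_le_iff)
qed

lemma L2_inner_tendsto:
  assumes f: "\<And>m. f m \<in> L2 M" "f' \<in> L2 M" and fl: "(\<lambda>m. L2_norm M (\<lambda>x. f m x - f' x)) \<longlonglongrightarrow> 0"
    and g: "\<And>m. g m \<in> L2 M" "g' \<in> L2 M" and gl: "(\<lambda>m. L2_norm M (\<lambda>x. g m x - g' x)) \<longlonglongrightarrow> 0"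
  shows "(\<lambda>m. L2_inner M (f m) (g m)) \<longlonglongrightarrow> L2_inner M f' g'"
proof (rule LIM_zero_cancel, rule Lim_null_comparison)
  show "(\<lambda>m. L2_norm M (\<lambda>x. f m x - f' x) * L2_norm M (g m) + L2_norm M f' * L2_norm M (\<lambda>x. g m x - g' x)) \<longlonglongrightarrow> 0"
    by (rule tendsto_eq_intros fl gl L2_norm_tendsto[OF g gl] refl | simp)+
  show "\<forall>\<^sub>F m in sequentially. norm (L2_inner M (f m) (g m) - L2_inner M f' g') \<le>
      L2_norm M (\<lambda>x. f m x - f' x) * L2_norm M (g m) + L2_norm M f' * L2_norm M (\<lambda>x. g m x - g' x)"
  proof (rule always_eventually, rule allI)
    fix m
    have "L2_inner M (f m) (g m) - L2_inner M f' g' =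
        L2_inner M (\<lambda>x. f m x - f' x) (g m) + L2_inner M f' (\<lambda>x. g m x - g' x)"
      using f g by (simp add: L2_inner_diff_left L2_inner_diff_right)
    then show "norm (L2_inner M (f m) (g m) - L2_inner M f' g') \<le>
      L2_norm M (\<lambda>x. f m x - f' x) * L2_norm M (g m) + L2_norm M f' * L2_norm M (\<lambda>x. g m x - g' x)"
      using L2_Cauchy_Schwarz[OF L2_diff[OF f(1)[of m] f(2)] g(1)[of m]]
        L2_Cauchy_Schwarz[OF f(2) L2_diff[OF g(1)[of m] g(2)]] by (simp add: abs_le_iff)
  qed
qed

lemma L2_norm_eq_0_AE:
  assumes "f \<in> L2 M" "L2_norm M f = 0"
  shows "AE x in M. f x = 0"
proof -
  have "(LINT x|M. (norm (f x))\<^sup>2) = 0"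
    using assms(2) by (simp add: L2_norm_square[symmetric])
  then show ?thesis
    using integral_nonneg_eq_0_iff_AE[OF L2_integrable_square[OF assms(1)]] by simp
qed

text \<open>Fatou and Tonelli arguments deliver bounds on nonnegative integrals with no
  integrability known in advance; this converts such a bound into membership and a norm
  estimate.\<close>

lemma L2_from_nn_integral:
  fixes f :: "'a \<Rightarrow> 'b::euclidean_space"
  assumes [measurable]: "f \<in> borel_measurable M" and le: "(\<integral>\<^sup>+x. ennreal ((norm (f x))\<^sup>2) \<partial>M) \<le> ennreal c" and "c \<ge> 0"
  shows "f \<in> L2 M" "(L2_norm M f)\<^sup>2 \<le> c"
proof -
  have i: "integrable M (\<lambda>x. (norm (f x))\<^sup>2)"
    using le by (auto simp: integrable_iff_bounded ennreal_less_top intro: le_less_trans)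
  show "f \<in> L2 M" by (rule L2I) (use i in measurable)
  have "ennreal (LINT x|M. (norm (f x))\<^sup>2) \<le> ennreal c"
    using le by (simp add: nn_integral_eq_integral[OF i])
  then show "(L2_norm M f)\<^sup>2 \<le> c"
    using \<open>c \<ge> 0\<close> by (simp add: L2_norm_square)
qed

lemma (in finite_measure) L1_le_L2:
  assumes "f \<in> L2 M"
  shows "(LINT x|M. norm (f x)) \<le> sqrt (measure M (space M)) * L2_norm M f"
  using L2_inner_le[of "\<lambda>x. norm (f x)" M "\<lambda>x. 1"] assms
  by (auto simp: L2_inner_def L2_norm_def mult.commute)

text \<open>Riesz-Fischer. Along a subsequence whose increments have \<open>L2\<close> norm at most
  \<open>(1/2)^k\<close> the increments are summable in \<open>L1\<close>, because the measure is
  finite, so the subsequence converges almost everywhere; Fatou's lemma transfers the Cauchy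
  estimate to the limit. It is used to obtain traces as limits on the boundary.\<close>

lemma (in finite_measure) L2_complete:
  fixes f :: "nat \<Rightarrow> 'a \<Rightarrow> 'b::euclidean_space"
  assumes f: "\<And>m. f m \<in> L2 M"
    and Cau: "\<And>e. e > 0 \<Longrightarrow> \<exists>N. \<forall>m\<ge>N. \<forall>n\<ge>N. L2_norm M (\<lambda>x. f m x - f n x) \<le> e"
  shows "\<exists>g\<in>L2 M. (\<lambda>m. L2_norm M (\<lambda>x. f m x - g x)) \<longlonglongrightarrow> 0"
proof -
  note [measurable] = L2_measurable[OF f]
  have "\<exists>N. \<forall>k. \<forall>m\<ge>N k. \<forall>n\<ge>N k. L2_norm M (\<lambda>x. f m x - f n x) \<le> (1/2)^k"
    by (rule choice) (use Cau in auto)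
  then obtain N where N: "\<And>k m n. m \<ge> N k \<Longrightarrow> n \<ge> N k \<Longrightarrow> L2_norm M (\<lambda>x. f m x - f n x) \<le> (1/2)^k"
    by blast
  \<comment> \<open>The sum dominates every \<open>N j\<close> with \<open>j \<le> k\<close>, so
    \<open>r k\<close> is a threshold for all these accuracies at once.\<close>
  define r where "r k = (\<Sum>j\<le>k. N j)" for k
  have rN: "r k \<ge> N j" if "j \<le> k" for j k
    unfolding r_def using that by (intro member_le_sum) auto
  have r: "L2_norm M (\<lambda>x. f (r m) x - f (r n) x) \<le> (1/2)^k" if "k \<le> m" "k \<le> n" for k m n
    using that by (intro N rN) auto
  let ?C = "sqrt (measure M (space M))"
  have int: "(\<integral>\<^sup>+x. ennreal (norm (f (r (Suc k)) x - f (r k) x)) \<partial>M) \<le> ennreal (?C * (1/2)^k)" for k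
  proof -
    have d: "(\<lambda>x. f (r (Suc k)) x - f (r k) x) \<in> L2 M" by (intro L2_diff f)
    have "(\<integral>\<^sup>+x. ennreal (norm (f (r (Suc k)) x - f (r k) x)) \<partial>M) =
        ennreal (LINT x|M. norm (f (r (Suc k)) x - f (r k) x))"
      using L2_integrable[OF d] by (intro nn_integral_eq_integral) auto
    also have "\<dots> \<le> ennreal (?C * (1/2)^k)"
      by (intro ennreal_leI order.trans[OF L1_le_L2[OF d]] mult_left_mono r) auto
    finally show ?thesis .
  qed
  have "(\<integral>\<^sup>+x. (\<Sum>k. ennreal (norm (f (r (Suc k)) x - f (r k) x))) \<partial>M) =
      (\<Sum>k. \<integral>\<^sup>+x. ennreal (norm (f (r (Suc k)) x - f (r k) x)) \<partial>M)"
    by (rule nn_integral_suminf) measurable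
  also have "\<dots> \<le> (\<Sum>k. ennreal (?C * (1/2)^k))"
    by (intro suminf_le int) auto
  also have "\<dots> = ennreal (\<Sum>k. ?C * (1/2)^k)"
    by (intro suminf_ennreal2) (auto intro!: summable_mult summable_geometric)
  finally have "(\<integral>\<^sup>+x. (\<Sum>k. ennreal (norm (f (r (Suc k)) x - f (r k) x))) \<partial>M) \<noteq> \<infinity>"
    by (auto simp: top_unique)
  then have "AE x in M. (\<Sum>k. ennreal (norm (f (r (Suc k)) x - f (r k) x))) \<noteq> \<infinity>"
    by (intro nn_integral_PInf_AE) measurable
  then have conv: "AE x in M. convergent (\<lambda>k. f (r k) x)"
  proof eventually_elim
    fix x assume "(\<Sum>k. ennreal (norm (f (r (Suc k)) x - f (r k) x))) \<noteq> \<infinity>"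
    then have "summable (\<lambda>k. norm (f (r (Suc k)) x - f (r k) x))"
      by (intro summable_suminf_not_top) auto
    then have "summable (\<lambda>k. f (r (Suc k)) x - f (r k) x)"
      by (rule summable_norm_cancel)
    then have "convergent (\<lambda>n. \<Sum>k<n. f (r (Suc k)) x - f (r k) x)"
      by (simp add: summable_iff_convergent)
    then have "convergent (\<lambda>n. f (r n) x - f (r 0) x)"
      by (simp add: sum_lessThan_telescope[of "\<lambda>k. f (r k) x"])
    then show "convergent (\<lambda>n. f (r n) x)"
      using convergent_add[OF _ convergent_const[of "f (r 0) x"]] by fastforce
  qed
  define g where "g x = lim (\<lambda>k. f (r k) x)" for x
  have [measurable]: "g \<in> borel_measurable M"
    unfolding g_def by (rule borel_measurable_lim_metric) measurable
  have lim: "AE x in M. (\<lambda>k. f (r k) x) \<longlonglongrightarrow> g x"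
    using conv by eventually_elim (simp add: g_def convergent_LIMSEQ_iff)
  \<comment> \<open>Fatou: the squared distance to \<open>g\<close> is almost everywhere the limit
    inferior of the squared distances to the subsequence, and these are integrably small once
    \<open>k \<ge> j\<close>.\<close>
  have bound: "(\<integral>\<^sup>+x. ennreal ((norm (f m x - g x))\<^sup>2) \<partial>M) \<le> ennreal (((1/2)^j)\<^sup>2)" if "m \<ge> N j" for m j
  proof -
    have "(\<integral>\<^sup>+x. ennreal ((norm (f m x - g x))\<^sup>2) \<partial>M) =
        (\<integral>\<^sup>+x. liminf (\<lambda>k. ennreal ((norm (f m x - f (r k) x))\<^sup>2)) \<partial>M)"
    proof (rule nn_integral_cong_AE)
      show "AE x in M. ennreal ((norm (f m x - g x))\<^sup>2) = liminf (\<lambda>k. ennreal ((norm (f m x - f (r k) x))\<^sup>2))"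
        using lim
      proof eventually_elim
        fix x assume "(\<lambda>k. f (r k) x) \<longlonglongrightarrow> g x"
        then have "(\<lambda>k. ennreal ((norm (f m x - f (r k) x))\<^sup>2)) \<longlonglongrightarrow> ennreal ((norm (f m x - g x))\<^sup>2)"
          by (intro tendsto_intros tendsto_ennrealI)
        then show "ennreal ((norm (f m x - g x))\<^sup>2) = liminf (\<lambda>k. ennreal ((norm (f m x - f (r k) x))\<^sup>2))"
          by (intro lim_imp_Liminf[symmetric]) auto
      qed
    qed
    also have "\<dots> \<le> liminf (\<lambda>k. \<integral>\<^sup>+x. ennreal ((norm (f m x - f (r k) x))\<^sup>2) \<partial>M)"
      by (rule nn_integral_liminf) measurable
    also have "\<dots> \<le> ennreal (((1/2)^j)\<^sup>2)"
    proof -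
      have "(\<integral>\<^sup>+x. ennreal ((norm (f m x - f (r k) x))\<^sup>2) \<partial>M) \<le> ennreal (((1/2)^j)\<^sup>2)" if "k \<ge> j" for k
      proof -
        have d: "(\<lambda>x. f m x - f (r k) x) \<in> L2 M" by (intro L2_diff f)
        have "(\<integral>\<^sup>+x. ennreal ((norm (f m x - f (r k) x))\<^sup>2) \<partial>M) = ennreal ((L2_norm M (\<lambda>x. f m x - f (r k) x))\<^sup>2)"
          using L2_integrable_square[OF d] by (subst nn_integral_eq_integral) (auto simp: L2_norm_square)
        also have "\<dots> \<le> ennreal (((1/2)^j)\<^sup>2)"
          using \<open>m \<ge> N j\<close> rN[OF that] by (intro ennreal_leI power_mono N) auto
        finally show ?thesis .
      qed
      then have "eventually (\<lambda>k. (\<integral>\<^sup>+x. ennreal ((norm (f m x - f (r k) x))\<^sup>2) \<partial>M) \<le> ennreal (((1/2)^j)\<^sup>2)) sequentially"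
        by (rule eventually_sequentiallyI)
      then have "limsup (\<lambda>k. \<integral>\<^sup>+x. ennreal ((norm (f m x - f (r k) x))\<^sup>2) \<partial>M) \<le> ennreal (((1/2)^j)\<^sup>2)"
        by (rule Limsup_bounded)
      with Liminf_le_Limsup[of sequentially "\<lambda>k. \<integral>\<^sup>+x. ennreal ((norm (f m x - f (r k) x))\<^sup>2) \<partial>M"]
      show ?thesis by (auto intro: order.trans)
    qed
    finally show ?thesis .
  qed
  have d: "(\<lambda>x. f m x - g x) \<in> L2 M" and dn: "L2_norm M (\<lambda>x. f m x - g x) \<le> (1/2)^j" if "m \<ge> N j" for m j
  proof -
    show "(\<lambda>x. f m x - g x) \<in> L2 M"
      by (rule L2_from_nn_integral(1)[OF _ bound[OF that]]) auto
    have "(L2_norm M (\<lambda>x. f m x - g x))\<^sup>2 \<le> ((1/2)^j)\<^sup>2"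
      by (rule L2_from_nn_integral(2)[OF _ bound[OF that]]) auto
    then show "L2_norm M (\<lambda>x. f m x - g x) \<le> (1/2)^j"
      by (rule power2_le_imp_le) simp
  qed
  have "g \<in> L2 M"
    using L2_diff[OF f[of "N 0"] d[of 0 "N 0"]] by simp
  moreover have "(\<lambda>m. L2_norm M (\<lambda>x. f m x - g x)) \<longlonglongrightarrow> 0"
  proof (rule LIMSEQ_I)
    fix e :: real assume "e > 0"
    then obtain j where "(1/2)^j < e"
      using real_arch_pow_inv[of e "1/2"] by auto
    then have "\<forall>m\<ge>N j. norm (L2_norm M (\<lambda>x. f m x - g x) - 0) < e"
      using dn by (fastforce intro: le_less_trans)
    then show "\<exists>no. \<forall>n\<ge>no. norm (L2_norm M (\<lambda>x. f n x - g x) - 0) < e" by blast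
  qed
  ultimately show ?thesis by blast
qed

section \<open>Fubini and Green on the cube\<close>

lemma face_proj_component [simp]: "face_proj i c x $ j = (if j = i then c else x $ j)"
  by (simp add: face_proj_def)

lemma face_proj_alt: "face_proj i c x = x + (c - x $ i) *\<^sub>R axis i 1"
  by (simp add: vec_eq_iff axis_def)

lemma face_proj_same [simp]: "face_proj i (x $ i) x = x"
  by (simp add: vec_eq_iff)

lemma face_proj_idem [simp]: "face_proj i s (face_proj i t x) = face_proj i s x"
  by (simp add: vec_eq_iff)

lemma mem_Omega: "x \<in> Omega \<longleftrightarrow> (\<forall>i. 0 \<le> x $ i \<and> x $ i \<le> 1)"
  by (simp add: mem_box_cart)

lemma face_proj_Omega: "x \<in> Omega \<Longrightarrow> 0 \<le> c \<Longrightarrow> c \<le> 1 \<Longrightarrow> face_proj i c x \<in> Omega"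
  by (simp add: mem_Omega)

lemma continuous_on_face_proj [continuous_intros]:
  "continuous_on S f \<Longrightarrow> continuous_on S g \<Longrightarrow> continuous_on S (\<lambda>x. face_proj i (f x) (g x))"
  unfolding face_proj_alt by (intro continuous_intros)

lemma borel_measurable_vec:
  fixes f :: "'a \<Rightarrow> real^'d"
  assumes "\<And>i. (\<lambda>x. f x $ i) \<in> borel_measurable M"
  shows "f \<in> borel_measurable M"
  unfolding borel_measurable_euclidean_space[where f = f]
  using assms by (auto simp: Basis_vec_def inner_axis)

lemma borel_measurable_vec_nth [measurable (raw)]:
  "f \<in> borel_measurable M \<Longrightarrow> (\<lambda>x. (f x :: real^'d) $ i) \<in> borel_measurable M"
  by (rule borel_measurable_continuous_on[OF linear_continuous_on[OF bounded_linear_vec_nth]])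

interpretation Om: finite_measure "lebesgue_on (Omega :: (real^'d) set)"
  by (rule finite_measureI) (simp add: emeasure_restrict_space emeasure_lborel_cbox_eq)

lemma prod_Basis_cart: "(\<Prod>b\<in>(Basis :: (real^'d) set). f b) = (\<Prod>i\<in>UNIV. f (axis i 1))"
proof -
  have B: "Basis = (\<lambda>i::'d. axis i (1::real)) ` UNIV"
    by (auto simp: Basis_vec_def)
  have I: "inj (\<lambda>i::'d. axis i (1::real))"
    by (auto simp: inj_on_def axis_eq_axis)
  show ?thesis
    using prod.reindex[OF I, of f] unfolding B by simp
qed

lemma measure_Omega [simp]: "measure (lebesgue_on (Omega :: (real^'d) set)) Omega = 1"
proof -
  have "measure lborel (Omega :: (real^'d) set) = 1"
    by (subst measure_lborel_cbox_eq, subst prod_Basis_cart) (auto simp: inner_axis Basis_vec_def)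
  then show ?thesis
    by (simp add: measure_restrict_space)
qed

lemma measurable_on_Omega [measurable (raw)]:
  "f \<in> borel_measurable borel \<Longrightarrow> f \<in> borel_measurable (lebesgue_on Omega)"
  by (simp add: measurable_completion measurable_restrict_space1)

lemma continuous_on_UNIV_measurable [intro]:
  "continuous_on UNIV f \<Longrightarrow> f \<in> borel_measurable (lebesgue_on Omega)"
  by (intro measurable_on_Omega borel_measurable_continuous_onI)

lemma space_Omega [simp]: "space (lebesgue_on Omega) = Omega"
  by (simp add: space_restrict_space)

lemma AE_OmegaI: "(\<And>x. x \<in> Omega \<Longrightarrow> P x) \<Longrightarrow> AE x in lebesgue_on Omega. P x"
  by (rule AE_I2) simp

lemma continuous_Omega_bounded:
  fixes f :: "real^'d \<Rightarrow> 'b::real_normed_vector"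
  assumes "continuous_on UNIV f" obtains B where "B > 0" "\<And>x. x \<in> Omega \<Longrightarrow> norm (f x) \<le> B"
proof -
  have "compact (f ` Omega)"
    by (intro compact_continuous_image continuous_on_subset[OF assms]) auto
  then show ?thesis
    using that compact_imp_bounded bounded_pos by (metis imageI)
qed

lemma continuous_L2 [intro]: 
  fixes f :: "real^'d \<Rightarrow> 'b::euclidean_space"
  assumes "continuous_on UNIV f" shows "f \<in> L2 (lebesgue_on Omega)"
proof -
  obtain B where "B > 0" "\<And>x. x \<in> Omega \<Longrightarrow> norm (f x) \<le> B"
    using continuous_Omega_bounded[OF assms] by blast
  then show ?thesis
    by (intro Om.L2_bounded[of f B] AE_OmegaI continuous_on_UNIV_measurable assms)
qed

lemma continuous_integrable [intro]: 
  fixes f :: "real^'d \<Rightarrow> real"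
  assumes "continuous_on UNIV f" shows "integrable (lebesgue_on Omega) f"
  by (intro Om.L2_integrable continuous_L2 assms)

lemma nn_integral_Omega:
  "(\<integral>\<^sup>+x. f x \<partial>lebesgue_on Omega) = (\<integral>\<^sup>+x. f x * indicator Omega x \<partial>lborel)"
  by (simp add: nn_integral_restrict_space nn_integral_completion)

text \<open>The set, half closed in direction \<open>i\<close> and open in the others, lies between
  the open and the closed box with the same corners, which have equal volume; direction
  \<open>i\<close> has length 1 and drops out of the product.\<close>

lemma emeasure_slab:
  fixes l u :: "real^'d"
  assumes lu: "\<And>j. l $ j \<le> u $ j"
  shows "emeasure lborel {x :: real^'d. x $ i \<in> {0..1} \<and> (\<forall>j. j \<noteq> i \<longrightarrow> l $ j < x $ j \<and> x $ j < u $ j)} =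
    ennreal (\<Prod>j\<in>UNIV - {i}. u $ j - l $ j)" (is "emeasure _ ?S = _")
proof -
  let ?l = "face_proj i 0 l" and ?u = "face_proj i 1 u"
  have p: "(\<Prod>b\<in>Basis. (?u - ?l) \<bullet> b) = (\<Prod>j\<in>UNIV - {i}. u $ j - l $ j)"
  proof -
    have "(\<Prod>b\<in>Basis. (?u - ?l) \<bullet> b) = (\<Prod>j\<in>UNIV. if j = i then 1 else u $ j - l $ j)"
      unfolding prod_Basis_cart by (intro prod.cong) (auto simp: inner_axis)
    also have "\<dots> = (\<Prod>j\<in>UNIV - {i}. u $ j - l $ j)"
      by (subst prod.remove[of _ i]) (auto intro!: prod.cong)
    finally show ?thesis .
  qed
  have le: "\<forall>b\<in>Basis. ?l \<bullet> b \<le> ?u \<bullet> b"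
    using lu by (auto simp: Basis_vec_def inner_axis)
  have [measurable]: "?S \<in> sets borel" by measurable
  have "emeasure lborel (box ?l ?u) \<le> emeasure lborel ?S"
    by (intro emeasure_mono) (auto simp: mem_box_cart less_imp_le split: if_splits)
  moreover have "emeasure lborel ?S \<le> emeasure lborel (cbox ?l ?u)"
    by (intro emeasure_mono) (auto simp: mem_box_cart less_imp_le)
  ultimately show ?thesis
    using le p by (simp add: emeasure_lborel_box_eq emeasure_lborel_cbox_eq)
qed

lemma measurable_resample:
  "(\<lambda>(t, x). face_proj i t x) \<in> borel_measurable (lborel \<Otimes>\<^sub>M restrict_space lborel S)"
proof -
  have "snd \<in> (lborel :: real measure) \<Otimes>\<^sub>M restrict_space lborel S \<rightarrow>\<^sub>M borel"
    by (rule measurable_compose[OF measurable_snd]) (simp add: measurable_restrict_space1)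
  moreover have "fst \<in> (lborel :: real measure) \<Otimes>\<^sub>M restrict_space lborel S \<rightarrow>\<^sub>M borel"
    by (rule measurable_compose[OF measurable_fst]) simp
  ultimately show ?thesis
    unfolding face_proj_alt case_prod_unfold by measurable
qed

text \<open>Lebesgue measure is determined by its values on boxes. The preimage of a box is an
  interval for \<open>t\<close> times a slab for \<open>x\<close>, and since the discarded
  coordinate ranges over a unit interval, the two measures multiply to the volume of the box. This
  stands in for splitting \<open>real^'d\<close> into a line and its complement.\<close>

lemma resample_lborel:
  "distr (lborel \<Otimes>\<^sub>M restrict_space lborel {x :: real^'d. x $ i \<in> {0..1}}) borel
     (\<lambda>(t, x). face_proj i t x) = lborel" (is "distr (_ \<Otimes>\<^sub>M ?R) _ _ = _")
proof (rule lborel_eqI[symmetric])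
  interpret R: sigma_finite_measure ?R
    by (intro sigma_finite_measure_restrict_space lborel.sigma_finite_measure_axioms) simp
  note m = measurable_resample[of i "{x. x $ i \<in> {0..1}}"]
  fix l u :: "real^'d" assume "\<And>b. b \<in> Basis \<Longrightarrow> l \<bullet> b \<le> u \<bullet> b"
  then have lu: "l $ j \<le> u $ j" for j
    by (auto simp: cart_eq_inner_axis)
  let ?S = "{x :: real^'d. x $ i \<in> {0..1} \<and> (\<forall>j. j \<noteq> i \<longrightarrow> l $ j < x $ j \<and> x $ j < u $ j)}"
  have [measurable]: "?S \<in> sets borel" by measurable
  have "emeasure (distr (lborel \<Otimes>\<^sub>M ?R) borel (\<lambda>(t, x). face_proj i t x)) (box l u) =
      emeasure (lborel \<Otimes>\<^sub>M ?R) ((\<lambda>(t, x). face_proj i t x) -` box l u \<inter> space (lborel \<Otimes>\<^sub>M ?R))"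
    by (rule emeasure_distr[OF m]) simp
  also have "(\<lambda>(t, x). face_proj i t x) -` box l u \<inter> space (lborel \<Otimes>\<^sub>M ?R) = {l $ i<..<u $ i} \<times> ?S"
    by (auto simp: space_pair_measure space_restrict_space mem_box_cart split: if_splits)
  also have "emeasure (lborel \<Otimes>\<^sub>M ?R) \<dots> = emeasure lborel {l $ i<..<u $ i} * emeasure ?R ?S"
    by (rule R.emeasure_pair_measure_Times) (auto simp: sets_restrict_space_iff)
  also have "emeasure ?R ?S = emeasure lborel ?S"
    by (rule emeasure_restrict_space) auto
  also have "\<dots> = ennreal (\<Prod>j\<in>UNIV - {i}. u $ j - l $ j)"
    by (rule emeasure_slab[OF lu])
  also have "emeasure lborel {l $ i<..<u $ i} * \<dots> = ennreal ((u $ i - l $ i) * (\<Prod>j\<in>UNIV - {i}. u $ j - l $ j))"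
    using lu by (simp add: ennreal_mult prod_nonneg)
  also have "(u $ i - l $ i) * (\<Prod>j\<in>UNIV - {i}. u $ j - l $ j) = (\<Prod>b\<in>Basis. (u - l) \<bullet> b)"
    unfolding prod_Basis_cart by (subst prod.remove[of UNIV i]) (auto simp: inner_axis)
  finally show "emeasure (distr (lborel \<Otimes>\<^sub>M ?R) borel (\<lambda>(t, x). face_proj i t x)) (box l u) =
      ennreal (\<Prod>b\<in>Basis. (u - l) \<bullet> b)" .
qed simp

text \<open>
  Fubini's theorem in the form that suits \<open>boundary_measure\<close>: resampling the coordinate
  \<open>x $ i\<close> uniformly preserves the integral over the cube.
\<close>

lemma nn_integral_resample:
  fixes f :: "real^'d \<Rightarrow> ennreal"
  assumes [measurable]: "f \<in> borel_measurable borel"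
  shows "(\<integral>\<^sup>+x. f x \<partial>lebesgue_on Omega) =
    (\<integral>\<^sup>+x. (\<integral>\<^sup>+t. f (face_proj i t x) * indicator {0..1} t \<partial>lborel) \<partial>lebesgue_on Omega)"
proof -
  let ?R = "restrict_space lborel {x :: real^'d. x $ i \<in> {0..1}}"
  interpret R: sigma_finite_measure ?R
    by (intro sigma_finite_measure_restrict_space lborel.sigma_finite_measure_axioms) simp
  interpret P: pair_sigma_finite lborel ?R ..
  note m = measurable_resample[of i "{x. x $ i \<in> {0..1}}"]
  have "(\<integral>\<^sup>+x. f x \<partial>lebesgue_on Omega) = (\<integral>\<^sup>+x. f x * indicator Omega x \<partial>lborel)"
    by (rule nn_integral_Omega)
  also have "\<dots> = (\<integral>\<^sup>+p. (case p of (t, x) \<Rightarrow> f (face_proj i t x) * indicator Omega (face_proj i t x)) \<partial>(lborel \<Otimes>\<^sub>M ?R))"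
    by (subst resample_lborel[of i, symmetric], subst nn_integral_distr[OF m]) (auto simp: case_prod_unfold)
  also have "\<dots> = (\<integral>\<^sup>+x. (\<integral>\<^sup>+t. f (face_proj i t x) * indicator Omega (face_proj i t x) \<partial>lborel) \<partial>?R)"
    using measurable_compose[OF m, of "\<lambda>x. f x * indicator Omega x"]
    by (subst P.nn_integral_snd[symmetric]) (auto simp: case_prod_unfold)
  also have "\<dots> = (\<integral>\<^sup>+x. (\<integral>\<^sup>+t. f (face_proj i t x) * indicator Omega (face_proj i t x) \<partial>lborel) * indicator {x. x $ i \<in> {0..1}} x \<partial>lborel)"
    by (subst nn_integral_restrict_space) auto
  also have "\<dots> = (\<integral>\<^sup>+x. (\<integral>\<^sup>+t. f (face_proj i t x) * indicator {0..1} t \<partial>lborel) * indicator Omega x \<partial>lborel)"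
  proof (rule nn_integral_cong)
    fix x :: "real^'d"
    \<comment> \<open>For \<open>x $ i\<close> in the unit interval, membership of the resampled
      point in the cube separates into a condition on \<open>t\<close> and one on \<open>x\<close>;
      otherwise both sides of the goal vanish.\<close>
    have "indicator Omega (face_proj i t x) = (indicator {0..1} t * indicator Omega x :: ennreal)"
      if "x $ i \<in> {0..1}" for t
      using that by (auto simp: indicator_def mem_Omega split: if_splits)
    moreover have "indicator Omega x = (0::ennreal)" if "x $ i \<notin> {0..1}"
      using that by (auto simp: indicator_def mem_Omega)
    ultimately show "(\<integral>\<^sup>+t. f (face_proj i t x) * indicator Omega (face_proj i t x) \<partial>lborel) * indicator {x. x $ i \<in> {0..1}} x =
        (\<integral>\<^sup>+t. f (face_proj i t x) * indicator {0..1} t \<partial>lborel) * indicator Omega x"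
      by (cases "x $ i \<in> {0..1}")
         (auto simp: mult.assoc[symmetric] nn_integral_multc face_proj_alt)
  qed
  finally show ?thesis by (simp add: nn_integral_Omega)
qed

text \<open>The gauge integral is chosen so that the fundamental theorem of calculus applies
  directly along the line. The value does not depend on \<open>x $ i\<close>.\<close>

definition coord_avg :: "'d \<Rightarrow> (real^'d \<Rightarrow> real) \<Rightarrow> real^'d \<Rightarrow> real" where
  "coord_avg i F x = integral {0..1} (\<lambda>t. F (face_proj i t x))"

lemma continuous_on_line:
  "continuous_on UNIV F \<Longrightarrow> continuous_on S (\<lambda>t. F (face_proj i t x))"
  by (rule continuous_on_compose2[of UNIV F]) (auto intro!: continuous_intros)

lemma line_integrable [intro]:
  fixes F :: "real^'d \<Rightarrow> real"
  shows "continuous_on UNIV F \<Longrightarrow> (\<lambda>t. F (face_proj i t x)) integrable_on {a..b}"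
  by (intro integrable_continuous_real continuous_on_line)

lemma continuous_on_coord_avg [intro]:
  assumes "continuous_on UNIV F" shows "continuous_on UNIV (coord_avg i F)"
proof -
  have "continuous_on (UNIV \<times> cbox 0 1) (\<lambda>(x, t::real). F (face_proj i t x))"
    unfolding case_prod_unfold
    by (rule continuous_on_compose2[of UNIV F]) (auto intro!: continuous_intros assms)
  from integral_continuous_on_param[OF this] show ?thesis
    by (simp add: coord_avg_def [abs_def])
qed

text \<open>Bridge from the gauge integral in \<open>coord_avg\<close> to the Lebesgue integral that
  occurs in the resampling formula.\<close>

lemma nn_integral_line:
  assumes F: "continuous_on UNIV F" and nn: "\<And>t. 0 \<le> t \<Longrightarrow> t \<le> 1 \<Longrightarrow> 0 \<le> F (face_proj i t x)"
  shows "(\<integral>\<^sup>+t. ennreal (F (face_proj i t x)) * indicator {0..1} t \<partial>lborel) = ennreal (coord_avg i F x)"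
proof -
  have "(\<lambda>t. F (face_proj i t x)) \<in> borel_measurable borel"
    by (intro borel_measurable_continuous_onI continuous_on_line F)
  then have "(\<integral>\<^sup>+t\<in>{0..1}. ennreal (F (face_proj i t x)) \<partial>lborel) = ennreal (coord_avg i F x)"
    using line_integrable[OF F, of i x 0 1] nn
    by (intro nn_integral_has_integral_lebesgue') (auto simp: coord_avg_def has_integral_integral)
  then show ?thesis .
qed

text \<open>Resampling speaks about nonnegative integrals. A continuous function is bounded on the
  cube, so adding a constant makes it nonnegative there, and averaging over a unit interval
  reproduces the constant.\<close>

lemma integral_coord_avg:
  assumes F: "continuous_on UNIV F"
  shows "(LINT x|lebesgue_on Omega. coord_avg i F x) = (LINT x|lebesgue_on Omega. F x)"
proof -
  have nonneg: "(LINT x|lebesgue_on Omega. coord_avg i F x) = (LINT x|lebesgue_on Omega. F x)"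
    if F: "continuous_on UNIV F" and nn: "\<And>x. x \<in> Omega \<Longrightarrow> F x \<ge> 0" for F
  proof -
    have [measurable]: "F \<in> borel_measurable borel"
      by (rule borel_measurable_continuous_onI[OF F])
    have avg_nn: "coord_avg i F x \<ge> 0" if "x \<in> Omega" for x
      unfolding coord_avg_def using that
      by (intro integral_nonneg line_integrable F) (auto intro!: nn face_proj_Omega)
    have "ennreal (LINT x|lebesgue_on Omega. F x) = (\<integral>\<^sup>+x. ennreal (F x) \<partial>lebesgue_on Omega)"
      by (rule nn_integral_eq_integral[symmetric]) (auto intro!: continuous_integrable F AE_OmegaI nn)
    also have "\<dots> = (\<integral>\<^sup>+x. (\<integral>\<^sup>+t. ennreal (F (face_proj i t x)) * indicator {0..1} t \<partial>lborel) \<partial>lebesgue_on Omega)"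
      by (rule nn_integral_resample) measurable
    also have "\<dots> = (\<integral>\<^sup>+x. ennreal (coord_avg i F x) \<partial>lebesgue_on Omega)"
      by (intro nn_integral_cong nn_integral_line F nn face_proj_Omega) auto
    also have "\<dots> = ennreal (LINT x|lebesgue_on Omega. coord_avg i F x)"
      by (rule nn_integral_eq_integral) (auto intro!: continuous_integrable continuous_on_coord_avg F AE_OmegaI avg_nn)
    finally show ?thesis
      by (subst (asm) ennreal_inj) (auto intro!: integral_nonneg_AE AE_OmegaI nn avg_nn)
  qed
  obtain B where B: "B > 0" "\<And>x. x \<in> Omega \<Longrightarrow> norm (F x) \<le> B"
    using continuous_Omega_bounded[OF F] by blast
  have B': "F x + B \<ge> 0" if "x \<in> Omega" for x
    using B(2)[OF that] by simp
  have avg: "coord_avg i (\<lambda>x. F x + B) x = coord_avg i F x + B" for x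
    unfolding coord_avg_def by (subst Henstock_Kurzweil_Integration.integral_add) (auto intro: line_integrable F)
  have "(LINT x|lebesgue_on Omega. coord_avg i (\<lambda>x. F x + B) x) = (LINT x|lebesgue_on Omega. F x + B)"
    by (rule nonneg) (auto intro!: continuous_intros F B')
  then show ?thesis
    using continuous_integrable[OF F] continuous_integrable[OF continuous_on_coord_avg[OF F]]
    by (simp add: avg)
qed

section \<open>Classical partial derivatives and their integrals\<close>

lemma C1_iff: "C_k (Suc 0) F \<longleftrightarrow> (\<forall>x. F differentiable at x) \<and> (\<forall>i. continuous_on UNIV (partial i F))"
  by simp

lemma C1_continuous: "C_k (Suc 0) F \<Longrightarrow> continuous_on UNIV F"
  by (auto simp: continuous_on_eq_continuous_at differentiable_imp_continuous_within)

lemma partial_line: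
  assumes "F differentiable at (face_proj i t x)"
  shows "((\<lambda>t. F (face_proj i t x)) has_real_derivative partial i F (face_proj i t x)) (at t)"
proof -
  have D: "(F has_derivative frechet_derivative F (at (face_proj i t x))) (at (face_proj i t x))"
    using assms by (simp add: frechet_derivative_works[symmetric])
  interpret bounded_linear "frechet_derivative F (at (face_proj i t x))"
    using D by (rule has_derivative_bounded_linear)
  have "((\<lambda>t. face_proj i t x) has_derivative (\<lambda>h. h *\<^sub>R axis i 1)) (at t)"
    unfolding face_proj_alt by (auto intro!: derivative_eq_intros)
  from diff_chain_at[OF this D] show ?thesis
    by (simp add: has_field_derivative_def partial_def scaleR o_def mult_commute_abs)
qed

lemma partial_eqI: 
  assumes "(F has_derivative D) (at x)" shows "partial i F x = D (axis i 1)"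
  using frechet_derivative_at[OF assms] by (simp add: partial_def)

lemma differentiable_has_partial:
  assumes "F differentiable at x"
  shows "(F has_derivative (\<lambda>h. \<Sum>i\<in>UNIV. h $ i * partial i F x)) (at x)"
proof -
  have D: "(F has_derivative frechet_derivative F (at x)) (at x)"
    using assms by (simp add: frechet_derivative_works[symmetric])
  interpret bounded_linear "frechet_derivative F (at x)"
    using D by (rule has_derivative_bounded_linear)
  have "frechet_derivative F (at x) h = (\<Sum>i\<in>UNIV. h $ i * partial i F x)" for h
  proof -
    have "frechet_derivative F (at x) h = frechet_derivative F (at x) (\<Sum>i\<in>UNIV. h $ i *\<^sub>R axis i 1)"
      using basis_expansion[of h] by (simp add: scalar_mult_eq_scaleR)
    also have "\<dots> = (\<Sum>i\<in>UNIV. h $ i * partial i F x)"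
      by (simp add: sum scaleR partial_def)
    finally show ?thesis .
  qed
  then have "frechet_derivative F (at x) = (\<lambda>h. \<Sum>i\<in>UNIV. h $ i * partial i F x)" by auto
  then show ?thesis using D by simp
qed

lemma partial_mult:
  assumes "F differentiable at x" "G differentiable at x"
  shows "partial i (\<lambda>x. F x * G x) x = partial i F x * G x + F x * partial i G x"
  using has_derivative_mult[OF differentiable_has_partial[OF assms(1)] differentiable_has_partial[OF assms(2)]]
  by (subst partial_eqI, assumption) (simp add: axis_def if_distrib[of "\<lambda>c. c * _"] cong: if_cong)

lemma C1_mult:
  assumes F: "C_k (Suc 0) F" and G: "C_k (Suc 0) G"
  shows "C_k (Suc 0) (\<lambda>x. F x * G x)"
  unfolding C1_iff
proof safe
  have d: "F differentiable at x" "G differentiable at x" for x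
    using F G by (auto simp: C1_iff)
  show "(\<lambda>x. F x * G x) differentiable at x" for x
    using d by (intro differentiable_mult)
  have "partial i (\<lambda>x. F x * G x) = (\<lambda>x. partial i F x * G x + F x * partial i G x)" for i
    by (intro ext partial_mult d)
  then show "continuous_on UNIV (partial i (\<lambda>x. F x * G x))" for i
    using F G C1_continuous[OF F] C1_continuous[OF G] by (auto intro!: continuous_intros)
qed

lemma partial_coord:
  "partial i (\<lambda>x. a * x $ j + b) x = (if i = j then a else 0)"
  by (subst partial_eqI[where D = "\<lambda>h. a * h $ j"])
     (auto intro!: derivative_eq_intros bounded_linear.has_derivative[OF bounded_linear_vec_nth] simp: axis_def)

lemma C1_coord: "C_k (Suc 0) (\<lambda>x. a * x $ j + b)"
  unfolding C1_iff
proof safe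
  show "(\<lambda>x. a * x $ j + b) differentiable at x" for x :: "real^'a"
    by (intro differentiable_add differentiable_mult differentiable_const
        bounded_linear_imp_differentiable bounded_linear_vec_nth)
  show "continuous_on UNIV (partial i (\<lambda>x. a * x $ j + b))" for i
    unfolding partial_coord [abs_def] by simp
qed

text \<open>By the fundamental theorem the average of \<open>partial i F\<close> along a line in
  direction \<open>i\<close> is the difference of the two end values, and averaging leaves the
  integral over the cube unchanged.\<close>

lemma integral_partial:
  assumes F: "C_k (Suc 0) F"
  shows "(LINT x|lebesgue_on Omega. partial i F x) =
    (LINT x|lebesgue_on Omega. F (face_proj i 1 x) - F (face_proj i 0 x))"
proof -
  have "coord_avg i (partial i F) x = F (face_proj i 1 x) - F (face_proj i 0 x)" for x
    unfolding coord_avg_def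
    by (rule integral_unique, rule fundamental_theorem_of_calculus)
       (use F in \<open>auto simp: has_real_derivative_iff_has_vector_derivative[symmetric]
         intro!: has_field_derivative_at_within partial_line\<close>)
  then show ?thesis
    using integral_coord_avg[of "partial i F" i] F by auto
qed

section \<open>Integration over the boundary and Green's formula for C1 functions\<close>

interpretation bd: finite_measure "boundary_measure :: (real^'d) measure"
proof (rule finite_measureI)
  have "(UNIV :: (real^'d) set) \<in> sets borel" by simp
  from emeasure_boundary_measure[OF this]
  show "emeasure (boundary_measure :: (real^'d) measure) (space boundary_measure) \<noteq> \<infinity>"
    by (auto simp: boundary_measure_def emeasure_lborel_cbox_eq ennreal_mult_eq_top_iff)
qed

lemma sets_boundary [measurable_cong, simp]: "sets boundary_measure = sets borel"
  by (simp add: boundary_measure_def)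

lemma nn_integral_boundary:
  fixes f :: "real^'d \<Rightarrow> ennreal"
  assumes [measurable]: "f \<in> borel_measurable borel"
  shows "(\<integral>\<^sup>+x. f x \<partial>boundary_measure) =
    (\<Sum>i\<in>UNIV. \<Sum>c\<in>{0, 1}. \<integral>\<^sup>+x. f (face_proj i c x) \<partial>lebesgue_on Omega)"
proof -
  let ?C = "count_space (UNIV \<times> {0, 1::real}) :: ('d \<times> real) measure"
  let ?R = "restrict_space lborel (Omega :: (real^'d) set)"
  interpret R: sigma_finite_measure ?R
    by (intro sigma_finite_measure_restrict_space lborel.sigma_finite_measure_axioms) simp
  note m = measurable_compose[OF measurable_face_proj_pair assms]
  have "(\<integral>\<^sup>+x. f x \<partial>boundary_measure) =
      (\<integral>\<^sup>+p. f ((\<lambda>((i, c), x). face_proj i c x) p) \<partial>(?C \<Otimes>\<^sub>M ?R))"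
    unfolding boundary_measure_def by (rule nn_integral_distr[OF measurable_face_proj_pair]) simp
  also have "\<dots> = (\<integral>\<^sup>+ic. \<integral>\<^sup>+x. f ((\<lambda>((i, c), x). face_proj i c x) (ic, x)) \<partial>?R \<partial>?C)"
    by (rule R.nn_integral_fst[OF m, symmetric])
  also have "\<dots> = (\<Sum>ic\<in>UNIV \<times> {0, 1}. \<integral>\<^sup>+x. f ((\<lambda>((i, c), x). face_proj i c x) (ic, x)) \<partial>?R)"
    by (rule nn_integral_count_space_finite) simp
  also have "\<dots> = (\<Sum>(i, c)\<in>UNIV \<times> {0, 1}. \<integral>\<^sup>+x. f (face_proj i c x) \<partial>lebesgue_on Omega)"
    by (intro sum.cong refl)
       (auto simp: nn_integral_Omega nn_integral_restrict_space)
  finally show ?thesis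
    by (simp only: sum.cartesian_product)
qed

text \<open>The nonnegative formula applied to the absolute value gives integrability; applied to
  the positive and negative parts it gives the value.\<close>

lemma integral_boundary:
  fixes f :: "real^'d \<Rightarrow> real"
  assumes [measurable]: "f \<in> borel_measurable borel"
    and int: "\<And>i c. c \<in> {0, 1} \<Longrightarrow> integrable (lebesgue_on Omega) (\<lambda>x. f (face_proj i c x))"
  shows "integrable boundary_measure f"
    and "(LINT x|boundary_measure. f x) = (\<Sum>i\<in>UNIV. \<Sum>c\<in>{0, 1}. LINT x|lebesgue_on Omega. f (face_proj i c x))"
proof -
  have fin: "(\<integral>\<^sup>+x. ennreal (norm (g x)) \<partial>boundary_measure) = 
     ennreal (\<Sum>i\<in>UNIV. \<Sum>c\<in>{0, 1}. LINT x|lebesgue_on Omega. norm (g (face_proj i c x)))"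
    if [measurable]: "g \<in> borel_measurable borel"
     and int: "\<And>i c. c \<in> {0, 1} \<Longrightarrow> integrable (lebesgue_on Omega) (\<lambda>x. g (face_proj i c x))" for g :: "real^'d \<Rightarrow> real"
  proof -
    have "(\<integral>\<^sup>+x. ennreal (norm (g x)) \<partial>boundary_measure) =
       (\<Sum>i\<in>UNIV. \<Sum>c\<in>{0, 1}. \<integral>\<^sup>+x. ennreal (norm (g (face_proj i c x))) \<partial>lebesgue_on Omega)"
      by (rule nn_integral_boundary) measurable
    also have "\<dots> = (\<Sum>i\<in>UNIV. \<Sum>c\<in>{0, 1}. ennreal (LINT x|lebesgue_on Omega. norm (g (face_proj i c x))))"
      using int by (intro sum.cong refl nn_integral_eq_integral) auto
    also have "\<dots> = ennreal (\<Sum>i\<in>UNIV. \<Sum>c\<in>{0, 1}. LINT x|lebesgue_on Omega. norm (g (face_proj i c x)))"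
      by (subst sum_ennreal[symmetric], force intro: sum_nonneg, intro sum.cong refl)
         (simp add: ennreal_plus[symmetric] del: ennreal_plus)
    finally show ?thesis .
  qed
  have m: "f \<in> borel_measurable boundary_measure" by measurable
  show i: "integrable boundary_measure f"
    using fin[OF assms] m by (simp add: integrable_iff_bounded)
  define p where "p x = max 0 (f x)" for x
  define q where "q x = max 0 (- f x)" for x
  have [measurable]: "p \<in> borel_measurable borel" "q \<in> borel_measurable borel"
    unfolding p_def q_def by measurable
  have pi: "integrable (lebesgue_on Omega) (\<lambda>x. p (face_proj i c x))"
       and qi: "integrable (lebesgue_on Omega) (\<lambda>x. q (face_proj i c x))" if "c \<in> {0, 1}" for i c
    unfolding p_def q_def using int[OF that, of i] by auto
  have ib: "integrable boundary_measure p" "integrable boundary_measure q"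
    using i by (simp_all add: p_def [abs_def] q_def [abs_def])
  have P: "(LINT x|boundary_measure. g x) = (\<Sum>i\<in>UNIV. \<Sum>c\<in>{0, 1}. LINT x|lebesgue_on Omega. g (face_proj i c x))"
    if [measurable]: "g \<in> borel_measurable borel" and g: "integrable boundary_measure g" "\<And>x. g x \<ge> 0"
     and int: "\<And>i c. c \<in> {0, 1} \<Longrightarrow> integrable (lebesgue_on Omega) (\<lambda>x. g (face_proj i c x))" for g :: "real^'d \<Rightarrow> real"
  proof -
    have "ennreal (LINT x|boundary_measure. g x) = (\<integral>\<^sup>+x. ennreal (norm (g x)) \<partial>boundary_measure)"
      using g by (subst nn_integral_eq_integral) auto
    also have "\<dots> = ennreal (\<Sum>i\<in>UNIV. \<Sum>c\<in>{0, 1}. LINT x|lebesgue_on Omega. norm (g (face_proj i c x)))"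
      by (rule fin) (use int in auto)
    finally show ?thesis
      using g(2) by (subst (asm) ennreal_inj) (auto intro!: sum_nonneg integral_nonneg_AE)
  qed
  have "(LINT x|boundary_measure. f x) = (LINT x|boundary_measure. p x - q x)"
    by (intro arg_cong[where f = "integral\<^sup>L boundary_measure"]) (auto simp: p_def q_def fun_eq_iff)
  also have "\<dots> = (LINT x|boundary_measure. p x) - (LINT x|boundary_measure. q x)"
    by (rule Bochner_Integration.integral_diff[OF ib])
  also have "\<dots> = (\<Sum>i\<in>UNIV. \<Sum>c\<in>{0, 1}. LINT x|lebesgue_on Omega. p (face_proj i c x)) -
      (\<Sum>i\<in>UNIV. \<Sum>c\<in>{0, 1}. LINT x|lebesgue_on Omega. q (face_proj i c x))"
    using ib pi qi P[of p] P[of q] by (simp add: p_def q_def)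
  also have "\<dots> = (\<Sum>i\<in>UNIV. \<Sum>c\<in>{0, 1}. LINT x|lebesgue_on Omega. p (face_proj i c x) - q (face_proj i c x))"
    unfolding sum_subtractf[symmetric]
    by (intro sum.cong refl Bochner_Integration.integral_diff[symmetric] pi qi) 
  also have "\<dots> = (\<Sum>i\<in>UNIV. \<Sum>c\<in>{0, 1}. LINT x|lebesgue_on Omega. f (face_proj i c x))"
    by (intro sum.cong refl arg_cong[where f = "integral\<^sup>L (lebesgue_on Omega)"]) (auto simp: p_def q_def fun_eq_iff)
  finally show "(LINT x|boundary_measure. f x) = (\<Sum>i\<in>UNIV. \<Sum>c\<in>{0, 1}. LINT x|lebesgue_on Omega. f (face_proj i c x))" .
qed

lemma outer_normal_component: 
  "outer_normal x $ i = (if x $ i = 0 then -1 else if x $ i = 1 then 1 else 0)"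
  by (simp add: outer_normal_def)

lemma measurable_outer_normal [measurable]: "outer_normal \<in> borel_measurable borel"
  by (rule borel_measurable_vec) (simp add: outer_normal_component, measurable)

lemma AE_coord_neq: "AE x in lebesgue_on (Omega :: (real^'d) set). x $ i \<noteq> c"
proof -
  have "{x :: real^'d. x $ i = c} \<in> null_sets lebesgue"
    using negligible_standard_hyperplane[of "axis i 1 :: real^'d" c]
    by (auto simp: negligible_iff_null_sets inner_axis Basis_vec_def)
  then have "AE x :: real^'d in lebesgue. x $ i \<noteq> c"
    by (auto dest: AE_not_in)
  then show ?thesis
    by (auto simp: AE_restrict_space_iff elim: eventually_mono)
qed

lemma norm_outer_normal_component: "\<bar>outer_normal x $ i\<bar> \<le> 1"
  by (simp add: outer_normal_component)

text \<open>On a face orthogonal to another direction \<open>j\<close>, the \<open>i\<close>-th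
  component of the normal is nonzero only where \<open>x $ i\<close> is 0 or 1, a null set. On the
  two faces orthogonal to \<open>i\<close> it is \<open>-1\<close> and \<open>1\<close>, which
  leaves the difference of the face values.\<close>

lemma integral_boundary_normal:
  fixes H :: "real^'d \<Rightarrow> real"
  assumes H: "continuous_on UNIV H"
  shows "integrable boundary_measure (\<lambda>x. outer_normal x $ i * H x)"
    and "(LINT x|boundary_measure. outer_normal x $ i * H x) =
      (LINT x|lebesgue_on Omega. H (face_proj i 1 x) - H (face_proj i 0 x))"
proof -
  have Hf: "continuous_on UNIV (\<lambda>x. H (face_proj j c x))" for j c
    by (rule continuous_on_compose2[OF H]) (auto intro!: continuous_intros)
  have m [measurable]: "H \<in> borel_measurable borel"
    by (rule borel_measurable_continuous_onI[OF H])
  have int: "integrable (lebesgue_on Omega) (\<lambda>x. outer_normal (face_proj j c x) $ i * H (face_proj j c x))" for j c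
  proof (rule Bochner_Integration.integrable_bound[OF continuous_integrable[OF Hf]])
    show "(\<lambda>x. outer_normal (face_proj j c x) $ i * H (face_proj j c x)) \<in> borel_measurable (lebesgue_on Omega)"
      by (rule measurable_on_Omega) measurable
    show "AE x in lebesgue_on Omega. norm (outer_normal (face_proj j c x) $ i * H (face_proj j c x)) \<le> norm (H (face_proj j c x))"
      using norm_outer_normal_component[of _ i] by (intro AE_I2) (simp add: abs_mult mult_left_le_one_le)
  qed
  have bm: "(\<lambda>x. outer_normal x $ i * H x) \<in> borel_measurable borel" by measurable
  show "integrable boundary_measure (\<lambda>x. outer_normal x $ i * H x)"
    by (rule integral_boundary(1)[OF bm int])
  have z: "(LINT x|lebesgue_on Omega. outer_normal (face_proj j c x) $ i * H (face_proj j c x)) = 0" if "j \<noteq> i" for j c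
  proof -
    have "(LINT x|lebesgue_on Omega. outer_normal (face_proj j c x) $ i * H (face_proj j c x)) =
        (LINT x|lebesgue_on (Omega :: (real^'d) set). 0)"
    proof (rule integral_cong_AE)
      show "AE x in lebesgue_on Omega. outer_normal (face_proj j c x) $ i * H (face_proj j c x) = 0"
        using AE_coord_neq[of i 0] AE_coord_neq[of i 1]
        by eventually_elim (use that in \<open>simp add: outer_normal_component\<close>)
    qed (use int in auto)
    then show ?thesis by simp
  qed
  have "(LINT x|boundary_measure. outer_normal x $ i * H x) =
     (\<Sum>j\<in>UNIV. \<Sum>c\<in>{0, 1}. LINT x|lebesgue_on Omega. outer_normal (face_proj j c x) $ i * H (face_proj j c x))"
    by (rule integral_boundary(2)[OF bm int])
  also have "\<dots> = (\<Sum>c\<in>{0, 1}. LINT x|lebesgue_on Omega. outer_normal (face_proj i c x) $ i * H (face_proj i c x))"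
    by (subst sum.remove[of _ i]) (auto simp: z)
  also have "\<dots> = (LINT x|lebesgue_on Omega. H (face_proj i 1 x) - H (face_proj i 0 x))"
    using continuous_integrable[OF Hf] by (simp add: outer_normal_component)
  finally show "(LINT x|boundary_measure. outer_normal x $ i * H x) =
      (LINT x|lebesgue_on Omega. H (face_proj i 1 x) - H (face_proj i 0 x))" .
qed

lemma Green_C1:
  assumes F: "C_k (Suc 0) F"
  shows "(LINT x|lebesgue_on Omega. partial i F x) = (LINT x|boundary_measure. outer_normal x $ i * F x)"
  using integral_partial[OF F] integral_boundary_normal(2)[OF C1_continuous[OF F]] by simp

lemma continuous_boundary_L2:
  fixes f :: "real^'d \<Rightarrow> real"
  assumes f: "continuous_on UNIV f" shows "f \<in> L2 boundary_measure"
proof (rule L2I)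
  have [measurable]: "f \<in> borel_measurable borel"
    by (rule borel_measurable_continuous_onI[OF f])
  then show "f \<in> borel_measurable boundary_measure" by measurable
  show "integrable boundary_measure (\<lambda>x. (norm (f x))\<^sup>2)"
    by (rule integral_boundary(1))
       (measurable, auto intro!: continuous_integrable continuous_intros continuous_on_compose2[OF f])
qed

section \<open>Smooth bump functions\<close>

text \<open>One-variable counterpart of \<open>C_k\<close>. Smoothness of the kernels is proved here
  and carried to several variables by products.\<close>

primrec smooth_upto :: "nat \<Rightarrow> (real \<Rightarrow> real) \<Rightarrow> bool" where
  "smooth_upto 0 f \<longleftrightarrow> continuous_on UNIV f"
| "smooth_upto (Suc k) f \<longleftrightarrow> (\<forall>x. (f has_real_derivative deriv f x) (at x)) \<and> smooth_upto k (deriv f)"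

lemma smooth_upto_SucI:
  "(\<And>x. (f has_real_derivative f' x) (at x)) \<Longrightarrow> smooth_upto k f' \<Longrightarrow> smooth_upto (Suc k) f"
  using DERIV_imp_deriv[of f] by (metis ext smooth_upto.simps(2))

lemma smooth_upto_mono: "smooth_upto (Suc k) f \<Longrightarrow> smooth_upto k f"
proof (induction k arbitrary: f)
  case 0
  then show ?case
    by (auto simp: continuous_on_eq_continuous_at intro: DERIV_isCont)
qed auto

lemma smooth_upto_add: "smooth_upto k f \<Longrightarrow> smooth_upto k g \<Longrightarrow> smooth_upto k (\<lambda>x. f x + g x)"
proof (induction k arbitrary: f g)
  case (Suc k)
  show ?case
    by (rule smooth_upto_SucI[where f' = "\<lambda>x. deriv f x + deriv g x"])
       (use Suc in \<open>auto intro!: derivative_intros\<close>)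
qed (auto intro: continuous_intros)

lemma smooth_upto_mult: "smooth_upto k f \<Longrightarrow> smooth_upto k g \<Longrightarrow> smooth_upto k (\<lambda>x. f x * g x)"
proof (induction k arbitrary: f g)
  case (Suc k)
  show ?case
  proof (rule smooth_upto_SucI[where f' = "\<lambda>x. deriv f x * g x + deriv g x * f x"])
    show "((\<lambda>x. f x * g x) has_real_derivative deriv f x * g x + deriv g x * f x) (at x)" for x
      using Suc.prems by (intro DERIV_mult) auto
    show "smooth_upto k (\<lambda>x. deriv f x * g x + deriv g x * f x)"
      using Suc.prems smooth_upto_mono[OF Suc.prems(1)] smooth_upto_mono[OF Suc.prems(2)]
      by (intro smooth_upto_add Suc.IH) auto
  qed
qed (auto intro: continuous_intros)

lemma smooth_upto_const: "smooth_upto k (\<lambda>x. c)"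
proof (induction k arbitrary: c)
  case (Suc k)
  show ?case by (rule smooth_upto_SucI[where f' = "\<lambda>x. 0"]) (auto intro: Suc)
qed auto

lemma smooth_upto_affine: "smooth_upto k f \<Longrightarrow> smooth_upto k (\<lambda>x. f (a * x + b))"
proof (induction k arbitrary: f)
  case 0
  then show ?case by (auto intro!: continuous_intros continuous_on_compose2[of UNIV f])
next
  case (Suc k)
  show ?case
  proof (rule smooth_upto_SucI)
    show "((\<lambda>x. f (a * x + b)) has_real_derivative deriv f (a * x + b) * a) (at x)" for x
      using Suc.prems by (intro DERIV_chain2[where f = f]) (auto intro!: derivative_eq_intros)
    show "smooth_upto k (\<lambda>x. deriv f (a * x + b) * a)"
      using Suc by (intro smooth_upto_mult smooth_upto_const) auto
  qed
qed

text \<open>The powers are part of the family because differentiating \<open>exp (- 1 / t)\<close>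
  produces them: taken over all \<open>j\<close>, the family is closed under differentiation up to
  linear combinations, so one induction on the order gives smoothness.\<close>

definition exp_inv :: "nat \<Rightarrow> real \<Rightarrow> real" where
  "exp_inv j t = (if t > 0 then (1 / t) ^ j * exp (- 1 / t) else 0)"

lemma exp_inv_tendsto_0: "(exp_inv j \<longlongrightarrow> 0) (at 0)"
proof -
  have "((\<lambda>t. (inverse t) ^ j / exp (inverse t)) \<longlongrightarrow> 0) (at_right (0::real))"
    by (rule filterlim_compose[OF tendsto_power_div_exp_0 filterlim_inverse_at_top_right])
  then have "(exp_inv j \<longlongrightarrow> 0) (at_right 0)"
    by (rule Lim_transform_eventually)
       (auto simp: eventually_at_filter exp_inv_def exp_minus field_simps)
  moreover have "(exp_inv j \<longlongrightarrow> 0) (at_left 0)"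
    by (rule Lim_transform_eventually[OF tendsto_const]) (auto simp: eventually_at_filter exp_inv_def)
  ultimately show ?thesis by (simp add: filterlim_at_split)
qed

lemma exp_inv_deriv: "(exp_inv j has_real_derivative exp_inv (j + 2) t - real j * exp_inv (j + 1) t) (at t)"
proof (cases t "0::real" rule: linorder_cases)
  case less
  have "((\<lambda>_. 0) has_real_derivative 0) (at t)" by simp
  then have "(exp_inv j has_real_derivative 0) (at t)"
    by (rule has_field_derivative_transform_within_open[where S = "{..<0}"]) (use less in \<open>auto simp: exp_inv_def\<close>)
  with less show ?thesis by (simp add: exp_inv_def)
next
  case greater
  have "((\<lambda>t. (1 / t) ^ j * exp (- 1 / t)) has_real_derivative
      (1 / t) ^ (j + 2) * exp (- 1 / t) - real j * ((1 / t) ^ (j + 1) * exp (- 1 / t))) (at t)"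
  proof -
    define s where "s = 1 / t"
    have "((\<lambda>t. (1 / t) ^ j * exp (- 1 / t)) has_real_derivative
      real j * (1 / t) ^ (j - 1) * (- (1 / t)\<^sup>2) * exp (- 1 / t) + (1 / t) ^ j * (exp (- 1 / t) * (1 / t)\<^sup>2)) (at t)"
      using greater by (auto intro!: derivative_eq_intros simp: power2_eq_square)
    \<comment> \<open>The case split on \<open>j\<close> is due to the truncated exponent
      \<open>j - 1\<close>, which is harmless for \<open>j = 0\<close> because of the factor
      \<open>real j\<close>.\<close>
    moreover have "real j * s ^ (j - 1) * (- s\<^sup>2) * e + s ^ j * (e * s\<^sup>2) = s ^ (j + 2) * e - real j * (s ^ (j + 1) * e)" for e
      by (cases j) (simp_all add: power2_eq_square algebra_simps)
    ultimately show ?thesis by (simp only: s_def)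
  qed
  then have "(exp_inv j has_real_derivative
      (1 / t) ^ (j + 2) * exp (- 1 / t) - real j * ((1 / t) ^ (j + 1) * exp (- 1 / t))) (at t)"
    by (rule has_field_derivative_transform_within_open[where S = "{0<..}"]) (use greater in \<open>auto simp: exp_inv_def\<close>)
  with greater show ?thesis by (simp add: exp_inv_def)
next
  case equal
  \<comment> \<open>The difference quotient of \<open>exp_inv j\<close> at 0 is
    \<open>exp_inv (j + 1)\<close>, which tends to 0.\<close>
  have "(exp_inv j has_real_derivative 0) (at 0)"
    unfolding has_field_derivative_iff
    by (rule Lim_transform_eventually[OF exp_inv_tendsto_0[of "j + 1"]])
       (auto simp: eventually_at_filter exp_inv_def)
  with equal show ?thesis by (simp add: exp_inv_def)
qed

lemma smooth_upto_exp_inv: "smooth_upto k (exp_inv j)"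
proof (induction k arbitrary: j)
  case 0
  then show ?case
    using exp_inv_deriv by (auto simp: continuous_on_eq_continuous_at intro: DERIV_isCont)
next
  case (Suc k)
  show ?case
    by (rule smooth_upto_SucI[OF exp_inv_deriv])
       (use smooth_upto_add[OF Suc.IH smooth_upto_mult[OF smooth_upto_const[of k "- real j" for j] Suc.IH]] in simp)
qed

text \<open>The support stays away from 0 and 1, so that kernels built from it vanish near the
  boundary of the cube. The symmetry about \<open>1/2\<close> is used later to reflect the
  argument.\<close>

definition bump :: "real \<Rightarrow> real" where
  "bump t = exp_inv 0 (t - 1/4) * exp_inv 0 (3/4 - t)"

lemma smooth_upto_bump: "smooth_upto k bump"
  using smooth_upto_mult[OF smooth_upto_affine[OF smooth_upto_exp_inv, of k 0 1 "-1/4"] smooth_upto_affine[OF smooth_upto_exp_inv, of k 0 "-1" "3/4"]]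
  by (simp add: bump_def [abs_def])

lemma bump_pos: "1/4 < t \<Longrightarrow> t < 3/4 \<Longrightarrow> bump t > 0"
  and bump_zero: "t \<le> 1/4 \<or> t \<ge> 3/4 \<Longrightarrow> bump t = 0"
  and bump_nonneg: "bump t \<ge> 0"
  by (auto simp: bump_def exp_inv_def)

text \<open>A separate factor for each coordinate is allowed because a partial derivative replaces
  exactly one factor by its derivative; the class is thus closed under \<open>partial\<close>, and
  the induction for \<open>C_k\<close> goes through.\<close>

definition tensor :: "('d \<Rightarrow> real \<Rightarrow> real) \<Rightarrow> real^'d \<Rightarrow> real" where
  "tensor h x = (\<Prod>i\<in>UNIV. h i (x $ i))"

lemma tensor_has_derivative:
  assumes "\<And>i t. (h i has_real_derivative h' i t) (at t)"
  shows "(tensor h has_derivative (\<lambda>y. \<Sum>i\<in>UNIV. y $ i * h' i (x $ i) * (\<Prod>j\<in>UNIV - {i}. h j (x $ j)))) (at x)"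
proof -
  have "((\<lambda>x. h i (x $ i)) has_derivative (\<lambda>y. y $ i * h' i (x $ i))) (at x)" for i
  proof -
    have "((\<lambda>x. x $ i) has_derivative (\<lambda>y. y $ i)) (at x)"
      by (rule bounded_linear_imp_has_derivative[OF bounded_linear_vec_nth])
    moreover have "(h i has_derivative (*) (h' i (x $ i))) (at (x $ i))"
      using assms[of i "x $ i"] by (simp add: has_field_derivative_def)
    ultimately have "(h i \<circ> (\<lambda>x. x $ i) has_derivative (*) (h' i (x $ i)) \<circ> (\<lambda>y. y $ i)) (at x)"
      by (rule diff_chain_at)
    then show ?thesis
      by (simp add: o_def mult.commute)
  qed
  then show ?thesis
    unfolding tensor_def [abs_def] by (rule has_derivative_prod)
qed

lemma C_k_tensor: "(\<And>i. smooth_upto k (h i)) \<Longrightarrow> C_k k (tensor h)"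
proof (induction k arbitrary: h)
  case 0
  have "continuous_on UNIV (\<lambda>x :: real^'a. h i (x $ i))" for i
    by (rule continuous_on_compose2[of UNIV "h i"]) (use 0 in \<open>auto intro: continuous_intros\<close>)
  then show ?case
    by (simp add: tensor_def [abs_def] continuous_on_prod)
next
  case (Suc k)
  then have D: "(h i has_real_derivative deriv (h i) t) (at t)" for i t
    by simp
  have "partial j (tensor h) = tensor (h(j := deriv (h j)))" for j
  proof
    fix x
    have "partial j (tensor h) x = (\<Sum>i\<in>UNIV. axis j 1 $ i * deriv (h i) (x $ i) * (\<Prod>k\<in>UNIV - {i}. h k (x $ k)))"
      by (rule partial_eqI[OF tensor_has_derivative[OF D]])
    also have "\<dots> = (\<Sum>i\<in>UNIV. if i = j then deriv (h j) (x $ j) * (\<Prod>k\<in>UNIV - {j}. h k (x $ k)) else 0)"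
      by (rule sum.cong) (auto simp: axis_def)
    also have "\<dots> = deriv (h j) (x $ j) * (\<Prod>k\<in>UNIV - {j}. h k (x $ k))"
      by simp
    also have "\<dots> = tensor (h(j := deriv (h j))) x"
      unfolding tensor_def by (subst (2) prod.remove[of _ j]) (auto intro!: prod.cong)
    finally show "partial j (tensor h) x = tensor (h(j := deriv (h j))) x" .
  qed
  moreover have "C_k k (tensor (h(j := deriv (h j))))" for j
  proof (rule Suc.IH)
    show "smooth_upto k ((h(j := deriv (h j))) i)" for i
      using Suc.prems[of i] smooth_upto_mono[OF Suc.prems[of i]] by (cases "i = j") auto
  qed
  moreover have "tensor h differentiable at x" for x
    using tensor_has_derivative[of h "\<lambda>i. deriv (h i)", OF D] by (auto simp: differentiable_def)
  ultimately show ?case by simp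
qed

section \<open>Scalar multiples and affine substitutions\<close>

lemma partial_cmult:
  assumes "F differentiable at x" shows "partial i (\<lambda>x. c * F x) x = c * partial i F x"
proof -
  have "partial i (\<lambda>_. c) x = 0"
    by (rule partial_eqI[OF has_derivative_const])
  then show ?thesis
    using partial_mult[of "\<lambda>_. c" x F i] assms by simp
qed

lemma C_k_cmult: "C_k k F \<Longrightarrow> C_k k (\<lambda>x. c * F x)"
proof (induction k arbitrary: F)
  case (Suc k)
  then have "partial i (\<lambda>x. c * F x) = (\<lambda>x. c * partial i F x)" for i
    by (intro ext partial_cmult) auto
  with Suc show ?case by (auto intro: differentiable_mult)
qed (auto intro: continuous_intros)

lemma has_derivative_affine_arg:
  fixes F :: "real^'d \<Rightarrow> real"
  assumes "F differentiable at (a *\<^sub>R x + b)"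
  shows "((\<lambda>x. F (a *\<^sub>R x + b)) has_derivative (\<lambda>h. \<Sum>i\<in>UNIV. (a * h $ i) * partial i F (a *\<^sub>R x + b))) (at x)"
proof -
  have "((\<lambda>x. a *\<^sub>R x + b) has_derivative (\<lambda>h. a *\<^sub>R h)) (at x)"
    by (auto intro!: derivative_eq_intros)
  from diff_chain_at[OF this differentiable_has_partial[OF assms]] show ?thesis
    by (simp add: o_def)
qed

lemma partial_affine_arg:
  fixes F :: "real^'d \<Rightarrow> real"
  assumes "F differentiable at (a *\<^sub>R x + b)"
  shows "partial i (\<lambda>x. F (a *\<^sub>R x + b)) x = a * partial i F (a *\<^sub>R x + b)"
  by (subst partial_eqI[OF has_derivative_affine_arg[OF assms]]) (simp add: axis_def if_distrib[of "\<lambda>c. c * _"] if_distrib[of "\<lambda>c. _ * c"] cong: if_cong)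

lemma C_k_affine_arg: "C_k k F \<Longrightarrow> C_k k (\<lambda>x. F (a *\<^sub>R x + b))"
proof (induction k arbitrary: F)
  case 0
  then show ?case by (auto intro!: continuous_intros continuous_on_compose2[of UNIV F])
next
  case (Suc k)
  then have d: "F differentiable at x" for x by simp
  have "(\<lambda>x. F (a *\<^sub>R x + b)) differentiable at x" for x
    using has_derivative_affine_arg[OF d] by (auto simp: differentiable_def)
  moreover have "partial i (\<lambda>x. F (a *\<^sub>R x + b)) = (\<lambda>x. a * partial i F (a *\<^sub>R x + b))" for i
    by (intro ext partial_affine_arg d)
  ultimately show ?case using Suc by (auto intro: C_k_cmult)
qed

section \<open>The bump on the cube and its mass\<close>

definition cube_bump :: "real^'d \<Rightarrow> real" where
  "cube_bump = tensor (\<lambda>i. bump)"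

lemma C_k_cube_bump: "C_k k cube_bump"
  unfolding cube_bump_def by (rule C_k_tensor) (rule smooth_upto_bump)

lemma continuous_cube_bump: "continuous_on UNIV cube_bump"
  using C_k_cube_bump[of 0] by simp

lemma measurable_cube_bump [measurable]: "cube_bump \<in> borel_measurable borel"
  by (rule borel_measurable_continuous_onI[OF continuous_cube_bump])

lemma cube_bump_nonneg: "cube_bump x \<ge> 0"
  by (simp add: cube_bump_def tensor_def prod_nonneg bump_nonneg)

lemma cube_bump_outside: "x \<notin> cbox (\<chi> i. 1/4) (\<chi> i. 3/4) \<Longrightarrow> cube_bump x = 0"
proof -
  assume "x \<notin> cbox (\<chi> i. 1/4) (\<chi> i. 3/4)"
  then obtain i where "x $ i < 1/4 \<or> x $ i > 3/4"
    by (auto simp: mem_box_cart not_le)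
  then have "bump (x $ i) = 0"
    by (intro bump_zero) auto
  then show ?thesis
    by (auto simp: cube_bump_def tensor_def)
qed

lemma cube_bump_support_subset:
  "cbox (\<chi> i. 1/4) (\<chi> i. 3/4) \<subseteq> (box 0 1 :: (real^'d) set)"
proof
  fix x :: "real^'d" assume "x \<in> cbox (\<chi> i. 1/4) (\<chi> i. 3/4)"
  then have x: "1/4 \<le> x $ i" "x $ i \<le> 3/4" for i
    by (simp_all add: mem_box_cart)
  show "x \<in> box 0 1"
    unfolding mem_box_cart using x by (auto intro: less_le_trans[of 0 "1/4"] le_less_trans[of _ "3/4" 1])
qed

lemma cube_bump_outside_Omega: "x \<notin> Omega \<Longrightarrow> cube_bump x = 0"
  using cube_bump_support_subset box_subset_cbox by (intro cube_bump_outside) blast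

text \<open>The normalising constant depends on the dimension alone, hence the type token as
  argument.\<close>

definition cube_bump_mass :: "'d::finite itself \<Rightarrow> real" where
  "cube_bump_mass _ = (LINT x|lebesgue_on Omega. cube_bump (x :: real^'d))"

text \<open>A nonnegative function of zero integral vanishes almost everywhere, while the bump is
  positive on an open box of positive volume.\<close>

lemma cube_bump_mass_pos: "cube_bump_mass TYPE('d::finite) > 0"
proof -
  have "cube_bump_mass TYPE('d) \<ge> 0"
    unfolding cube_bump_mass_def by (intro integral_nonneg_AE AE_I2 cube_bump_nonneg)
  moreover have "cube_bump_mass TYPE('d) \<noteq> 0"
  proof
    assume "cube_bump_mass TYPE('d) = 0"
    then have "AE x in lebesgue_on Omega. cube_bump (x :: real^'d) = 0"
      using integral_nonneg_eq_0_iff_AE[OF continuous_integrable[OF continuous_cube_bump]]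
      by (auto simp: cube_bump_mass_def cube_bump_nonneg)
    then have *: "AE x in lebesgue. (x :: real^'d) \<in> Omega \<longrightarrow> cube_bump x = 0"
      by (simp add: AE_restrict_space_iff)
    have pos: "cube_bump x > 0" if "x \<in> box (\<chi> i. 1/4) (\<chi> i. 3/4)" for x :: "real^'d"
      using that unfolding cube_bump_def tensor_def by (intro prod_pos) (auto simp: mem_box_cart intro: bump_pos)
    have sub: "box (\<chi> i. 1/4) (\<chi> i. 3/4) \<subseteq> (Omega :: (real^'d) set)"
      using cube_bump_support_subset box_subset_cbox by blast
    from * have "AE x in lebesgue. (x :: real^'d) \<notin> box (\<chi> i. 1/4) (\<chi> i. 3/4)"
    proof eventually_elim
      fix x :: "real^'d" assume "x \<in> Omega \<longrightarrow> cube_bump x = 0"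
      with pos[of x] sub show "x \<notin> box (\<chi> i. 1/4) (\<chi> i. 3/4)" by force
    qed
    then have "box (\<chi> i. 1/4) (\<chi> i. 3/4) \<in> null_sets (lebesgue :: (real^'d) measure)"
      by (subst AE_iff_null_sets) auto
    then have "emeasure lborel (box (\<chi> i. 1/4) (\<chi> i. 3/4) :: (real^'d) set) = 0"
      by (auto simp: null_sets_def)
    moreover have "\<forall>b\<in>Basis. ((\<chi> i. 1/4) :: real^'d) \<bullet> b \<le> (\<chi> i. 3/4) \<bullet> b"
      by (auto simp: Basis_vec_def inner_axis)
    ultimately show False
      by (simp add: emeasure_lborel_box_eq prod_Basis_cart inner_axis)
  qed
  ultimately show ?thesis by simp
qed

section \<open>Mollification\<close>

lemma L2_dominated_convergence:
  fixes f :: "nat \<Rightarrow> 'a \<Rightarrow> real"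
  assumes [measurable]: "\<And>m. f m \<in> borel_measurable M" "g \<in> borel_measurable M"
    and w: "w \<in> L2 M" and lim: "AE x in M. (\<lambda>m. f m x) \<longlonglongrightarrow> g x"
    and bound: "\<And>m. AE x in M. \<bar>f m x - g x\<bar> \<le> w x"
  shows "(\<lambda>m. L2_norm M (\<lambda>x. f m x - g x)) \<longlonglongrightarrow> 0"
proof -
  have "(\<lambda>m. LINT x|M. (norm (f m x - g x))\<^sup>2) \<longlonglongrightarrow> (LINT x|M. 0)"
  proof (rule integral_dominated_convergence)
    show "integrable M (\<lambda>x. (norm (w x))\<^sup>2)"
      by (rule L2_integrable_square[OF w])
    show "AE x in M. (\<lambda>m. (norm (f m x - g x))\<^sup>2) \<longlonglongrightarrow> 0"
      using lim
    proof eventually_elim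
      fix x assume "(\<lambda>m. f m x) \<longlonglongrightarrow> g x"
      then have "(\<lambda>m. (norm (f m x - g x))\<^sup>2) \<longlonglongrightarrow> (norm (g x - g x))\<^sup>2"
        by (intro tendsto_intros)
      then show "(\<lambda>m. (norm (f m x - g x))\<^sup>2) \<longlonglongrightarrow> 0" by simp
    qed
    show "AE x in M. norm ((norm (f m x - g x))\<^sup>2) \<le> (norm (w x))\<^sup>2" for m
      using bound[of m] by eventually_elim (simp add: abs_le_square_iff[symmetric])
  qed measurable
  then have "(\<lambda>m. sqrt (LINT x|M. (norm (f m x - g x))\<^sup>2)) \<longlonglongrightarrow> sqrt 0"
    by (intro tendsto_real_sqrt) simp
  then show ?thesis by (simp add: L2_norm_def)
qed

text \<open>Truncating at height \<open>k\<close> costs little in \<open>L2\<close> for large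
  \<open>k\<close>. The truncated function is an almost everywhere limit of continuous functions,
  and applying the same truncation to these makes them uniformly bounded, so dominated convergence
  applies a second time.\<close>

lemma continuous_dense_L2:
  fixes f :: "real^'d \<Rightarrow> real"
  assumes f: "f \<in> L2 (lebesgue_on Omega)" and "e > 0"
  shows "\<exists>c. continuous_on UNIV c \<and> L2_norm (lebesgue_on Omega) (\<lambda>x. f x - c x) < e"
proof -
  let ?M = "lebesgue_on (Omega :: (real^'d) set)"
  have [measurable]: "f \<in> borel_measurable ?M" by (rule L2_measurable[OF f])
  define cut where "cut k t = max (- real k) (min (real k) t)" for k t
  have cut_cont: "continuous_on UNIV (cut k)" for k
    unfolding cut_def [abs_def] by (intro continuous_intros)
  then have [measurable]: "cut k \<in> borel_measurable borel" for k
    by (rule borel_measurable_continuous_onI)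
  have "(\<lambda>k. L2_norm ?M (\<lambda>x. cut k (f x) - f x)) \<longlonglongrightarrow> 0"
  proof (rule L2_dominated_convergence[OF _ _ L2_norm_fun[OF f]])
    show "AE x in ?M. (\<lambda>k. cut k (f x)) \<longlonglongrightarrow> f x"
    proof (rule AE_I2)
      fix x
      obtain k0 where "\<bar>f x\<bar> \<le> real k0" using real_arch_simple by blast
      then have "cut k (f x) = f x" if "k \<ge> k0" for k
        using that by (auto simp: cut_def)
      then show "(\<lambda>k. cut k (f x)) \<longlonglongrightarrow> f x"
        by (intro tendsto_eventually eventually_sequentiallyI)
    qed
    show "AE x in ?M. \<bar>cut k (f x) - f x\<bar> \<le> norm (f x)" for k
      by (rule AE_I2) (auto simp: cut_def max_def min_def)
  qed measurable
  from LIMSEQ_D[OF this, of "e/2"] \<open>e > 0\<close> obtain k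
    where k: "L2_norm ?M (\<lambda>x. cut k (f x) - f x) < e / 2" by auto
  \<comment> \<open>Measurability in this form is by definition almost everywhere approximation by
    continuous functions.\<close>
  have "f measurable_on Omega"
    by (subst measurable_on_iff_borel_measurable) auto
  then obtain N h where N: "negligible N" and h: "\<And>n. continuous_on UNIV (h n)"
      and lim: "\<And>x. x \<notin> N \<Longrightarrow> (\<lambda>n. h n x) \<longlonglongrightarrow> (if x \<in> Omega then f x else 0)"
    unfolding measurable_on_def by blast
  have hc: "continuous_on UNIV (\<lambda>x. cut k (h n x))" for n
    by (rule continuous_on_compose2[OF cut_cont h]) auto
  have "AE x in lebesgue. x \<notin> N"
    using N by (auto simp: negligible_iff_null_sets intro: AE_not_in)
  then have N': "AE x in ?M. x \<notin> N"
    by (auto simp: AE_restrict_space_iff elim: eventually_mono)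
  have "(\<lambda>n. L2_norm ?M (\<lambda>x. cut k (h n x) - cut k (f x))) \<longlonglongrightarrow> 0"
  proof (rule L2_dominated_convergence)
    show "(\<lambda>x. 2 * real k) \<in> L2 ?M" by simp
    show "AE x in ?M. (\<lambda>n. cut k (h n x)) \<longlonglongrightarrow> cut k (f x)"
      using N' AE_space
    proof eventually_elim
      fix x assume "x \<notin> N" "x \<in> space ?M"
      then have "(\<lambda>n. h n x) \<longlonglongrightarrow> f x" using lim[of x] by simp
      then show "(\<lambda>n. cut k (h n x)) \<longlonglongrightarrow> cut k (f x)"
        by (rule continuous_on_tendsto_compose[OF cut_cont]) auto
    qed
    show "AE x in ?M. \<bar>cut k (h n x) - cut k (f x)\<bar> \<le> 2 * real k" for n
      by (rule AE_I2) (auto simp: cut_def max_def min_def)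
    show "(\<lambda>x. cut k (h n x)) \<in> borel_measurable ?M" for n
      by (intro continuous_on_UNIV_measurable hc)
  qed measurable
  from LIMSEQ_D[OF this, of "e/2"] \<open>e > 0\<close> obtain n
    where n: "L2_norm ?M (\<lambda>x. cut k (h n x) - cut k (f x)) < e / 2" by auto
  have cL: "(\<lambda>x. cut k (f x)) \<in> L2 ?M"
    by (rule L2_bound[OF f]) (auto simp: cut_def max_def min_def)
  have "L2_norm ?M (\<lambda>x. f x - cut k (h n x)) = L2_norm ?M (\<lambda>x. (f x - cut k (f x)) + (cut k (f x) - cut k (h n x)))"
    by simp
  also have "\<dots> \<le> L2_norm ?M (\<lambda>x. f x - cut k (f x)) + L2_norm ?M (\<lambda>x. cut k (f x) - cut k (h n x))"
    by (intro L2_norm_triangle L2_diff f cL continuous_L2 hc)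
  also have "\<dots> < e"
    using k n by (simp add: L2_norm_minus_commute)
  finally show ?thesis using hc by blast
qed

text \<open>Differentiation under the integral sign. Bounded partial derivatives make the kernel
  Lipschitz in \<open>x\<close> uniformly in \<open>y\<close>, so the first-order remainders divided
  by the increment are dominated by a multiple of \<open>|f|\<close> and tend to 0 pointwise. The
  argument \<open>a y + b x\<close> has the shape that the mollifier uses.\<close>

lemma kernel_integral_has_derivative:
  fixes \<kappa> :: "real^'d \<Rightarrow> real" and f :: "real^'d \<Rightarrow> real"
  assumes C1: "C_k (Suc 0) \<kappa>" and B: "\<And>x. \<bar>\<kappa> x\<bar> \<le> B" and dB: "\<And>i x. \<bar>partial i \<kappa> x\<bar> \<le> B"
    and f: "integrable (lebesgue_on Omega) f"
  shows "((\<lambda>x. LINT y|lebesgue_on Omega. f y * \<kappa> (a *\<^sub>R y + b *\<^sub>R x)) has_derivative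
      (\<lambda>h. \<Sum>i\<in>UNIV. h $ i * (LINT y|lebesgue_on Omega. f y * (b * partial i \<kappa> (a *\<^sub>R y + b *\<^sub>R x))))) (at x)"
    (is "(?G has_derivative ?D) _")
proof -
  let ?M = "lebesgue_on (Omega :: (real^'d) set)"
  have [measurable]: "f \<in> borel_measurable ?M" using f by auto
  have k_cont: "continuous_on UNIV \<kappa>" by (rule C1_continuous[OF C1])
  have p_cont: "continuous_on UNIV (partial i \<kappa>)" for i using C1 by auto
  have diff: "\<kappa> differentiable at x" for x using C1 by simp
  have k_meas [measurable]: "(\<lambda>y. \<kappa> (a *\<^sub>R y + z)) \<in> borel_measurable ?M" for z
    by (intro continuous_on_UNIV_measurable continuous_on_compose2[OF k_cont]) (auto intro!: continuous_intros)
  have p_meas [measurable]: "(\<lambda>y. partial i \<kappa> (a *\<^sub>R y + z)) \<in> borel_measurable ?M" for i z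
    by (intro continuous_on_UNIV_measurable continuous_on_compose2[OF p_cont]) (auto intro!: continuous_intros)
  have B0: "B \<ge> 0" using B[of 0] by simp
  have k_int: "integrable ?M (\<lambda>y. f y * \<kappa> (a *\<^sub>R y + z))" for z
    by (rule Bochner_Integration.integrable_bound[OF integrable_mult_right[OF f, of B]])
       (auto simp: abs_mult mult.commute[of "\<bar>f _\<bar>"] B B0 intro!: AE_I2 mult_right_mono)
  have p_int: "integrable ?M (\<lambda>y. f y * (b * partial i \<kappa> (a *\<^sub>R y + z)))" for i z
  proof -
    have "integrable ?M (\<lambda>y. f y * partial i \<kappa> (a *\<^sub>R y + z))"
      by (rule Bochner_Integration.integrable_bound[OF integrable_mult_right[OF f, of B]])
         (auto simp: abs_mult mult.commute[of "\<bar>f _\<bar>"] dB B0 intro!: AE_I2 mult_right_mono)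
    from integrable_mult_right[OF this, of b] show ?thesis by (simp add: algebra_simps)
  qed
  \<comment> \<open>A crude Lipschitz constant in \<open>x\<close>: each of the \<open>d\<close>
    terms of the derivative is at most \<open>|b| B\<close> times the norm of the increment.\<close>
  define L where "L = real CARD('d) * \<bar>b\<bar> * B"
  have lin_bound: "\<bar>\<Sum>i\<in>UNIV. (b * h $ i) * partial i \<kappa> z\<bar> \<le> L * norm h" for h z
  proof -
    have "\<bar>\<Sum>i\<in>UNIV. (b * h $ i) * partial i \<kappa> z\<bar> \<le> (\<Sum>i\<in>(UNIV :: 'd set). \<bar>b\<bar> * norm h * B)"
    proof (rule order.trans[OF sum_abs sum_mono])
      fix i :: 'd
      show "\<bar>b * h $ i * partial i \<kappa> z\<bar> \<le> \<bar>b\<bar> * norm h * B"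
        unfolding abs_mult by (intro mult_mono component_le_norm_cart dB) auto
    qed
    then show ?thesis by (simp add: L_def mult_ac)
  qed
  have der: "((\<lambda>x. \<kappa> (a *\<^sub>R y + b *\<^sub>R x)) has_derivative (\<lambda>h. \<Sum>i\<in>UNIV. (b * h $ i) * partial i \<kappa> (a *\<^sub>R y + b *\<^sub>R x))) (at x)" for x y
    using has_derivative_affine_arg[of \<kappa> b x "a *\<^sub>R y"] diff by (simp add: add.commute)
  have lip: "\<bar>\<kappa> (a *\<^sub>R y + b *\<^sub>R x) - \<kappa> (a *\<^sub>R y + b *\<^sub>R x')\<bar> \<le> L * norm (x - x')" for x x' y
  proof -
    have "norm (\<kappa> (a *\<^sub>R y + b *\<^sub>R x) - \<kappa> (a *\<^sub>R y + b *\<^sub>R x')) \<le> L * norm (x - x')"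
      by (rule differentiable_bound[of UNIV "\<lambda>x. \<kappa> (a *\<^sub>R y + b *\<^sub>R x)"])
         (auto intro!: der onorm_le simp: lin_bound)
    then show ?thesis by simp
  qed
  show ?thesis
    unfolding has_derivative_iff_norm
  proof (intro conjI)
    show "bounded_linear ?D"
      by (intro bounded_linear_sum bounded_linear_mult_const bounded_linear_vec_nth)
    show "((\<lambda>x'. norm (?G x' - ?G x - ?D (x' - x)) / norm (x' - x)) \<longlongrightarrow> 0) (at x)"
      unfolding tendsto_at_iff_sequentially o_def
    proof (intro allI impI)
      fix X :: "nat \<Rightarrow> real^'d" assume X: "\<forall>n. X n \<in> UNIV - {x}" "X \<longlonglongrightarrow> x"
      \<comment> \<open>The normalised first-order remainder of the kernel along an arbitrary
        sequence tending to \<open>x\<close>; its integral against \<open>f\<close> is the remainder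
        of the integral.\<close>
      define q where "q n y = (\<kappa> (a *\<^sub>R y + b *\<^sub>R X n) - \<kappa> (a *\<^sub>R y + b *\<^sub>R x)
        - (\<Sum>i\<in>UNIV. (b * (X n - x) $ i) * partial i \<kappa> (a *\<^sub>R y + b *\<^sub>R x))) / norm (X n - x)" for n y
      have ne: "norm (X n - x) > 0" for n using X by simp
      have [measurable]: "q n \<in> borel_measurable ?M" for n
        unfolding q_def by measurable
      have quot: "(LINT y|?M. f y * q n y) = (?G (X n) - ?G x - ?D (X n - x)) / norm (X n - x)" for n
      proof -
        have "(LINT y|?M. f y * q n y) = (LINT y|?M. (f y * \<kappa> (a *\<^sub>R y + b *\<^sub>R X n) - f y * \<kappa> (a *\<^sub>R y + b *\<^sub>R x)
           - (\<Sum>i\<in>UNIV. (X n - x) $ i * (f y * (b * partial i \<kappa> (a *\<^sub>R y + b *\<^sub>R x))))) / norm (X n - x))"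
          by (intro arg_cong[where f = "integral\<^sup>L ?M"] ext)
             (simp add: q_def algebra_simps sum_distrib_left sum_distrib_right diff_divide_distrib)
        also have "\<dots> = (?G (X n) - ?G x - ?D (X n - x)) / norm (X n - x)"
          using k_int p_int by simp
        finally show ?thesis .
      qed
      have "(\<lambda>n. LINT y|?M. f y * q n y) \<longlonglongrightarrow> (LINT y|?M. 0)"
      proof (rule integral_dominated_convergence)
        show "integrable ?M (\<lambda>y. (2 * L) * \<bar>f y\<bar>)" using f by (intro integrable_mult_right integrable_abs)
        show "AE y in ?M. (\<lambda>n. f y * q n y) \<longlonglongrightarrow> 0"
        proof (rule AE_I2)
          fix y
          have "((\<lambda>x'. norm (\<kappa> (a *\<^sub>R y + b *\<^sub>R x') - \<kappa> (a *\<^sub>R y + b *\<^sub>R x) -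
              (\<Sum>i\<in>UNIV. (b * (x' - x) $ i) * partial i \<kappa> (a *\<^sub>R y + b *\<^sub>R x))) / norm (x' - x)) \<longlongrightarrow> 0) (at x)"
            using der[of y x] unfolding has_derivative_iff_norm by simp
          then have "(\<lambda>n. \<bar>q n y\<bar>) \<longlonglongrightarrow> 0"
            unfolding tendsto_at_iff_sequentially o_def q_def using X by (auto simp: abs_divide)
          then have "(\<lambda>n. q n y) \<longlonglongrightarrow> 0" by (rule tendsto_rabs_zero_cancel)
          from tendsto_mult[OF tendsto_const this, of "f y"] show "(\<lambda>n. f y * q n y) \<longlonglongrightarrow> 0" by simp
        qed
        show "AE y in ?M. norm (f y * q n y) \<le> 2 * L * \<bar>f y\<bar>" for n
        proof (rule AE_I2)
          fix y
          \<comment> \<open>One \<open>L\<close> comes from the difference of values, the other from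
            the linear part.\<close>
          have "\<bar>\<kappa> (a *\<^sub>R y + b *\<^sub>R X n) - \<kappa> (a *\<^sub>R y + b *\<^sub>R x)
            - (\<Sum>i\<in>UNIV. (b * (X n - x) $ i) * partial i \<kappa> (a *\<^sub>R y + b *\<^sub>R x))\<bar> \<le> 2 * L * norm (X n - x)"
            using lip[of y "X n" x] lin_bound[of "X n - x" "a *\<^sub>R y + b *\<^sub>R x"] by simp
          then have "\<bar>q n y\<bar> \<le> 2 * L"
            unfolding q_def abs_divide using ne[of n] by (simp add: pos_divide_le_eq)
          then show "norm (f y * q n y) \<le> 2 * L * \<bar>f y\<bar>"
            by (simp add: abs_mult mult.commute[of _ "\<bar>f y\<bar>"] mult_left_mono)
        qed
      qed measurable
      then have "(\<lambda>n. \<bar>(?G (X n) - ?G x - ?D (X n - x)) / norm (X n - x)\<bar>) \<longlonglongrightarrow> 0"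
        unfolding quot by (intro tendsto_rabs_zero) simp
      then show "(\<lambda>n. norm (?G (X n) - ?G x - ?D (X n - x)) / norm (X n - x)) \<longlonglongrightarrow> 0"
        by (simp add: abs_divide)
    qed
  qed
qed

lemma kernel_integral_continuous:
  fixes \<kappa> :: "real^'d \<Rightarrow> real" and f :: "real^'d \<Rightarrow> real"
  assumes k_cont: "continuous_on UNIV \<kappa>" and B: "\<And>x. \<bar>\<kappa> x\<bar> \<le> B"
    and f: "integrable (lebesgue_on Omega) f"
  shows "continuous_on UNIV (\<lambda>x. LINT y|lebesgue_on Omega. f y * \<kappa> (a *\<^sub>R y + b *\<^sub>R x))"
proof -
  let ?M = "lebesgue_on (Omega :: (real^'d) set)"
  have [measurable]: "f \<in> borel_measurable ?M" using f by auto
  have B0: "B \<ge> 0" using B[of 0] by simp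
  have [measurable]: "(\<lambda>y. \<kappa> (a *\<^sub>R y + z)) \<in> borel_measurable ?M" for z
    by (intro continuous_on_UNIV_measurable continuous_on_compose2[OF k_cont]) (auto intro!: continuous_intros)
  show ?thesis
    unfolding continuous_on_sequentially o_def
  proof (intro allI ballI impI, elim conjE)
    fix X :: "nat \<Rightarrow> real^'d" and x assume X: "X \<longlonglongrightarrow> x"
    show "(\<lambda>n. LINT y|?M. f y * \<kappa> (a *\<^sub>R y + b *\<^sub>R X n)) \<longlonglongrightarrow> (LINT y|?M. f y * \<kappa> (a *\<^sub>R y + b *\<^sub>R x))"
    proof (rule integral_dominated_convergence)
      show "integrable ?M (\<lambda>y. B * \<bar>f y\<bar>)" using f by (intro integrable_mult_right integrable_abs)
      show "AE y in ?M. (\<lambda>n. f y * \<kappa> (a *\<^sub>R y + b *\<^sub>R X n)) \<longlonglongrightarrow> f y * \<kappa> (a *\<^sub>R y + b *\<^sub>R x)"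
      proof (intro AE_I2 tendsto_mult tendsto_const)
        fix y
        have "(\<lambda>n. a *\<^sub>R y + b *\<^sub>R X n) \<longlonglongrightarrow> a *\<^sub>R y + b *\<^sub>R x" by (intro tendsto_intros X)
        then show "(\<lambda>n. \<kappa> (a *\<^sub>R y + b *\<^sub>R X n)) \<longlonglongrightarrow> \<kappa> (a *\<^sub>R y + b *\<^sub>R x)"
          by (rule continuous_on_tendsto_compose[OF k_cont]) auto
      qed
      show "AE y in ?M. norm (f y * \<kappa> (a *\<^sub>R y + b *\<^sub>R X n)) \<le> B * \<bar>f y\<bar>" for n
        by (rule AE_I2) (simp add: abs_mult mult.commute[of B] mult_left_mono B)
    qed measurable
  qed
qed

lemma cube_bump_partial_outside: "x \<notin> Omega \<Longrightarrow> partial i cube_bump x = 0"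
proof -
  assume x: "x \<notin> Omega"
  have "(cube_bump has_derivative (\<lambda>h. 0)) (at x)"
    by (rule has_derivative_transform_within_open[where f = "\<lambda>_. 0" and s = "- Omega"])
       (use x in \<open>auto simp: cube_bump_outside_Omega open_Compl\<close>)
  from partial_eqI[OF this] show ?thesis by simp
qed

lemma cube_bump_bounded: obtains B where "\<And>x :: real^'d. \<bar>cube_bump x\<bar> \<le> B" "\<And>i (x :: real^'d). \<bar>partial i cube_bump x\<bar> \<le> B"
proof -
  obtain B0 where B0: "B0 > 0" "\<And>x :: real^'d. x \<in> Omega \<Longrightarrow> norm (cube_bump x) \<le> B0"
    using continuous_Omega_bounded[OF continuous_cube_bump] by blast
  have "continuous_on UNIV (partial i (cube_bump :: real^'d \<Rightarrow> real))" for i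
    using C_k_cube_bump[of "Suc 0"] by auto
  then have "\<exists>b>0. \<forall>x\<in>Omega. norm (partial i (cube_bump :: real^'d \<Rightarrow> real) x) \<le> b" for i
    by (meson continuous_Omega_bounded)
  then obtain b where b: "\<And>i. b i > 0" "\<And>i (x :: real^'d). x \<in> Omega \<Longrightarrow> norm (partial i cube_bump x) \<le> b i"
    by metis
  have bi: "b i \<le> sum b UNIV" for i
    using b(1) by (intro member_le_sum) (auto intro: less_imp_le)
  have s: "sum b UNIV \<ge> 0"
    using b(1) by (intro sum_nonneg) (auto intro: less_imp_le)
  show ?thesis
  proof (rule that)
    show "\<bar>cube_bump x\<bar> \<le> B0 + sum b UNIV" for x :: "real^'d"
      using B0 s by (cases "x \<in> Omega") (auto simp: cube_bump_outside_Omega intro: add_increasing2)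
    show "\<bar>partial i cube_bump x\<bar> \<le> B0 + sum b UNIV" for i and x :: "real^'d"
      using b(2)[of x i] bi[of i] B0 s
      by (cases "x \<in> Omega") (auto simp: cube_bump_partial_outside)
  qed
qed


text \<open>The argument of \<open>cube_bump\<close> is the \<open>z\<close> solving
  \<open>y = (1 - \<delta>) x + \<delta> z\<close>. The power of \<delta> in the normalisation is
  the Jacobian of \<open>y\<close> with respect to \<open>z\<close>.\<close>

definition mollifier :: "real \<Rightarrow> real^'d \<Rightarrow> real^'d \<Rightarrow> real" where
  "mollifier \<delta> x y = inverse (cube_bump_mass TYPE('d) * \<delta> ^ CARD('d)) *
     cube_bump ((1 / \<delta>) *\<^sub>R y + (- (1 - \<delta>) / \<delta>) *\<^sub>R x)"

text \<open>
  \<open>mollify \<delta> g x\<close> averages \<open>g\<close> over the points \<open>(1 - \<delta>) x + \<delta> z\<close>, where \<open>z\<close> runs through the support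
  of \<open>cube_bump\<close>, which is contained in the open cube. As \<open>x\<close> is shrunk towards the interior, the kernel
  is a test function for every \<open>x\<close> in the closed cube.
\<close>

definition mollify :: "real \<Rightarrow> (real^'d \<Rightarrow> real) \<Rightarrow> real^'d \<Rightarrow> real" where
  "mollify \<delta> g x = (LINT y|lebesgue_on Omega. g y * mollifier \<delta> x y)"

lemma mollifier_nonneg: "0 < \<delta> \<Longrightarrow> mollifier \<delta> x y \<ge> 0"
  unfolding mollifier_def using cube_bump_mass_pos[where 'd = 'a] by (intro mult_nonneg_nonneg cube_bump_nonneg) (auto intro: less_imp_le)

lemma mollifier_support:
  assumes "0 < \<delta>" "mollifier \<delta> x y \<noteq> 0"
  obtains z where "z \<in> cbox (\<chi> i. 1/4) (\<chi> i. 3/4)" "y = (1 - \<delta>) *\<^sub>R x + \<delta> *\<^sub>R z"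
proof
  let ?z = "(1 / \<delta>) *\<^sub>R y + (- (1 - \<delta>) / \<delta>) *\<^sub>R x"
  show "?z \<in> cbox (\<chi> i. 1/4) (\<chi> i. 3/4)"
    using assms cube_bump_outside[of ?z] by (auto simp: mollifier_def)
  show "y = (1 - \<delta>) *\<^sub>R x + \<delta> *\<^sub>R ?z"
    using assms(1) by (simp add: vec_eq_iff field_simps)
qed

lemma mollifier_test_function:
  assumes "0 < \<delta>" "\<delta> < 1" "x \<in> Omega"
  shows "test_function (mollifier \<delta> x)"
  unfolding test_function_def
proof (intro conjI allI exI)
  show "C_k k (mollifier \<delta> x)" for k
    unfolding mollifier_def [abs_def] by (intro C_k_cmult C_k_affine_arg C_k_cube_bump)
  let ?K = "(\<lambda>z. (1 - \<delta>) *\<^sub>R x + \<delta> *\<^sub>R z) ` cbox (\<chi> i. 1/4) (\<chi> i. 3/4)"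
  show "compact ?K"
    by (intro compact_continuous_image continuous_intros compact_cbox)
  show "?K \<subseteq> box 0 1"
  proof clarify
    fix z :: "real^'a" assume "z \<in> cbox (\<chi> i. 1/4) (\<chi> i. 3/4)"
    then have "z \<in> box 0 1" using cube_bump_support_subset by blast
    then have z: "0 < z $ i" "z $ i < 1" for i by (auto simp: mem_box_cart)
    have x: "0 \<le> x $ i" "x $ i \<le> 1" for i using assms(3) by (auto simp: mem_Omega)
    have "0 < (1 - \<delta>) * x $ i + \<delta> * z $ i" for i
      using assms x[of i] z[of i] by (intro add_nonneg_pos) auto
    moreover have "(1 - \<delta>) * x $ i + \<delta> * z $ i < 1" for i
    proof -
      have "(1 - \<delta>) * x $ i \<le> 1 - \<delta>" using assms x[of i] by (intro mult_left_le) auto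
      moreover have "\<delta> * z $ i < \<delta>" using assms z[of i] by simp
      ultimately show ?thesis by simp
    qed
    ultimately show "(1 - \<delta>) *\<^sub>R x + \<delta> *\<^sub>R z \<in> box 0 1"
      by (simp add: mem_box_cart)
  qed
  show "y \<notin> ?K \<longrightarrow> mollifier \<delta> x y = 0" for y
    using mollifier_support[OF assms(1), of x y] by blast
qed

section \<open>Mass of the kernel in either variable\<close>

lemma nn_integral_affine:
  fixes f :: "real^'d \<Rightarrow> ennreal"
  assumes [measurable]: "f \<in> borel_measurable borel" and "c \<noteq> 0"
  shows "(\<integral>\<^sup>+x. f x \<partial>lborel) = ennreal (\<bar>c\<bar> ^ CARD('d)) * (\<integral>\<^sup>+x. f (t + c *\<^sub>R x) \<partial>lborel)"
  by (subst lborel_affine[OF \<open>c \<noteq> 0\<close>, of t])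
     (simp add: nn_integral_density nn_integral_distr nn_integral_cmult)

lemma nn_integral_cube_bump: "(\<integral>\<^sup>+x. ennreal (cube_bump (x :: real^'d)) \<partial>lborel) = ennreal (cube_bump_mass TYPE('d))"
proof -
  have "(\<integral>\<^sup>+x. ennreal (cube_bump (x :: real^'d)) \<partial>lborel) = (\<integral>\<^sup>+x. ennreal (cube_bump (x :: real^'d)) * indicator Omega x \<partial>lborel)"
    by (intro nn_integral_cong) (auto simp: indicator_def cube_bump_outside_Omega)
  also have "\<dots> = (\<integral>\<^sup>+x. ennreal (cube_bump (x :: real^'d)) \<partial>lebesgue_on Omega)"
    by (rule nn_integral_Omega[symmetric])
  also have "\<dots> = ennreal (cube_bump_mass TYPE('d))"
    unfolding cube_bump_mass_def
    by (intro nn_integral_eq_integral continuous_integrable continuous_cube_bump) (simp add: cube_bump_nonneg)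
  finally show ?thesis .
qed

lemma nn_integral_cube_bump_affine:
  assumes "c > 0"
  shows "(\<integral>\<^sup>+x. ennreal (cube_bump (t + c *\<^sub>R x :: real^'d)) \<partial>lborel) = ennreal (cube_bump_mass TYPE('d) / c ^ CARD('d))"
proof -
  have "ennreal (cube_bump_mass TYPE('d)) = ennreal (c ^ CARD('d)) * (\<integral>\<^sup>+x. ennreal (cube_bump (t + c *\<^sub>R x :: real^'d)) \<partial>lborel)"
    using nn_integral_affine[of "\<lambda>x. ennreal (cube_bump (x :: real^'d))" c t] assms by (simp add: nn_integral_cube_bump)
  then have "ennreal (cube_bump_mass TYPE('d)) / ennreal (c ^ CARD('d)) = (\<integral>\<^sup>+x. ennreal (cube_bump (t + c *\<^sub>R x :: real^'d)) \<partial>lborel)"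
    using assms by (simp add: ennreal_mult_divide_eq mult.commute[of "ennreal (c ^ CARD('d))"])
  then show ?thesis
    using assms cube_bump_mass_pos[where 'd = 'd] by (simp add: divide_ennreal)
qed

text \<open>In the kernel the variable \<open>x\<close> has a negative coefficient. The reflection
  symmetry of the bump turns it into a positive one, for which the affine substitution is
  available.\<close>

lemma cube_bump_minus: "cube_bump (t + c *\<^sub>R x :: real^'d) = cube_bump ((1 - t) + (- c) *\<^sub>R x)"
proof -
  have "bump (1 - s) = bump s" for s
    by (simp add: bump_def mult.commute add.commute)
  from this[of "(t + c *\<^sub>R x) $ i" for i] show ?thesis
    by (simp add: cube_bump_def tensor_def algebra_simps)
qed

lemma nn_integral_mollifier:
  assumes "0 < \<delta>"
  shows "(\<integral>\<^sup>+y. ennreal (mollifier \<delta> (x :: real^'d) y) \<partial>lborel) = 1"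
proof -
  let ?k = "inverse (cube_bump_mass TYPE('d) * \<delta> ^ CARD('d))"
  have "(\<integral>\<^sup>+y. ennreal (mollifier \<delta> x y) \<partial>lborel) =
     (\<integral>\<^sup>+y. ennreal ?k * ennreal (cube_bump ((- (1 - \<delta>) / \<delta>) *\<^sub>R x + (1 / \<delta>) *\<^sub>R y)) \<partial>lborel)"
    unfolding mollifier_def using assms cube_bump_mass_pos[where 'd = 'd]
    by (intro nn_integral_cong) (simp add: ennreal_mult' cube_bump_nonneg add.commute)
  also have "\<dots> = ennreal ?k * ennreal (cube_bump_mass TYPE('d) / (1 / \<delta>) ^ CARD('d))"
    using assms by (subst nn_integral_cmult) (auto simp: nn_integral_cube_bump_affine)
  also have "\<dots> = ennreal (?k * (cube_bump_mass TYPE('d) / (1 / \<delta>) ^ CARD('d)))"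
    using assms cube_bump_mass_pos[where 'd = 'd] by (intro ennreal_mult[symmetric]) auto
  also have "?k * (cube_bump_mass TYPE('d) / (1 / \<delta>) ^ CARD('d)) = 1"
    using assms cube_bump_mass_pos[where 'd = 'd] by (simp add: field_simps)
  finally show ?thesis by simp
qed

text \<open>As a function of \<open>x\<close> the kernel is scaled by
  \<open>(1 - \<delta>) / \<delta>\<close> instead of \<open>1 / \<delta>\<close>, which leaves a
  mass slightly above 1. This mass controls the norm of mollification on \<open>L2\<close>.\<close>

lemma nn_integral_mollifier':
  assumes "0 < \<delta>" "\<delta> < 1"
  shows "(\<integral>\<^sup>+x. ennreal (mollifier \<delta> x (y :: real^'d)) \<partial>lborel) = ennreal (1 / (1 - \<delta>) ^ CARD('d))"
proof -
  let ?k = "inverse (cube_bump_mass TYPE('d) * \<delta> ^ CARD('d))"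
  have "(\<integral>\<^sup>+x. ennreal (mollifier \<delta> x y) \<partial>lborel) =
     (\<integral>\<^sup>+x. ennreal ?k * ennreal (cube_bump ((1 - (1 / \<delta>) *\<^sub>R y) + ((1 - \<delta>) / \<delta>) *\<^sub>R x)) \<partial>lborel)"
    unfolding mollifier_def using assms cube_bump_mass_pos[where 'd = 'd]
    by (intro nn_integral_cong) (simp add: ennreal_mult' cube_bump_nonneg, subst cube_bump_minus, simp add: minus_divide_left)
  also have "\<dots> = ennreal ?k * ennreal (cube_bump_mass TYPE('d) / ((1 - \<delta>) / \<delta>) ^ CARD('d))"
    using assms by (subst nn_integral_cmult) (auto simp: nn_integral_cube_bump_affine)
  also have "\<dots> = ennreal (?k * (cube_bump_mass TYPE('d) / ((1 - \<delta>) / \<delta>) ^ CARD('d)))"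
    using assms cube_bump_mass_pos[where 'd = 'd] by (intro ennreal_mult[symmetric]) auto
  also have "?k * (cube_bump_mass TYPE('d) / ((1 - \<delta>) / \<delta>) ^ CARD('d)) = 1 / (1 - \<delta>) ^ CARD('d)"
    using assms cube_bump_mass_pos[where 'd = 'd] by (simp add: field_simps)
  finally show ?thesis .
qed

text \<open>The kernel depends on \<open>x\<close> and \<open>y\<close> through one affine
  combination, so its derivative in \<open>x\<close> is \<open>- (1 - \<delta>)\<close> times its
  derivative in \<open>y\<close>. In this form the derivative falls on the integration variable,
  where weak derivatives can take it over.\<close>

lemma mollify_has_derivative:
  assumes f: "f \<in> L2 (lebesgue_on Omega)" 
  shows "(mollify \<delta> f has_derivative (\<lambda>h. \<Sum>i\<in>UNIV. h $ i *
     (LINT y|lebesgue_on Omega. f y * (- (1 - \<delta>) * partial i (mollifier \<delta> x) y)))) (at x)"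
  and "C_k (Suc 0) (mollify \<delta> f)"
proof -
  let ?M = "lebesgue_on (Omega :: (real^'a) set)"
  let ?k = "inverse (cube_bump_mass TYPE('a) * \<delta> ^ CARD('a))"
  let ?a = "1 / \<delta>" and ?b = "- (1 - \<delta>) / \<delta>"
  obtain B where B: "\<And>x :: real^'a. \<bar>cube_bump x\<bar> \<le> B" "\<And>i (x :: real^'a). \<bar>partial i cube_bump x\<bar> \<le> B"
    using cube_bump_bounded by blast
  have fi: "integrable ?M f" by (rule Om.L2_integrable[OF f])
  have C1: "C_k (Suc 0) (cube_bump :: real^'a \<Rightarrow> real)" by (rule C_k_cube_bump)
  have diff: "cube_bump differentiable at x" for x :: "real^'a" using C1 by auto
  have pc: "continuous_on UNIV (partial i (cube_bump :: real^'a \<Rightarrow> real))" for i using C1 by auto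
  \<comment> \<open>The ratio of the coefficients of \<open>x\<close> and \<open>y\<close> in the
    argument is \<open>- (1 - \<delta>)\<close>.\<close>
  have pk: "?k * (?b * partial i cube_bump (?a *\<^sub>R y + ?b *\<^sub>R x)) = - (1 - \<delta>) * partial i (mollifier \<delta> x) y" for i and x y :: "real^'a"
  proof -
    have "partial i (\<lambda>y. ?k * cube_bump (?a *\<^sub>R y + ?b *\<^sub>R x)) y = ?k * partial i (\<lambda>y. cube_bump (?a *\<^sub>R y + ?b *\<^sub>R x)) y"
      by (rule partial_cmult, rule differentiableI, rule has_derivative_affine_arg[OF diff])
    then have "partial i (mollifier \<delta> x) y = ?k * (?a * partial i cube_bump (?a *\<^sub>R y + ?b *\<^sub>R x))"
      unfolding partial_affine_arg[OF diff] by (simp only: mollifier_def [abs_def])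
    then show ?thesis by simp
  qed
  have m: "mollify \<delta> f = (\<lambda>x. ?k * (LINT y|?M. f y * cube_bump (?a *\<^sub>R y + ?b *\<^sub>R x)))"
    unfolding mollify_def [abs_def] mollifier_def by (simp only: mult.left_commute[of _ ?k] integral_mult_right_zero)
  have "(mollify \<delta> f has_derivative (\<lambda>h. ?k * (\<Sum>i\<in>UNIV. h $ i * (LINT y|?M. f y * (?b * partial i cube_bump (?a *\<^sub>R y + ?b *\<^sub>R x)))))) (at x)" for x
    unfolding m
    by (intro has_derivative_mult_right kernel_integral_has_derivative[where B = B] C_k_cube_bump B fi)
  moreover have "?k * (\<Sum>i\<in>UNIV. h $ i * (LINT y|?M. f y * (?b * partial i cube_bump (?a *\<^sub>R y + ?b *\<^sub>R x))))
     = (\<Sum>i\<in>UNIV. h $ i * (LINT y|?M. f y * (- (1 - \<delta>) * partial i (mollifier \<delta> x) y)))" for h x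
    unfolding pk[symmetric] sum_distrib_left
    by (intro sum.cong refl) (simp only: mult.left_commute[of _ ?k] integral_mult_right_zero)
  ultimately show D: "(mollify \<delta> f has_derivative (\<lambda>h. \<Sum>i\<in>UNIV. h $ i *
     (LINT y|?M. f y * (- (1 - \<delta>) * partial i (mollifier \<delta> x) y)))) (at x)" for x
    by simp
  have "partial i (mollify \<delta> f) x = (?k * ?b) * (LINT y|?M. f y * partial i cube_bump (?a *\<^sub>R y + ?b *\<^sub>R x))" for i x
  proof -
    have "partial i (mollify \<delta> f) x = (\<Sum>j\<in>UNIV. axis i 1 $ j * (LINT y|?M. f y * (- (1 - \<delta>) * partial j (mollifier \<delta> x) y)))"
      by (rule partial_eqI[OF D])
    also have "\<dots> = (LINT y|?M. f y * (- (1 - \<delta>) * partial i (mollifier \<delta> x) y))"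
      by (simp add: axis_def if_distrib[of "\<lambda>c. c * _"] cong: if_cong)
    also have "\<dots> = (LINT y|?M. (?k * ?b) * (f y * partial i cube_bump (?a *\<^sub>R y + ?b *\<^sub>R x)))"
      unfolding pk[symmetric] by (simp only: mult_ac)
    finally show ?thesis by simp
  qed
  then have "continuous_on UNIV (partial i (mollify \<delta> f))" for i
    by (simp only: ext[of "partial i (mollify \<delta> f)"]) (intro continuous_intros kernel_integral_continuous[where B = B] pc B fi)
  with D show "C_k (Suc 0) (mollify \<delta> f)"
    unfolding C1_iff by (auto simp: differentiable_def)
qed

text \<open>For \<open>x\<close> in the closed cube the kernel is a test function, so the definition
  of the weak derivative moves the derivative from the kernel to \<open>f\<close>. The factor
  \<open>1 - \<delta>\<close> is the price of shrinking \<open>x\<close> into the interior and tends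
  to 1.\<close>

lemma partial_mollify:
  assumes f: "f \<in> L2 (lebesgue_on Omega)" and w: "has_weak_partial i f g"
    and "0 < \<delta>" "\<delta> < 1" "x \<in> Omega"
  shows "partial i (mollify \<delta> f) x = (1 - \<delta>) * mollify \<delta> g x"
proof -
  let ?M = "lebesgue_on (Omega :: (real^'a) set)"
  have "partial i (mollify \<delta> f) x = (\<Sum>j\<in>UNIV. axis i 1 $ j * (LINT y|?M. f y * (- (1 - \<delta>) * partial j (mollifier \<delta> x) y)))"
    by (rule partial_eqI[OF mollify_has_derivative(1)[OF f]])
  also have "\<dots> = (LINT y|?M. f y * (- (1 - \<delta>) * partial i (mollifier \<delta> x) y))"
    by (simp add: axis_def if_distrib[of "\<lambda>c. c * _"] cong: if_cong)
  also have "\<dots> = (LINT y|?M. - (1 - \<delta>) * (f y * partial i (mollifier \<delta> x) y))"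
    by (simp only: mult_ac)
  also have "\<dots> = (1 - \<delta>) * mollify \<delta> g x"
    using w mollifier_test_function[OF assms(3-5)]
    by (simp only: integral_mult_right_zero has_weak_partial_def mollify_def)
  finally show ?thesis .
qed


lemma mollifier_outside:
  assumes "0 < \<delta>" "\<delta> < 1" "x \<in> Omega" "y \<notin> Omega" shows "mollifier \<delta> x y = 0"
proof -
  obtain K where "K \<subseteq> box 0 1" "\<And>z. z \<notin> K \<Longrightarrow> mollifier \<delta> x z = 0"
    using mollifier_test_function[OF assms(1-3)] by (auto simp: test_function_def)
  with assms(4) show ?thesis using box_subset_cbox[of "0 :: real^'a" 1] by blast
qed

lemma continuous_mollifier: "continuous_on UNIV (mollifier \<delta> x)"
  unfolding mollifier_def [abs_def]
  by (intro continuous_intros continuous_on_compose2[OF continuous_cube_bump]) auto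

lemma measurable_mollifier [measurable (raw)]:
  assumes [measurable]: "f \<in> borel_measurable M" "g \<in> borel_measurable M"
  shows "(\<lambda>p. mollifier \<delta> (f p) (g p)) \<in> borel_measurable M"
  unfolding mollifier_def by measurable

lemma nn_integral_mollifier_Omega:
  assumes "0 < \<delta>" "\<delta> < 1" "x \<in> Omega"
  shows "(\<integral>\<^sup>+y. ennreal (mollifier \<delta> x y) \<partial>lebesgue_on Omega) = 1"
proof -
  have "(\<integral>\<^sup>+y. ennreal (mollifier \<delta> x y) \<partial>lebesgue_on Omega) = (\<integral>\<^sup>+y. ennreal (mollifier \<delta> x y) \<partial>lborel)"
    unfolding nn_integral_Omega
    by (intro nn_integral_cong) (auto simp: indicator_def mollifier_outside[OF assms])
  then show ?thesis by (simp add: nn_integral_mollifier assms)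
qed

lemma integral_mollifier:
  assumes "0 < \<delta>" "\<delta> < 1" "x \<in> Omega"
  shows "(LINT y|lebesgue_on Omega. mollifier \<delta> x y) = 1"
proof -
  have "ennreal (LINT y|lebesgue_on Omega. mollifier \<delta> x y) = 1"
    using nn_integral_mollifier_Omega[OF assms]
    by (subst nn_integral_eq_integral[symmetric]) (auto simp: mollifier_nonneg assms intro: continuous_integrable continuous_mollifier)
  then show ?thesis by (metis ennreal_eq_1)
qed

text \<open>Jensen's inequality for the probability density \<open>mollifier \<delta> x\<close>,
  obtained from Cauchy-Schwarz by splitting the kernel into two square roots, one of which
  integrates to 1.\<close>

lemma mollify_square_le:
  assumes d: "0 < \<delta>" "\<delta> < 1" "x \<in> Omega" and [measurable]: "g \<in> borel_measurable (lebesgue_on Omega)"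
  shows "ennreal ((norm (mollify \<delta> g x))\<^sup>2) \<le> (\<integral>\<^sup>+y. ennreal ((g y)\<^sup>2) * ennreal (mollifier \<delta> x y) \<partial>lebesgue_on Omega)"
proof -
  let ?M = "lebesgue_on (Omega :: (real^'a) set)"
  have [measurable]: "mollifier \<delta> x \<in> borel_measurable ?M" by (rule measurable_on_Omega) measurable
  note kn = mollifier_nonneg[OF d(1)]
  \<comment> \<open>If the integrand is not integrable, the Bochner integral is 0 by convention and
    the bound is trivial.\<close>
  have "ennreal (norm (mollify \<delta> g x)) \<le> (\<integral>\<^sup>+y. ennreal (norm (g y * mollifier \<delta> x y)) \<partial>?M)"
    unfolding mollify_def
    by (cases "integrable ?M (\<lambda>y. g y * mollifier \<delta> x y)", erule integral_norm_bound_ennreal)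
       (simp add: not_integrable_integral_eq)
  also have "\<dots> = (\<integral>\<^sup>+y. ennreal (\<bar>g y\<bar> * sqrt (mollifier \<delta> x y)) * ennreal (sqrt (mollifier \<delta> x y)) \<partial>?M)"
    by (intro nn_integral_cong) (simp add: ennreal_mult[symmetric] kn abs_mult mult.assoc)
  finally have "(ennreal (norm (mollify \<delta> g x)))\<^sup>2 \<le>
      (\<integral>\<^sup>+y. ennreal (\<bar>g y\<bar> * sqrt (mollifier \<delta> x y)) * ennreal (sqrt (mollifier \<delta> x y)) \<partial>?M)\<^sup>2"
    by (rule power_mono) simp
  also have "\<dots> \<le> (\<integral>\<^sup>+y. (ennreal (\<bar>g y\<bar> * sqrt (mollifier \<delta> x y)))\<^sup>2 \<partial>?M) * (\<integral>\<^sup>+y. (ennreal (sqrt (mollifier \<delta> x y)))\<^sup>2 \<partial>?M)"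
    by (rule Cauchy_Schwarz_nn_integral) measurable
  also have "(\<integral>\<^sup>+y. (ennreal (sqrt (mollifier \<delta> x y)))\<^sup>2 \<partial>?M) = (\<integral>\<^sup>+y. ennreal (mollifier \<delta> x y) \<partial>?M)"
    by (intro nn_integral_cong) (simp add: ennreal_power kn)
  also have "\<dots> = 1"
    by (rule nn_integral_mollifier_Omega[OF d])
  also have "(\<integral>\<^sup>+y. (ennreal (\<bar>g y\<bar> * sqrt (mollifier \<delta> x y)))\<^sup>2 \<partial>?M) = (\<integral>\<^sup>+y. ennreal ((g y)\<^sup>2) * ennreal (mollifier \<delta> x y) \<partial>?M)"
    by (intro nn_integral_cong) (simp add: ennreal_power kn ennreal_mult[symmetric] power_mult_distrib)
  finally show ?thesis by (simp add: ennreal_power)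
qed

text \<open>Members of \<open>L2\<close> are only Lebesgue measurable, whereas Tonelli's theorem on
  the product of two copies of \<open>lborel\<close> wants Borel functions.\<close>

lemma borel_representative:
  assumes "g \<in> borel_measurable (lebesgue_on (Omega :: (real^'d) set))"
  obtains g' :: "real^'d \<Rightarrow> real" where "g' \<in> borel_measurable borel" "AE x in lebesgue_on Omega. g x = g' x"
proof -
  have "(\<lambda>x. if x \<in> Omega then g x else 0) \<in> borel_measurable lebesgue"
    using assms by (simp add: borel_measurable_if)
  then have "(\<lambda>x. if x \<in> Omega then g x else 0) \<in> borel_measurable (completion lborel)" by simp
  from completion_ex_borel_measurable_real[OF this] obtain g'
    where g': "g' \<in> borel_measurable lborel" "AE x in lborel. (if x \<in> Omega then g x else 0) = g' x" by blast
  have "AE x in lebesgue. (if x \<in> Omega then g x else 0) = g' x"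
    using g'(2) by (rule AE_completion)
  then have "AE x in lebesgue_on Omega. g x = g' x"
    by (auto simp: AE_restrict_space_iff elim: eventually_mono)
  with g'(1) show ?thesis using that by simp
qed

text \<open>Integrating the pointwise Jensen bound and exchanging the order leaves the mass of the
  kernel in \<open>x\<close>, as in Schur's test. The restriction \<open>\<delta> \<le> 1/2\<close>
  makes the bound uniform in \<delta>.\<close>

lemma mollify_L2_bound:
  fixes g :: "real^'d \<Rightarrow> real"
  assumes d: "0 < \<delta>" "\<delta> \<le> 1/2" and g: "g \<in> L2 (lebesgue_on Omega)"
  shows "L2_norm (lebesgue_on Omega) (mollify \<delta> g) \<le> 2 ^ CARD('d) * L2_norm (lebesgue_on Omega) g"
proof -
  let ?M = "lebesgue_on (Omega :: (real^'d) set)"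
  have [measurable]: "g \<in> borel_measurable ?M" by (rule L2_measurable[OF g])
  obtain g' where g'[measurable]: "g' \<in> borel_measurable borel" and ae: "AE x in ?M. g x = g' x"
    using borel_representative[OF L2_measurable[OF g]] by blast
  have [measurable]: "g' \<in> borel_measurable ?M" by (rule measurable_on_Omega) measurable
  have d1: "\<delta> < 1" using d by simp
  have "(\<integral>\<^sup>+x. ennreal ((norm (mollify \<delta> g x))\<^sup>2) \<partial>?M) \<le>
     (\<integral>\<^sup>+x. (\<integral>\<^sup>+y. ennreal ((g y)\<^sup>2) * ennreal (mollifier \<delta> x y) \<partial>?M) \<partial>?M)"
    by (intro nn_integral_mono mollify_square_le d d1) auto
  also have "\<dots> = (\<integral>\<^sup>+x. (\<integral>\<^sup>+y. ennreal ((g' y)\<^sup>2) * ennreal (mollifier \<delta> x y) \<partial>?M) \<partial>?M)"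
    using ae by (intro nn_integral_cong nn_integral_cong_AE) (auto elim: eventually_mono)
  also have "\<dots> = (\<integral>\<^sup>+x. (\<integral>\<^sup>+y. ennreal ((g' y)\<^sup>2) * ennreal (mollifier \<delta> x y) * indicator Omega y \<partial>lborel) * indicator Omega x \<partial>lborel)"
    by (simp add: nn_integral_Omega)
  also have "\<dots> \<le> (\<integral>\<^sup>+x. (\<integral>\<^sup>+y. ennreal ((g' y)\<^sup>2) * ennreal (mollifier \<delta> x y) * indicator Omega y \<partial>lborel) \<partial>lborel)"
    by (intro nn_integral_mono) (simp add: indicator_def)
  also have "\<dots> = (\<integral>\<^sup>+y. (\<integral>\<^sup>+x. ennreal ((g' y)\<^sup>2) * ennreal (mollifier \<delta> x y) * indicator Omega y \<partial>lborel) \<partial>lborel)"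
    by (rule lborel_pair.Fubini') measurable
  also have "\<dots> = (\<integral>\<^sup>+y. (\<integral>\<^sup>+x. (ennreal ((g' y)\<^sup>2) * indicator Omega y) * ennreal (mollifier \<delta> x y) \<partial>lborel) \<partial>lborel)"
    by (simp only: mult_ac)
  also have "\<dots> = (\<integral>\<^sup>+y. (ennreal ((g' y)\<^sup>2) * indicator Omega y) * ennreal (1 / (1 - \<delta>) ^ CARD('d)) \<partial>lborel)"
  proof (rule nn_integral_cong)
    fix y :: "real^'d"
    have [measurable]: "(\<lambda>x. mollifier \<delta> x y) \<in> borel_measurable borel"
      unfolding mollifier_def by measurable
    show "(\<integral>\<^sup>+x. (ennreal ((g' y)\<^sup>2) * indicator Omega y) * ennreal (mollifier \<delta> x y) \<partial>lborel) =
        (ennreal ((g' y)\<^sup>2) * indicator Omega y) * ennreal (1 / (1 - \<delta>) ^ CARD('d))"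
      by (subst nn_integral_cmult) (auto simp: nn_integral_mollifier'[OF d(1) d1])
  qed
  also have "\<dots> = (\<integral>\<^sup>+y. ennreal ((g' y)\<^sup>2) \<partial>?M) * ennreal (1 / (1 - \<delta>) ^ CARD('d))"
    by (subst nn_integral_multc) (auto simp: nn_integral_Omega)
  also have "(\<integral>\<^sup>+y. ennreal ((g' y)\<^sup>2) \<partial>?M) = (\<integral>\<^sup>+y. ennreal ((g y)\<^sup>2) \<partial>?M)"
    using ae by (intro nn_integral_cong_AE) (auto elim: eventually_mono)
  also have "\<dots> = ennreal ((L2_norm ?M g)\<^sup>2)"
    using L2_integrable_square[OF g] by (subst nn_integral_eq_integral) (auto simp: L2_norm_square)
  also have "ennreal ((L2_norm ?M g)\<^sup>2) * ennreal (1 / (1 - \<delta>) ^ CARD('d)) \<le> ennreal ((L2_norm ?M g)\<^sup>2) * ennreal ((2 ^ CARD('d))\<^sup>2)"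
  proof (intro mult_left_mono ennreal_leI)
    \<comment> \<open>The mass is at most \<open>2 ^ CARD('d)\<close>; it is enlarged to a square so
      that the root can be taken cleanly.\<close>
    have "1 / (1 - \<delta>) ^ CARD('d) = (1 / (1 - \<delta>)) ^ CARD('d)" by (simp add: power_divide)
    also have "\<dots> \<le> 2 ^ CARD('d)" using d by (intro power_mono) (auto simp: field_simps)
    also have "\<dots> \<le> (2 ^ CARD('d))\<^sup>2" by (simp add: power2_eq_square)
    finally show "1 / (1 - \<delta>) ^ CARD('d) \<le> (2 ^ CARD('d))\<^sup>2" .
  qed simp
  finally have le: "(\<integral>\<^sup>+x. ennreal ((norm (mollify \<delta> g x))\<^sup>2) \<partial>?M) \<le> ennreal ((2 ^ CARD('d) * L2_norm ?M g)\<^sup>2)"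
    by (simp add: ennreal_mult[symmetric] power_mult_distrib mult.commute)
  have "mollify \<delta> g \<in> borel_measurable ?M"
    by (intro continuous_on_UNIV_measurable C1_continuous mollify_has_derivative(2) g)
  from L2_from_nn_integral(2)[OF this le]
  have "(L2_norm ?M (mollify \<delta> g))\<^sup>2 \<le> (2 ^ CARD('d) * L2_norm ?M g)\<^sup>2" by simp
  then show ?thesis by (rule power2_le_imp_le) simp
qed

text \<open>The kernel has mass 1 and lives within distance \<open>2 R \<delta>\<close> of
  \<open>x\<close>, where \<open>R\<close> bounds the cube, so uniform continuity bounds the
  pointwise error on the cube, which has volume 1.\<close>

lemma mollify_continuous_near:
  fixes g :: "real^'d \<Rightarrow> real"
  assumes g: "continuous_on UNIV g" and "e > 0"
  shows "\<exists>d>0. \<forall>\<delta>. 0 < \<delta> \<and> \<delta> < d \<and> \<delta> < 1 \<longrightarrow> L2_norm (lebesgue_on Omega) (\<lambda>x. mollify \<delta> g x - g x) \<le> e"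
proof -
  let ?M = "lebesgue_on (Omega :: (real^'d) set)"
  have "uniformly_continuous_on Omega g"
    by (intro compact_uniformly_continuous continuous_on_subset[OF g]) auto
  then obtain d0 where d0: "d0 > 0" "\<And>x y. x \<in> Omega \<Longrightarrow> y \<in> Omega \<Longrightarrow> dist y x < d0 \<Longrightarrow> dist (g y) (g x) < e"
    using \<open>e > 0\<close> unfolding uniformly_continuous_on_def by metis
  obtain R where R: "R > 0" "\<And>x :: real^'d. x \<in> Omega \<Longrightarrow> norm x \<le> R"
    using continuous_Omega_bounded[of "\<lambda>x. x"] by auto
  \<comment> \<open>A point \<open>(1 - \<delta>) x + \<delta> z\<close> is at distance
    \<open>\<delta> |z - x| \<le> 2 R \<delta>\<close> from \<open>x\<close>, hence the radius
    \<open>d0 / (2 * R)\<close>.\<close>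
  show ?thesis
  proof (intro exI[of _ "d0 / (2 * R)"] conjI allI impI)
    show "d0 / (2 * R) > 0" using d0 R by simp
    fix \<delta> :: real assume "0 < \<delta> \<and> \<delta> < d0 / (2 * R) \<and> \<delta> < 1"
    then have d: "0 < \<delta>" "\<delta> < d0 / (2 * R)" "\<delta> < 1" by auto
    have pt: "\<bar>mollify \<delta> g x - g x\<bar> \<le> e" if x: "x \<in> Omega" for x
    proof -
      have kint: "integrable ?M (mollifier \<delta> x)" by (intro continuous_integrable continuous_mollifier)
      have gint: "integrable ?M (\<lambda>y. g y * mollifier \<delta> x y)"
        by (intro continuous_integrable continuous_intros g continuous_mollifier)
      have "mollify \<delta> g x - g x = (LINT y|?M. g y * mollifier \<delta> x y) - g x * (LINT y|?M. mollifier \<delta> x y)"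
        by (simp add: mollify_def integral_mollifier[OF d(1,3) x])
      also have "\<dots> = (LINT y|?M. g y * mollifier \<delta> x y - g x * mollifier \<delta> x y)"
        using kint gint by simp
      finally have "\<bar>mollify \<delta> g x - g x\<bar> \<le> (LINT y|?M. \<bar>g y * mollifier \<delta> x y - g x * mollifier \<delta> x y\<bar>)"
        using integral_norm_bound[of ?M "\<lambda>y. g y * mollifier \<delta> x y - g x * mollifier \<delta> x y"] by simp
      also have "\<dots> \<le> (LINT y|?M. e * mollifier \<delta> x y)"
      proof (rule integral_mono)
        show "integrable ?M (\<lambda>y. \<bar>g y * mollifier \<delta> x y - g x * mollifier \<delta> x y\<bar>)"
          using kint gint by simp
        show "integrable ?M (\<lambda>y. e * mollifier \<delta> x y)" using kint by simp
        fix y assume "y \<in> space ?M"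
        then have y: "y \<in> Omega" by simp
        show "\<bar>g y * mollifier \<delta> x y - g x * mollifier \<delta> x y\<bar> \<le> e * mollifier \<delta> x y"
        proof (cases "mollifier \<delta> x y = 0")
          case False
          with mollifier_support[OF d(1)] obtain z where z: "z \<in> cbox (\<chi> i. 1/4) (\<chi> i. 3/4)"
            and yz: "y = (1 - \<delta>) *\<^sub>R x + \<delta> *\<^sub>R z" by metis
          have zO: "z \<in> Omega" using z cube_bump_support_subset box_subset_cbox by blast
          have "y - x = \<delta> *\<^sub>R (z - x)" by (simp add: yz algebra_simps)
          then have "dist y x = \<delta> * norm (z - x)" using d by (simp add: dist_norm)
          also have "\<dots> \<le> \<delta> * (2 * R)"
            using d R(2)[OF zO] R(2)[OF x] norm_triangle_ineq4[of z x] by (intro mult_left_mono) auto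
          also have "\<dots> < d0" using d R by (simp add: field_simps)
          finally have "\<bar>g y - g x\<bar> \<le> e" using d0(2)[OF x y] by (simp add: dist_real_def)
          then have "\<bar>g y - g x\<bar> * mollifier \<delta> x y \<le> e * mollifier \<delta> x y"
            by (intro mult_right_mono mollifier_nonneg d)
          moreover have "\<bar>g y * mollifier \<delta> x y - g x * mollifier \<delta> x y\<bar> = \<bar>g y - g x\<bar> * mollifier \<delta> x y"
            using mollifier_nonneg[OF d(1), of x y] by (simp add: left_diff_distrib[symmetric] abs_mult)
          ultimately show ?thesis by simp
        qed simp
      qed
      also have "\<dots> = e" by (simp add: integral_mollifier[OF d(1,3) x])
      finally show ?thesis .
    qed
    have "L2_norm ?M (\<lambda>x. mollify \<delta> g x - g x) \<le> L2_norm ?M (\<lambda>x. e)"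
    proof (rule L2_norm_mono)
      show "AE x in ?M. norm (mollify \<delta> g x - g x) \<le> norm e"
        using pt \<open>e > 0\<close> by (intro AE_OmegaI) simp
      show "(\<lambda>x. mollify \<delta> g x - g x) \<in> borel_measurable ?M"
        by (intro continuous_on_UNIV_measurable continuous_intros C1_continuous[OF mollify_has_derivative(2)] g continuous_L2)
    qed simp
    also have "\<dots> = e" using \<open>e > 0\<close> by (simp add: L2_norm_def)
    finally show "L2_norm ?M (\<lambda>x. mollify \<delta> g x - g x) \<le> e" .
  qed
qed

lemma mollify_cont: "f \<in> L2 (lebesgue_on Omega) \<Longrightarrow> continuous_on UNIV (mollify \<delta> f)"
  by (rule C1_continuous[OF mollify_has_derivative(2)])

lemma mollify_diff:
  fixes f g :: "real^'d \<Rightarrow> real"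
  assumes "f \<in> L2 (lebesgue_on Omega)" "g \<in> L2 (lebesgue_on Omega)"
  shows "mollify \<delta> (\<lambda>x. f x - g x) x = mollify \<delta> f x - mollify \<delta> g x"
proof -
  have "integrable (lebesgue_on Omega) (\<lambda>y. f y * mollifier \<delta> x y)" if "f \<in> L2 (lebesgue_on Omega)" for f
    using L2_inner_integrable[OF that continuous_L2[OF continuous_mollifier, of \<delta> x]] by simp
  with assms show ?thesis
    by (simp add: mollify_def left_diff_distrib)
qed

text \<open>Approximation of the identity: the bound uniform in \<delta> allows replacing
  \<open>f\<close> by a nearby continuous function, for which convergence is known.\<close>

lemma mollify_tendsto:
  fixes f :: "real^'d \<Rightarrow> real"
  assumes f: "f \<in> L2 (lebesgue_on Omega)" and d: "\<And>m. 0 < d m" "\<And>m. d m \<le> 1/2" "d \<longlonglongrightarrow> 0"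
  shows "(\<lambda>m. L2_norm (lebesgue_on Omega) (\<lambda>x. mollify (d m) f x - f x)) \<longlonglongrightarrow> 0"
proof (rule LIMSEQ_I)
  let ?M = "lebesgue_on (Omega :: (real^'d) set)"
  let ?C = "2 ^ CARD('d) :: real"
  fix e :: real assume e: "e > 0"
  \<comment> \<open>The three errors add up to \<open>(?C + 2) * e'\<close>; the extra unit in the
    denominator makes the final inequality strict.\<close>
  define e' where "e' = e / (?C + 3)"
  have C: "?C + 3 > 0" by (intro add_pos_pos) auto
  have e': "e' > 0" using e C by (simp add: e'_def)
  obtain c where c: "continuous_on UNIV c" "L2_norm ?M (\<lambda>x. f x - c x) < e'"
    using continuous_dense_L2[OF f e'] by blast
  obtain d0 where d0: "d0 > 0" "\<And>\<delta>. 0 < \<delta> \<and> \<delta> < d0 \<and> \<delta> < 1 \<Longrightarrow> L2_norm ?M (\<lambda>x. mollify \<delta> c x - c x) \<le> e'"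
    using mollify_continuous_near[OF c(1) e'] by blast
  obtain N where N: "\<And>m. m \<ge> N \<Longrightarrow> d m < d0"
    using LIMSEQ_D[OF d(3) d0(1)] d(1) by fastforce
  have cL: "c \<in> L2 ?M" by (rule continuous_L2[OF c(1)])
  have "L2_norm ?M (\<lambda>x. mollify (d m) f x - f x) < e" if m: "m \<ge> N" for m
  proof -
    have dm: "d m < 1" using d(2)[of m] by simp
    have fc: "(\<lambda>x. f x - c x) \<in> L2 ?M" by (intro L2_diff f cL)
    have "L2_norm ?M (\<lambda>x. mollify (d m) f x - f x) =
        L2_norm ?M (\<lambda>x. (mollify (d m) (\<lambda>x. f x - c x) x + (mollify (d m) c x - c x)) - (f x - c x))"
      by (simp add: mollify_diff[OF f cL])
    also have "\<dots> \<le> L2_norm ?M (\<lambda>x. mollify (d m) (\<lambda>x. f x - c x) x + (mollify (d m) c x - c x)) + L2_norm ?M (\<lambda>x. f x - c x)"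
      by (intro L2_norm_triangle_diff L2_add L2_diff continuous_L2 mollify_cont fc cL f c)
    also have "\<dots> \<le> (L2_norm ?M (mollify (d m) (\<lambda>x. f x - c x)) + L2_norm ?M (\<lambda>x. mollify (d m) c x - c x)) + L2_norm ?M (\<lambda>x. f x - c x)"
      by (intro add_right_mono L2_norm_triangle L2_diff continuous_L2 mollify_cont fc cL c)
    also have "\<dots> \<le> (?C * e' + e') + e'"
    proof (intro add_mono)
      have "L2_norm ?M (mollify (d m) (\<lambda>x. f x - c x)) \<le> ?C * L2_norm ?M (\<lambda>x. f x - c x)"
        by (rule mollify_L2_bound[OF d(1,2) fc])
      also have "\<dots> \<le> ?C * e'" using c(2) by (intro mult_left_mono) auto
      finally show "L2_norm ?M (mollify (d m) (\<lambda>x. f x - c x)) \<le> ?C * e'" .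
      show "L2_norm ?M (\<lambda>x. mollify (d m) c x - c x) \<le> e'"
        using d(1) dm N[OF m] by (intro d0) auto
    qed (use c(2) in simp)
    also have "\<dots> = (?C + 2) * e'" by (simp add: algebra_simps)
    also have "\<dots> < (?C + 3) * e'" using e' by simp
    also have "\<dots> = e" using C by (simp add: e'_def)
    finally show ?thesis .
  qed
  then show "\<exists>no. \<forall>m\<ge>no. norm (L2_norm ?M (\<lambda>x. mollify (d m) f x - f x) - 0) < e"
    by (intro exI[of _ N]) simp
qed

section \<open>Weak derivatives and traces\<close>

lemma test_function_continuous:
  assumes "test_function \<eta>"
  shows "continuous_on UNIV \<eta>" "continuous_on UNIV (partial i \<eta>)" "C_k (Suc 0) \<eta>"
proof -
  have "C_k k \<eta>" for k using assms by (simp add: test_function_def)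
  from this[of 0] this[of "Suc 0"]
  show "continuous_on UNIV \<eta>" "continuous_on UNIV (partial i \<eta>)" "C_k (Suc 0) \<eta>" by auto
qed

lemma has_weak_partial_diff:
  assumes L: "f \<in> L2 (lebesgue_on Omega)" "f' \<in> L2 (lebesgue_on Omega)"
      "g \<in> L2 (lebesgue_on Omega)" "g' \<in> L2 (lebesgue_on Omega)"
    and w: "has_weak_partial i f g" "has_weak_partial i f' g'"
  shows "has_weak_partial i (\<lambda>x. f x - f' x) (\<lambda>x. g x - g' x)"
  unfolding has_weak_partial_def
proof (intro allI impI)
  fix \<eta> :: "real^'a \<Rightarrow> real" assume t: "test_function \<eta>"
  have int: "integrable (lebesgue_on Omega) (\<lambda>x. h x * \<eta> x)"
      "integrable (lebesgue_on Omega) (\<lambda>x. h x * partial i \<eta> x)"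
    if "h \<in> L2 (lebesgue_on Omega)" for h
    using L2_inner_integrable[OF that continuous_L2[OF test_function_continuous(1)[OF t]]]
      L2_inner_integrable[OF that continuous_L2[OF test_function_continuous(2)[OF t]]] by simp_all
  show "(LINT x|lebesgue_on Omega. (f x - f' x) * partial i \<eta> x) = - (LINT x|lebesgue_on Omega. (g x - g' x) * \<eta> x)"
    using w t int L by (simp add: has_weak_partial_def left_diff_distrib)
qed

text \<open>The product with a test function vanishes on all faces, so the integral of its partial
  derivative is 0.\<close>

lemma has_weak_partial_C1:
  assumes F: "C_k (Suc 0) F" shows "has_weak_partial i F (partial i F)"
  unfolding has_weak_partial_def
proof (intro allI impI)
  fix \<eta> :: "real^'a \<Rightarrow> real" assume t: "test_function \<eta>"
  let ?M = "lebesgue_on (Omega :: (real^'a) set)"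
  note c = test_function_continuous[OF t] C1_continuous[OF F]
  have pc: "continuous_on UNIV (partial i F)" using F by auto
  have z: "\<eta> y = 0" if "y \<notin> box 0 1" for y
    using t that by (auto simp: test_function_def)
  have z': "\<eta> (face_proj i e x) = 0" if "e \<in> {0, 1}" for e x
    using that by (intro z) (auto simp: mem_box_cart)
  have "(LINT x|?M. partial i F x * \<eta> x + F x * partial i \<eta> x) = (LINT x|?M. partial i (\<lambda>x. F x * \<eta> x) x)"
    using F c(3) by (intro arg_cong[where f = "integral\<^sup>L ?M"] ext) (subst partial_mult, auto)
  also have "\<dots> = 0"
    by (subst integral_partial[OF C1_mult[OF F c(3)]]) (simp add: z')
  finally have "(LINT x|?M. partial i F x * \<eta> x) + (LINT x|?M. F x * partial i \<eta> x) = 0"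
    by (subst (asm) Bochner_Integration.integral_add) (auto intro!: continuous_integrable continuous_intros c pc)
  then show "(LINT x|?M. F x * partial i \<eta> x) = - (LINT x|?M. partial i F x * \<eta> x)" by simp
qed

text \<open>The shift by 2 starts the radii at \<open>1/2\<close>, the largest value for which the
  uniform \<open>L2\<close> bound is stated.\<close>

lemma mollification_radius:
  "0 < 1 / real (m + 2)" "1 / real (m + 2) \<le> 1 / 2" "(\<lambda>m. 1 / real (m + 2)) \<longlonglongrightarrow> 0"
proof -
  show "(\<lambda>m. 1 / real (m + 2)) \<longlonglongrightarrow> 0"
    using LIMSEQ_ignore_initial_segment[OF lim_const_over_n[of 1], of 2] by simp
qed (auto simp: field_simps)

text \<open>Tested with the kernels, which are test functions for every point of the closed cube,
  the two derivatives have equal mollifications. The mollification of their difference is thus 0 on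
  the whole cube and at the same time converges to the difference in \<open>L2\<close>.\<close>

lemma has_weak_partial_unique:
  assumes g: "g \<in> L2 (lebesgue_on Omega)" "g' \<in> L2 (lebesgue_on Omega)"
    and w: "has_weak_partial i f g" "has_weak_partial i f g'"
  shows "AE x in lebesgue_on Omega. g x = g' x"
proof -
  let ?M = "lebesgue_on (Omega :: (real^'a) set)"
  let ?h = "\<lambda>x. g x - g' x"
  have h: "?h \<in> L2 ?M" by (intro L2_diff g)
  have m0: "mollify \<delta> ?h x = 0" if d: "0 < \<delta>" "\<delta> < 1" "x \<in> Omega" for \<delta> x
  proof -
    have "(LINT y|?M. g y * mollifier \<delta> x y) = (LINT y|?M. g' y * mollifier \<delta> x y)"
      using w mollifier_test_function[OF d] by (simp add: has_weak_partial_def)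
    then show ?thesis by (simp add: mollify_diff[OF g]) (simp add: mollify_def)
  qed
  have "L2_norm ?M (\<lambda>x. mollify (1 / real (m + 2)) ?h x - ?h x) = L2_norm ?M ?h" for m
  proof -
    have "L2_norm ?M (\<lambda>x. mollify (1 / real (m + 2)) ?h x - ?h x) = L2_norm ?M (\<lambda>x. 0 - ?h x)"
    proof (rule L2_norm_cong_AE)
      show "AE x in ?M. mollify (1 / real (m + 2)) ?h x - ?h x = 0 - ?h x"
        by (rule AE_OmegaI) (simp add: m0)
    qed (rule L2_measurable[OF L2_diff[OF continuous_L2[OF mollify_cont[OF h]] h]],
         rule L2_measurable[OF L2_diff[OF L2_zero h]])
    also have "\<dots> = L2_norm ?M ?h" by (simp add: L2_norm_def power2_commute)
    finally show ?thesis .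
  qed
  then have "(\<lambda>m :: nat. L2_norm ?M ?h) \<longlonglongrightarrow> 0"
    using mollify_tendsto[OF h mollification_radius] by simp
  then have "L2_norm ?M ?h = 0" by (simp add: LIMSEQ_const_iff)
  from L2_norm_eq_0_AE[OF h this] show ?thesis by simp
qed

section \<open>The space H1 and density of C1 functions\<close>

lemma H1_L2: "f \<in> H1 \<Longrightarrow> f \<in> L2 (lebesgue_on Omega)"
  by (simp add: H1_def)

lemma
  assumes "f \<in> H1"
  shows weak_partial_L2: "weak_partial i f \<in> L2 (lebesgue_on Omega)"
    and has_weak_partial_weak_partial: "has_weak_partial i f (weak_partial i f)"
proof -
  have "\<exists>g. g \<in> L2 (lebesgue_on Omega) \<and> has_weak_partial i f g"
    using assms by (auto simp: H1_def)
  from someI_ex[OF this] show "weak_partial i f \<in> L2 (lebesgue_on Omega)" "has_weak_partial i f (weak_partial i f)"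
    by (auto simp: weak_partial_def)
qed

text \<open>Frees the development from the Hilbert choice: any weak derivative at hand agrees with
  the chosen one outside a null set.\<close>

lemma weak_partial_AE:
  assumes "f \<in> L2 (lebesgue_on Omega)" "g \<in> L2 (lebesgue_on Omega)" "has_weak_partial i f g"
  shows "AE x in lebesgue_on Omega. weak_partial i f x = g x"
proof -
  have "weak_partial i f \<in> L2 (lebesgue_on Omega) \<and> has_weak_partial i f (weak_partial i f)"
    unfolding weak_partial_def by (rule someI[of _ g]) (use assms in auto)
  then show ?thesis using has_weak_partial_unique assms by blast
qed

lemma C1_H1:
  assumes F: "C_k (Suc 0) F" shows "F \<in> H1"
proof -
  have "F \<in> L2 (lebesgue_on Omega)"
    by (rule continuous_L2[OF C1_continuous[OF F]])
  moreover have "partial i F \<in> L2 (lebesgue_on Omega)" for i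
    using F by (intro continuous_L2) simp
  ultimately show ?thesis
    unfolding H1_def using has_weak_partial_C1[OF F] by blast
qed

lemma H1_diff:
  assumes "f \<in> H1" "g \<in> H1" shows "(\<lambda>x. f x - g x) \<in> H1"
proof -
  have "has_weak_partial i (\<lambda>x. f x - g x) (\<lambda>x. weak_partial i f x - weak_partial i g x)" for i
    using assms by (intro has_weak_partial_diff H1_L2 weak_partial_L2 has_weak_partial_weak_partial)
  moreover have "(\<lambda>x. weak_partial i f x - weak_partial i g x) \<in> L2 (lebesgue_on Omega)" for i
    using assms by (intro L2_diff weak_partial_L2)
  moreover have "(\<lambda>x. f x - g x) \<in> L2 (lebesgue_on Omega)"
    using assms by (intro L2_diff H1_L2)
  ultimately show ?thesis unfolding H1_def by blast
qed

lemma weak_partial_diff_AE: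
  assumes "f \<in> H1" "g \<in> H1"
  shows "AE x in lebesgue_on Omega. weak_partial i (\<lambda>x. f x - g x) x = weak_partial i f x - weak_partial i g x"
  using assms by (intro weak_partial_AE L2_diff has_weak_partial_diff)
    (auto intro: H1_L2 weak_partial_L2 has_weak_partial_weak_partial)

lemma grad_L2:
  assumes "f \<in> H1" shows "grad f \<in> L2 (lebesgue_on Omega)"
    and "(L2_norm (lebesgue_on Omega) (grad f))\<^sup>2 = (\<Sum>i\<in>UNIV. (L2_norm (lebesgue_on Omega) (weak_partial i f))\<^sup>2)"
proof -
  let ?M = "lebesgue_on (Omega :: (real^'a) set)"
  have n: "(norm (grad f x))\<^sup>2 = (\<Sum>i\<in>UNIV. (norm (weak_partial i f x))\<^sup>2)" for x
    by (simp only: power2_norm_eq_inner) (simp add: inner_vec_def grad_def)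
  have i: "integrable ?M (\<lambda>x. (norm (weak_partial i f x))\<^sup>2)" for i
    by (rule L2_integrable_square[OF weak_partial_L2[OF assms]])
  show "grad f \<in> L2 ?M"
  proof (rule L2I)
    show "grad f \<in> borel_measurable ?M"
      by (rule borel_measurable_vec) (simp add: grad_def L2_measurable[OF weak_partial_L2[OF assms]])
    show "integrable ?M (\<lambda>x. (norm (grad f x))\<^sup>2)" unfolding n using i by auto
  qed
  show "(L2_norm ?M (grad f))\<^sup>2 = (\<Sum>i\<in>UNIV. (L2_norm ?M (weak_partial i f))\<^sup>2)"
    unfolding L2_norm_square n using i by simp
qed

lemma H1_norm_nonneg [simp]: "H1_norm f \<ge> 0"
  by (simp add: H1_norm_def)

lemma H1_norm_square:
  "f \<in> H1 \<Longrightarrow> (H1_norm f)\<^sup>2 = (L2_norm (lebesgue_on Omega) f)\<^sup>2 + (\<Sum>i\<in>UNIV. (L2_norm (lebesgue_on Omega) (weak_partial i f))\<^sup>2)"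
  by (simp add: H1_norm_def grad_L2(2) sum_nonneg)

lemma L2_norm_le_H1_norm: "L2_norm (lebesgue_on Omega) f \<le> H1_norm f"
  and L2_norm_grad_le_H1_norm: "L2_norm (lebesgue_on Omega) (grad f) \<le> H1_norm f"
  by (auto simp: H1_norm_def intro: real_le_rsqrt)

lemma L2_norm_weak_partial_le:
  assumes "f \<in> H1"
  shows "L2_norm (lebesgue_on Omega) (weak_partial i f) \<le> L2_norm (lebesgue_on Omega) (grad f)"
proof (rule power2_le_imp_le)
  show "(L2_norm (lebesgue_on Omega) (weak_partial i f))\<^sup>2 \<le> (L2_norm (lebesgue_on Omega) (grad f))\<^sup>2"
    unfolding grad_L2(2)[OF assms] by (rule member_le_sum) auto
qed simp

lemma H1_norm_le:
  assumes "f \<in> H1"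
  shows "H1_norm f \<le> L2_norm (lebesgue_on Omega) f + (\<Sum>i\<in>UNIV. L2_norm (lebesgue_on Omega) (weak_partial i f))"
proof (rule power2_le_imp_le)
  let ?w = "\<lambda>i. L2_norm (lebesgue_on Omega) (weak_partial i f)"
  have "(\<Sum>i\<in>UNIV. (?w i)\<^sup>2) \<le> (\<Sum>i\<in>UNIV. ?w i * sum ?w UNIV)"
    unfolding power2_eq_square by (intro sum_mono mult_left_mono member_le_sum) auto
  also have "\<dots> = (sum ?w UNIV)\<^sup>2"
    by (simp add: power2_eq_square sum_distrib_right)
  finally have "(\<Sum>i\<in>UNIV. (?w i)\<^sup>2) \<le> (sum ?w UNIV)\<^sup>2" .
  then show "(H1_norm f)\<^sup>2 \<le> (L2_norm (lebesgue_on Omega) f + sum ?w UNIV)\<^sup>2"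
  proof -
    have "0 \<le> 2 * L2_norm (lebesgue_on Omega) f * sum ?w UNIV"
      by (intro mult_nonneg_nonneg sum_nonneg) auto
    with \<open>(\<Sum>i\<in>UNIV. (?w i)\<^sup>2) \<le> (sum ?w UNIV)\<^sup>2\<close> show ?thesis
      unfolding H1_norm_square[OF assms] power2_sum by linarith
  qed
qed (simp add: sum_nonneg)

lemma L2_norm_weak_partial_diff:
  assumes F: "C_k (Suc 0) F" and f: "f \<in> H1"
  shows "L2_norm (lebesgue_on Omega) (weak_partial i (\<lambda>x. F x - f x)) =
    L2_norm (lebesgue_on Omega) (\<lambda>x. partial i F x - weak_partial i f x)"
proof (rule L2_norm_cong_AE)
  have pc: "partial i F \<in> L2 (lebesgue_on Omega)" using F by (intro continuous_L2) auto
  have "AE x in lebesgue_on Omega. weak_partial i F x = partial i F x"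
    by (intro weak_partial_AE H1_L2 C1_H1 F pc has_weak_partial_C1)
  with weak_partial_diff_AE[OF C1_H1[OF F] f, of i]
  show "AE x in lebesgue_on Omega. weak_partial i (\<lambda>x. F x - f x) x = partial i F x - weak_partial i f x"
    by eventually_elim simp
  show "weak_partial i (\<lambda>x. F x - f x) \<in> borel_measurable (lebesgue_on Omega)"
    by (intro L2_measurable weak_partial_L2 H1_diff C1_H1 F f)
  show "(\<lambda>x. partial i F x - weak_partial i f x) \<in> borel_measurable (lebesgue_on Omega)"
    by (intro L2_measurable L2_diff pc weak_partial_L2 f)
qed

lemma tendsto_0_le:
  fixes f g :: "nat \<Rightarrow> real"
  assumes "g \<longlonglongrightarrow> 0" "\<And>m. 0 \<le> f m" "\<And>m. f m \<le> g m"
  shows "f \<longlonglongrightarrow> 0"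
  by (rule tendsto_sandwich[OF _ _ tendsto_const assms(1)]) (simp_all add: assms(2,3))

text \<open>\<open>H1_norm\<close> of a difference involves weak derivatives chosen for that
  difference. Uniqueness replaces them by the classical derivative of \<open>F m\<close> minus the
  chosen derivative of \<open>f\<close>, the form in which limits are computed.\<close>

lemma H1_norm_tendsto_0_iff:
  fixes f :: "real^'d \<Rightarrow> real"
  assumes F: "\<And>m. C_k (Suc 0) (F m)" and f: "f \<in> H1"
  shows "(\<lambda>m. H1_norm (\<lambda>x. F m x - f x)) \<longlonglongrightarrow> 0 \<longleftrightarrow>
    (\<lambda>m. L2_norm (lebesgue_on Omega) (\<lambda>x. F m x - f x)) \<longlonglongrightarrow> 0 \<and>
    (\<forall>i. (\<lambda>m. L2_norm (lebesgue_on Omega) (\<lambda>x. partial i (F m) x - weak_partial i f x)) \<longlonglongrightarrow> 0)"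
    (is "?L \<longleftrightarrow> ?R \<and> (\<forall>i. ?S i)")
proof (intro iffI conjI allI)
  have d: "(\<lambda>x. F m x - f x) \<in> H1" for m by (intro H1_diff C1_H1 F f)
  note w = L2_norm_weak_partial_diff[OF F f, symmetric]
  show ?R if ?L
    by (rule tendsto_0_le[OF that]) (rule L2_norm_nonneg L2_norm_le_H1_norm)+
  show "?S i" if ?L for i
    unfolding w
    by (rule tendsto_0_le[OF that L2_norm_nonneg])
       (rule order.trans[OF L2_norm_weak_partial_le[OF d] L2_norm_grad_le_H1_norm])
  show ?L if RS: "?R \<and> (\<forall>i. ?S i)"
  proof (rule tendsto_0_le[OF _ H1_norm_nonneg H1_norm_le[OF d]])
    have "(\<lambda>m. L2_norm (lebesgue_on Omega) (\<lambda>x. F m x - f x) +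
        (\<Sum>i\<in>UNIV. L2_norm (lebesgue_on Omega) (weak_partial i (\<lambda>x. F m x - f x)))) \<longlonglongrightarrow> 0 + (\<Sum>i\<in>(UNIV :: 'd set). 0)"
      using RS unfolding w by (intro tendsto_add tendsto_sum) auto
    then show "(\<lambda>m. L2_norm (lebesgue_on Omega) (\<lambda>x. F m x - f x) +
        (\<Sum>i\<in>UNIV. L2_norm (lebesgue_on Omega) (weak_partial i (\<lambda>x. F m x - f x)))) \<longlonglongrightarrow> 0" by simp
  qed
qed

text \<open>On the cube the derivative is \<open>(1 - \<delta>)\<close> times the mollification of
  \<open>g\<close>; subtracting \<open>g\<close> splits into the mollification error of
  \<open>g\<close>, damped by \<open>1 - \<delta>\<close>, and \<open>\<delta> g\<close>.\<close>

lemma L2_norm_partial_mollify_le: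
  fixes f :: "real^'d \<Rightarrow> real"
  assumes f: "f \<in> L2 (lebesgue_on Omega)" and g: "g \<in> L2 (lebesgue_on Omega)"
    and w: "has_weak_partial i f g" and d: "0 < \<delta>" "\<delta> < 1"
  shows "L2_norm (lebesgue_on Omega) (\<lambda>x. partial i (mollify \<delta> f) x - g x) \<le>
    L2_norm (lebesgue_on Omega) (\<lambda>x. mollify \<delta> g x - g x) + \<delta> * L2_norm (lebesgue_on Omega) g"
proof -
  let ?M = "lebesgue_on (Omega :: (real^'d) set)"
  have mL: "mollify \<delta> g \<in> L2 ?M" by (intro continuous_L2 mollify_cont g)
  have pL: "partial i (mollify \<delta> f) \<in> L2 ?M"
    using mollify_has_derivative(2)[OF f, of \<delta>] by (intro continuous_L2) simp
  note L = L2_cmult[OF L2_diff[OF mL g], of "1 - \<delta>"] L2_cmult[OF g, of \<delta>]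
  have "L2_norm ?M (\<lambda>x. partial i (mollify \<delta> f) x - g x) =
      L2_norm ?M (\<lambda>x. (1 - \<delta>) * (mollify \<delta> g x - g x) - \<delta> * g x)"
  proof (rule L2_norm_cong_AE)
    show "AE x in ?M. partial i (mollify \<delta> f) x - g x = (1 - \<delta>) * (mollify \<delta> g x - g x) - \<delta> * g x"
      by (rule AE_OmegaI) (simp add: partial_mollify[OF f w d] algebra_simps)
  qed (rule L2_measurable[OF L2_diff[OF pL g]], rule L2_measurable[OF L2_diff[OF L]])
  also have "\<dots> \<le> L2_norm ?M (\<lambda>x. (1 - \<delta>) * (mollify \<delta> g x - g x)) + L2_norm ?M (\<lambda>x. \<delta> * g x)"
    by (rule L2_norm_triangle_diff[OF L])
  also have "\<dots> \<le> L2_norm ?M (\<lambda>x. mollify \<delta> g x - g x) + \<delta> * L2_norm ?M g"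
    unfolding L2_norm_cmult using d by (intro add_mono mult_left_le_one_le) auto
  finally show ?thesis .
qed

lemma C1_dense_H1:
  fixes f :: "real^'d \<Rightarrow> real"
  assumes f: "f \<in> H1"
  shows "\<exists>F. (\<forall>m. C_k (Suc 0) (F m)) \<and> (\<lambda>m. H1_norm (\<lambda>x. F m x - f x)) \<longlonglongrightarrow> 0"
proof -
  let ?M = "lebesgue_on (Omega :: (real^'d) set)"
  define d :: "nat \<Rightarrow> real" where "d m = 1 / real (m + 2)" for m
  have d: "0 < d m" "d m \<le> 1 / 2" "d \<longlonglongrightarrow> 0" for m
    unfolding d_def by (rule mollification_radius)+
  have d1: "d m < 1" for m using d(2)[of m] by simp
  define F where "F m = mollify (d m) f" for m
  note fL = H1_L2[OF f]
  have F: "C_k (Suc 0) (F m)" for m unfolding F_def by (rule mollify_has_derivative(2)[OF fL])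
  have "(\<lambda>m. L2_norm ?M (\<lambda>x. partial i (F m) x - weak_partial i f x)) \<longlonglongrightarrow> 0" for i
  proof (rule tendsto_0_le[OF _ L2_norm_nonneg])
    let ?g = "weak_partial i f"
    note gL = weak_partial_L2[OF f, of i]
    have "(\<lambda>m. L2_norm ?M (\<lambda>x. mollify (d m) ?g x - ?g x) + d m * L2_norm ?M ?g) \<longlonglongrightarrow> 0 + 0 * L2_norm ?M ?g"
      by (intro tendsto_intros mollify_tendsto[OF gL d] d(3))
    then show "(\<lambda>m. L2_norm ?M (\<lambda>x. mollify (d m) ?g x - ?g x) + d m * L2_norm ?M ?g) \<longlonglongrightarrow> 0" by simp
    show "L2_norm ?M (\<lambda>x. partial i (F m) x - ?g x) \<le>
        L2_norm ?M (\<lambda>x. mollify (d m) ?g x - ?g x) + d m * L2_norm ?M ?g" for m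
      using L2_norm_partial_mollify_le[OF fL gL has_weak_partial_weak_partial[OF f] d(1) d1] by (simp add: F_def)
  qed
  moreover have "(\<lambda>m. L2_norm ?M (\<lambda>x. F m x - f x)) \<longlonglongrightarrow> 0"
    unfolding F_def by (rule mollify_tendsto[OF fL d])
  ultimately show ?thesis
    using F H1_norm_tendsto_0_iff[of F, OF F f] by blast
qed

text \<open>The fundamental theorem for \<open>(2 x $ i - 1) F\<^sup>2\<close>. The weight is
  \<open>-1\<close> on one face and \<open>1\<close> on the opposite one, so both face integrals
  appear with a plus sign. The identity is read in one direction for the trace inequality and in the
  other for Friedrichs.\<close>

lemma integral_faces:
  assumes F: "C_k (Suc 0) F"
  shows "(LINT x|lebesgue_on Omega. (F (face_proj i 0 x))\<^sup>2) + (LINT x|lebesgue_on Omega. (F (face_proj i 1 x))\<^sup>2) =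
    (LINT x|lebesgue_on Omega. 2 * (F x)\<^sup>2 + 2 * (2 * x $ i - 1) * F x * partial i F x)"
proof -
  let ?M = "lebesgue_on (Omega :: (real^'a) set)"
  let ?H = "\<lambda>x. (2 * x $ i + (- 1)) * (F x * F x)"
  note c = C1_continuous[OF F]
  have d: "F differentiable at x" for x using F by auto
  have H: "C_k (Suc 0) ?H" by (intro C1_mult C1_coord F)
  have p: "partial i ?H x = 2 * (F x)\<^sup>2 + 2 * (2 * x $ i - 1) * F x * partial i F x" for x
  proof -
    have "partial i ?H x = 2 * (F x * F x) + (2 * x $ i + (- 1)) * (partial i F x * F x + F x * partial i F x)"
      using C1_coord[of 2 i "- 1"] d
      by (subst partial_mult) (auto simp: partial_mult partial_coord[of i 2 i "- 1", simplified])
    then show ?thesis by (simp add: power2_eq_square algebra_simps)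
  qed
  have i: "integrable ?M (\<lambda>x. (F (face_proj i c x))\<^sup>2)" for c
    by (intro continuous_integrable continuous_intros continuous_on_compose2[OF c]) auto
  have "(LINT x|?M. (F (face_proj i 0 x))\<^sup>2) + (LINT x|?M. (F (face_proj i 1 x))\<^sup>2)
     = (LINT x|?M. (F (face_proj i 0 x))\<^sup>2 + (F (face_proj i 1 x))\<^sup>2)"
    using i by simp
  also have "\<dots> = (LINT x|?M. ?H (face_proj i 1 x) - ?H (face_proj i 0 x))"
    by (intro arg_cong[where f = "integral\<^sup>L ?M"] ext) (simp add: power2_eq_square)
  also have "\<dots> = (LINT x|?M. partial i ?H x)"
    by (rule integral_partial[OF H, symmetric])
  finally show ?thesis by (simp only: p)
qed

lemma L2_norm_boundary_square:
  fixes F :: "real^'d \<Rightarrow> real"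
  assumes F: "continuous_on UNIV F"
  shows "(L2_norm boundary_measure F)\<^sup>2 =
    (\<Sum>i\<in>UNIV. (LINT x|lebesgue_on Omega. (F (face_proj i 0 x))\<^sup>2) + (LINT x|lebesgue_on Omega. (F (face_proj i 1 x))\<^sup>2))"
proof -
  have [measurable]: "F \<in> borel_measurable borel" by (rule borel_measurable_continuous_onI[OF F])
  have "(LINT x|boundary_measure. (norm (F x))\<^sup>2) =
     (\<Sum>i\<in>UNIV. \<Sum>c\<in>{0, 1}. LINT x|lebesgue_on Omega. (norm (F (face_proj i c x)))\<^sup>2)"
    by (rule integral_boundary(2))
       (measurable, intro continuous_integrable continuous_intros continuous_on_compose2[OF F], auto)
  then show ?thesis by (simp add: L2_norm_square)
qed

lemma square_weight_bound:
  fixes a b t :: real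
  assumes "0 \<le> t" "t \<le> 1"
  shows "\<bar>2 * (2 * t - 1) * a * b\<bar> \<le> a\<^sup>2 + b\<^sup>2"
proof -
  have "\<bar>2 * (2 * t - 1) * a * b\<bar> = \<bar>2 * t - 1\<bar> * \<bar>2 * a * b\<bar>"
    unfolding abs_mult[symmetric] by (simp add: algebra_simps)
  also have "\<dots> \<le> \<bar>2 * a * b\<bar>"
    using assms by (intro mult_left_le_one_le) auto
  also have "\<dots> = 2 * \<bar>a\<bar> * \<bar>b\<bar>" by (simp add: abs_mult)
  also have "\<dots> \<le> a\<^sup>2 + b\<^sup>2"
    using sum_squares_bound[of "\<bar>a\<bar>" "\<bar>b\<bar>"] by simp
  finally show ?thesis .
qed

text \<open>The weight is at most 1 in absolute value, so the cross term in
  \<open>integral_faces\<close> costs one more \<open>F\<^sup>2\<close> and one squared derivative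
  per direction.\<close>

lemma trace_inequality_C1:
  fixes F :: "real^'d \<Rightarrow> real"
  assumes F: "C_k (Suc 0) F"
  shows "(L2_norm boundary_measure F)\<^sup>2 \<le>
    3 * real CARD('d) * (L2_norm (lebesgue_on Omega) F)\<^sup>2 + (\<Sum>i\<in>UNIV. (L2_norm (lebesgue_on Omega) (partial i F))\<^sup>2)"
proof -
  let ?M = "lebesgue_on (Omega :: (real^'d) set)"
  note c = C1_continuous[OF F]
  have pc: "continuous_on UNIV (partial i F)" for i using F by auto
  have "(LINT x|?M. (F (face_proj i 0 x))\<^sup>2) + (LINT x|?M. (F (face_proj i 1 x))\<^sup>2) \<le>
     3 * (L2_norm ?M F)\<^sup>2 + (L2_norm ?M (partial i F))\<^sup>2" for i
  proof -
    have "(LINT x|?M. (F (face_proj i 0 x))\<^sup>2) + (LINT x|?M. (F (face_proj i 1 x))\<^sup>2) =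
        (LINT x|?M. 2 * (F x)\<^sup>2 + 2 * (2 * x $ i - 1) * F x * partial i F x)"
      by (rule integral_faces[OF F])
    also have "\<dots> \<le> (LINT x|?M. 3 * (F x)\<^sup>2 + (partial i F x)\<^sup>2)"
    proof (rule integral_mono)
      fix x assume "x \<in> space ?M"
      then have "0 \<le> x $ i" "x $ i \<le> 1" by (auto simp: mem_Omega)
      from square_weight_bound[OF this, of "F x" "partial i F x"]
      show "2 * (F x)\<^sup>2 + 2 * (2 * x $ i - 1) * F x * partial i F x \<le> 3 * (F x)\<^sup>2 + (partial i F x)\<^sup>2" by simp
    qed (auto intro!: continuous_integrable continuous_intros c pc)
    also have "\<dots> = 3 * (L2_norm ?M F)\<^sup>2 + (L2_norm ?M (partial i F))\<^sup>2"
      using L2_integrable_square[OF continuous_L2[OF c]] L2_integrable_square[OF continuous_L2[OF pc[of i]]]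
      by (simp add: L2_norm_square)
    finally show ?thesis .
  qed
  then have "(L2_norm boundary_measure F)\<^sup>2 \<le> (\<Sum>i\<in>UNIV. 3 * (L2_norm ?M F)\<^sup>2 + (L2_norm ?M (partial i F))\<^sup>2)"
    unfolding L2_norm_boundary_square[OF c] by (rule sum_mono)
  then show ?thesis by (simp add: sum.distrib)
qed

text \<open>The cross term in \<open>integral_faces\<close> is at least
  \<open>- F\<^sup>2 - (partial i F)\<^sup>2\<close>, so one of the two copies of
  \<open>F\<^sup>2\<close> survives and is bounded by the faces of a single direction.\<close>

lemma Friedrichs_C1:
  fixes F :: "real^'d \<Rightarrow> real"
  assumes F: "C_k (Suc 0) F"
  shows "(L2_norm (lebesgue_on Omega) F)\<^sup>2 \<le>
    (L2_norm boundary_measure F)\<^sup>2 + (\<Sum>i\<in>UNIV. (L2_norm (lebesgue_on Omega) (partial i F))\<^sup>2)"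
proof -
  let ?M = "lebesgue_on (Omega :: (real^'d) set)"
  note c = C1_continuous[OF F]
  have pc: "continuous_on UNIV (partial i F)" for i using F by auto
  have "(L2_norm ?M F)\<^sup>2 - (L2_norm ?M (partial i F))\<^sup>2 \<le>
     (LINT x|?M. (F (face_proj i 0 x))\<^sup>2) + (LINT x|?M. (F (face_proj i 1 x))\<^sup>2)" for i
  proof -
    have "(L2_norm ?M F)\<^sup>2 - (L2_norm ?M (partial i F))\<^sup>2 = (LINT x|?M. (F x)\<^sup>2 - (partial i F x)\<^sup>2)"
      using L2_integrable_square[OF continuous_L2[OF c]] L2_integrable_square[OF continuous_L2[OF pc[of i]]]
      by (simp add: L2_norm_square)
    also have "\<dots> \<le> (LINT x|?M. 2 * (F x)\<^sup>2 + 2 * (2 * x $ i - 1) * F x * partial i F x)"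
    proof (rule integral_mono)
      fix x assume "x \<in> space ?M"
      then have "0 \<le> x $ i" "x $ i \<le> 1" by (auto simp: mem_Omega)
      from square_weight_bound[OF this, of "F x" "partial i F x"]
      show "(F x)\<^sup>2 - (partial i F x)\<^sup>2 \<le> 2 * (F x)\<^sup>2 + 2 * (2 * x $ i - 1) * F x * partial i F x" by simp
    qed (auto intro!: continuous_integrable continuous_intros c pc)
    finally show ?thesis by (simp only: integral_faces[OF F])
  qed
  \<comment> \<open>\<open>undefined\<close> serves as an arbitrary direction, one pair of opposite
    faces being enough.\<close>
  note this[of undefined]
  moreover have "(LINT x|?M. (F (face_proj undefined 0 x))\<^sup>2) + (LINT x|?M. (F (face_proj undefined 1 x))\<^sup>2) \<le> (L2_norm boundary_measure F)\<^sup>2"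
    unfolding L2_norm_boundary_square[OF c] by (rule member_le_sum) auto
  moreover have "(L2_norm ?M (partial undefined F))\<^sup>2 \<le> (\<Sum>i\<in>UNIV. (L2_norm ?M (partial i F))\<^sup>2)"
    by (rule member_le_sum) auto
  ultimately show ?thesis by linarith
qed

section \<open>Existence of traces\<close>

lemma C1_diff:
  assumes "C_k (Suc 0) F" "C_k (Suc 0) G" 
  shows "C_k (Suc 0) (\<lambda>x. F x - G x)" "partial i (\<lambda>x. F x - G x) x = partial i F x - partial i G x"
proof -
  have d: "F differentiable at x" "G differentiable at x" for x using assms by auto
  have p: "partial i (\<lambda>x. F x - G x) x = partial i F x - partial i G x" for i x
    using has_derivative_diff[OF differentiable_has_partial[OF d(1)] differentiable_has_partial[OF d(2)]]
    by (subst partial_eqI, assumption) (simp add: axis_def if_distrib[of "\<lambda>c. c * _"] cong: if_cong)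
  then show "partial i (\<lambda>x. F x - G x) x = partial i F x - partial i G x" .
  have "partial i (\<lambda>x. F x - G x) = (\<lambda>x. partial i F x - partial i G x)" for i by (rule ext) (rule p)
  then show "C_k (Suc 0) (\<lambda>x. F x - G x)"
    unfolding C1_iff using assms d by (auto intro!: continuous_intros differentiable_diff)
qed

text \<open>A C1 sequence converging in \<open>H1\<close> is Cauchy there, hence by the trace
  inequality Cauchy on the boundary, where completeness provides the limit.\<close>

lemma trace_exists:
  fixes f :: "real^'d \<Rightarrow> real"
  assumes f: "f \<in> H1" shows "\<exists>g. is_trace f g"
proof -
  let ?M = "lebesgue_on (Omega :: (real^'d) set)"
  obtain F where F: "\<And>m. C_k (Suc 0) (F m)" and lim: "(\<lambda>m. H1_norm (\<lambda>x. F m x - f x)) \<longlonglongrightarrow> 0"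
    using C1_dense_H1[OF f] by blast
  note fL = H1_L2[OF f] and wL = weak_partial_L2[OF f]
  have FL: "F m \<in> L2 ?M" for m by (intro continuous_L2 C1_continuous F)
  have pL: "partial i (F m) \<in> L2 ?M" for i m using F[of m] by (intro continuous_L2) auto
  have BL: "F m \<in> L2 boundary_measure" for m by (intro continuous_boundary_L2 C1_continuous F)
  \<comment> \<open>The trace inequality contributes \<open>3 d\<close> from the function and
    \<open>d\<close> from its partial derivatives, all with the same bound.\<close>
  let ?K = "sqrt (4 * real CARD('d))"
  have "\<exists>N. \<forall>m\<ge>N. \<forall>n\<ge>N. L2_norm boundary_measure (\<lambda>x. F m x - F n x) \<le> e" if "e > 0" for e
  proof -
    \<comment> \<open>Two members of the sequence are at most \<open>2 * e'\<close> apart, and the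
      trace inequality multiplies this by \<open>?K\<close>.\<close>
    define e' where "e' = e / (2 * ?K)"
    have "e' > 0" using that by (simp add: e'_def)
    from LIMSEQ_D[OF lim this] obtain N where N: "\<And>m. m \<ge> N \<Longrightarrow> H1_norm (\<lambda>x. F m x - f x) < e'"
      by auto
    have "L2_norm boundary_measure (\<lambda>x. F m x - F n x) \<le> e" if mn: "m \<ge> N" "n \<ge> N" for m n
    proof -
      have H: "(\<lambda>x. F m x - f x) \<in> H1" for m by (intro H1_diff C1_H1 F f)
      have 1: "L2_norm ?M (\<lambda>x. F m x - F n x) \<le> 2 * e'"
      proof -
        have "L2_norm ?M (\<lambda>x. F m x - F n x) \<le> L2_norm ?M (\<lambda>x. F m x - f x) + L2_norm ?M (\<lambda>x. F n x - f x)"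
          using L2_norm_triangle_diff[OF L2_diff[OF FL[of m] fL] L2_diff[OF FL[of n] fL]] by simp
        then show ?thesis
          using N[OF mn(1)] N[OF mn(2)] L2_norm_le_H1_norm[of "\<lambda>x. F m x - f x"] L2_norm_le_H1_norm[of "\<lambda>x. F n x - f x"] by simp
      qed
      have 2: "L2_norm ?M (partial i (\<lambda>x. F m x - F n x)) \<le> 2 * e'" for i
      proof -
        have "partial i (\<lambda>x. F m x - F n x) = (\<lambda>x. (partial i (F m) x - weak_partial i f x) - (partial i (F n) x - weak_partial i f x))"
          using C1_diff(2)[OF F F] by auto
        then have "L2_norm ?M (partial i (\<lambda>x. F m x - F n x)) \<le> L2_norm ?M (\<lambda>x. partial i (F m) x - weak_partial i f x) + L2_norm ?M (\<lambda>x. partial i (F n) x - weak_partial i f x)"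
          using L2_norm_triangle_diff[OF L2_diff[OF pL[of i m] wL[of i]] L2_diff[OF pL[of i n] wL[of i]]] by simp
        moreover have *: "L2_norm ?M (\<lambda>x. partial i (F m) x - weak_partial i f x) \<le> e'" if "m \<ge> N" for m
          using L2_norm_weak_partial_le[OF H[of m], of i] L2_norm_grad_le_H1_norm[of "\<lambda>x. F m x - f x"] N[OF that]
          by (simp add: L2_norm_weak_partial_diff[OF F f])
        note *[OF mn(1)] *[OF mn(2)]
        ultimately show ?thesis by linarith
      qed
      have "(L2_norm boundary_measure (\<lambda>x. F m x - F n x))\<^sup>2 \<le> 3 * real CARD('d) * (L2_norm ?M (\<lambda>x. F m x - F n x))\<^sup>2
          + (\<Sum>i\<in>UNIV. (L2_norm ?M (partial i (\<lambda>x. F m x - F n x)))\<^sup>2)"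
        by (intro trace_inequality_C1 C1_diff F)
      also have "\<dots> \<le> 3 * real CARD('d) * (2 * e')\<^sup>2 + (\<Sum>i\<in>(UNIV :: 'd set). (2 * e')\<^sup>2)"
        using 1 2 by (intro add_mono mult_left_mono sum_mono power_mono) auto
      also have "\<dots> = (?K * (2 * e'))\<^sup>2" by (simp add: power_mult_distrib)
      also have "?K * (2 * e') = e" by (simp add: e'_def)
      finally show ?thesis using \<open>e > 0\<close> by (auto intro: power2_le_imp_le)
    qed
    then show ?thesis by blast
  qed
  from bd.L2_complete[OF BL this] obtain g where "g \<in> L2 boundary_measure"
      "(\<lambda>m. L2_norm boundary_measure (\<lambda>x. F m x - g x)) \<longlonglongrightarrow> 0" by blast
  with f F lim show ?thesis unfolding is_trace_def One_nat_def by blast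
qed

lemma is_trace_boundary_trace: "f \<in> H1 \<Longrightarrow> is_trace f (boundary_trace f)"
  unfolding boundary_trace_def by (rule someI_ex[OF trace_exists])

lemma boundary_trace_L2: "f \<in> H1 \<Longrightarrow> boundary_trace f \<in> L2 boundary_measure"
  using is_trace_boundary_trace by (auto simp: is_trace_def)

text \<open>The sequence hidden in \<open>is_trace\<close> approximates in the interior and on the
  boundary at once, so a formula for C1 functions that mixes both can be passed to the
  limit.\<close>

lemma H1_approximation:
  fixes f :: "real^'d \<Rightarrow> real"
  assumes f: "f \<in> H1"
  obtains F where "\<And>m :: nat. C_k (Suc 0) (F m)"
    "(\<lambda>m. L2_norm (lebesgue_on Omega) (\<lambda>x. F m x - f x)) \<longlonglongrightarrow> 0"
    "\<And>i. (\<lambda>m. L2_norm (lebesgue_on Omega) (\<lambda>x. partial i (F m) x - weak_partial i f x)) \<longlonglongrightarrow> 0"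
    "(\<lambda>m. L2_norm boundary_measure (\<lambda>x. F m x - boundary_trace f x)) \<longlonglongrightarrow> 0"
proof -
  obtain F where F: "\<And>m :: nat. C_k (Suc 0) (F m)"
    and l: "(\<lambda>m. H1_norm (\<lambda>x. F m x - f x)) \<longlonglongrightarrow> 0"
    and b: "(\<lambda>m. L2_norm boundary_measure (\<lambda>x. F m x - boundary_trace f x)) \<longlonglongrightarrow> 0"
    using is_trace_boundary_trace[OF f] unfolding is_trace_def One_nat_def by blast
  show ?thesis
    by (rule that[OF F _ _ b]) (use l H1_norm_tendsto_0_iff[OF F f] in auto)
qed

section \<open>Poincare, Friedrichs and Green in H1\<close>

lemma L2_norm_square_real: "(L2_norm M f)\<^sup>2 = (LINT x|M. (f x)\<^sup>2)" for f :: "'a \<Rightarrow> real"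
  by (simp add: L2_norm_square)

text \<open>The difference of the two sides is the integral of \<open>(F - c)\<^sup>2\<close> along
  the line, where \<open>c\<close> is the average.\<close>

lemma coord_avg_square_le:
  assumes F: "continuous_on UNIV F"
  shows "(coord_avg i F x)\<^sup>2 \<le> coord_avg i (\<lambda>x. (F x)\<^sup>2) x"
proof -
  define c where "c = coord_avg i F x"
  let ?g = "\<lambda>t. F (face_proj i t x)"
  have i1: "?g integrable_on {0..1}" by (rule line_integrable[OF F])
  have i2: "(\<lambda>t. (?g t)\<^sup>2) integrable_on {0..1}"
    by (rule line_integrable[of "\<lambda>x. (F x)\<^sup>2"]) (intro continuous_intros F)
  have "0 \<le> integral {0..1} (\<lambda>t. (?g t - c)\<^sup>2)"
    by (rule Henstock_Kurzweil_Integration.integral_nonneg)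
       (auto intro!: line_integrable[of "\<lambda>x. (F x - c)\<^sup>2"] continuous_intros F)
  also have "(\<lambda>t. (?g t - c)\<^sup>2) = (\<lambda>t. (?g t)\<^sup>2 - (2 * c) * ?g t + c\<^sup>2)"
    by (auto simp: power2_diff algebra_simps)
  also have "integral {0..1} \<dots> = integral {0..1} (\<lambda>t. (?g t)\<^sup>2) - (2 * c) * integral {0..1} ?g + c\<^sup>2"
  proof -
    have "((\<lambda>t. (?g t)\<^sup>2 - (2 * c) * ?g t + c\<^sup>2) has_integral
        integral {0..1} (\<lambda>t. (?g t)\<^sup>2) - (2 * c) * integral {0..1} ?g + c\<^sup>2 * (1 - 0)) {0..1}"
      using has_integral_const_real[of "c\<^sup>2" 0 1]
      by (intro has_integral_add has_integral_diff has_integral_mult_right integrable_integral i1 i2) simp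
    then show ?thesis by (simp add: integral_unique)
  qed
  also have "\<dots> = coord_avg i (\<lambda>x. (F x)\<^sup>2) x - c\<^sup>2"
    by (simp add: coord_avg_def c_def power2_eq_square)
  finally show ?thesis by (simp add: c_def)
qed

text \<open>Any two values on the line differ by at most the integral of the absolute derivative
  over the whole line; fixing one point at \<open>x $ i\<close> and averaging over the other gives
  the claim.\<close>

lemma coord_avg_deviation:
  assumes F: "C_k (Suc 0) F" and x: "x \<in> Omega"
  shows "\<bar>F x - coord_avg i F x\<bar> \<le> coord_avg i (\<lambda>x. \<bar>partial i F x\<bar>) x"
proof -
  let ?g = "\<lambda>t. F (face_proj i t x)" and ?g' = "\<lambda>t. partial i F (face_proj i t x)"
  note c = C1_continuous[OF F]
  have pc: "continuous_on UNIV (partial i F)" using F by auto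
  have pac: "continuous_on UNIV (\<lambda>x. \<bar>partial i F x\<bar>)" by (intro continuous_intros pc)
  let ?I = "integral {0..1} (\<lambda>t. \<bar>?g' t\<bar>)"
  have le: "\<bar>?g t - ?g s\<bar> \<le> ?I" if "0 \<le> s" "s \<le> t" "t \<le> 1" for s t
  proof -
    have "(?g' has_integral (?g t - ?g s)) {s..t}"
      using F that
      by (intro fundamental_theorem_of_calculus)
         (auto simp: has_real_derivative_iff_has_vector_derivative[symmetric]
           intro!: has_field_derivative_at_within partial_line)
    then have "\<bar>?g t - ?g s\<bar> = \<bar>integral {s..t} ?g'\<bar>" by (simp add: integral_unique)
    also have "\<dots> \<le> integral {s..t} (\<lambda>t. \<bar>?g' t\<bar>)"
      using integral_norm_bound_integral[OF line_integrable[OF pc] line_integrable[OF pac], of s t i x i x] by simp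
    also have "\<dots> \<le> ?I"
      using that by (intro integral_subset_le line_integrable[OF pac]) auto
    finally show ?thesis .
  qed
  have le': "\<bar>?g s - ?g t\<bar> \<le> ?I" if "s \<in> {0..1}" "t \<in> {0..1}" for s t
    using le[of s t] le[of t s] that by (cases "s \<le> t") (auto simp: abs_minus_commute)
  have xi: "x $ i \<in> {0..1}" using x by (simp add: mem_Omega)
  have "F x - coord_avg i F x = integral {0..1} (\<lambda>t. ?g (x $ i) - ?g t)"
    unfolding coord_avg_def
    by (subst Henstock_Kurzweil_Integration.integral_diff) (auto intro: line_integrable[OF c])
  also have "norm \<dots> \<le> integral {0..1} (\<lambda>t :: real. ?I)"
  proof (rule integral_norm_bound_integral)
    show "(\<lambda>t. ?g (x $ i) - ?g t) integrable_on {0..1}"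
      by (intro integrable_diff line_integrable[OF c] integrable_const_ivl)
  qed (use le'[OF xi] in auto)
  finally show ?thesis by (simp add: coord_avg_def)
qed

lemma L2_norm_coord_avg_le:
  assumes F: "continuous_on UNIV F"
  shows "L2_norm (lebesgue_on Omega) (coord_avg i F) \<le> L2_norm (lebesgue_on Omega) F"
proof (rule power2_le_imp_le)
  have F2: "continuous_on UNIV (\<lambda>x. (F x)\<^sup>2)" by (intro continuous_intros F)
  have "(LINT x|lebesgue_on Omega. (coord_avg i F x)\<^sup>2) \<le> (LINT x|lebesgue_on Omega. coord_avg i (\<lambda>x. (F x)\<^sup>2) x)"
  proof (rule integral_mono)
    show "integrable (lebesgue_on Omega) (\<lambda>x. (coord_avg i F x)\<^sup>2)"
      by (intro continuous_integrable continuous_on_power continuous_on_coord_avg F)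
    show "integrable (lebesgue_on Omega) (coord_avg i (\<lambda>x. (F x)\<^sup>2))"
      by (intro continuous_integrable continuous_on_coord_avg F2)
  qed (rule coord_avg_square_le[OF F])
  also have "\<dots> = (LINT x|lebesgue_on Omega. (F x)\<^sup>2)"
    by (rule integral_coord_avg[OF F2])
  finally show "(L2_norm (lebesgue_on Omega) (coord_avg i F))\<^sup>2 \<le> (L2_norm (lebesgue_on Omega) F)\<^sup>2"
    by (simp add: L2_norm_square_real)
qed simp

lemma L2_norm_coord_avg_deviation:
  assumes F: "C_k (Suc 0) F"
  shows "L2_norm (lebesgue_on Omega) (\<lambda>x. F x - coord_avg i F x) \<le> L2_norm (lebesgue_on Omega) (partial i F)"
proof -
  note c = C1_continuous[OF F]
  have pc: "continuous_on UNIV (\<lambda>x. \<bar>partial i F x\<bar>)" using F by (auto intro: continuous_intros)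
  have "L2_norm (lebesgue_on Omega) (\<lambda>x. F x - coord_avg i F x) \<le> L2_norm (lebesgue_on Omega) (coord_avg i (\<lambda>x. \<bar>partial i F x\<bar>))"
  proof (rule L2_norm_mono)
    show "coord_avg i (\<lambda>x. \<bar>partial i F x\<bar>) \<in> L2 (lebesgue_on Omega)"
      by (intro continuous_L2 continuous_on_coord_avg pc)
    show "AE x in lebesgue_on Omega. norm (F x - coord_avg i F x) \<le> norm (coord_avg i (\<lambda>x. \<bar>partial i F x\<bar>) x)"
      unfolding real_norm_def
      by (rule AE_OmegaI) (rule order.trans[OF coord_avg_deviation[OF F] abs_ge_self])
    show "(\<lambda>x. F x - coord_avg i F x) \<in> borel_measurable (lebesgue_on Omega)"
      by (intro continuous_on_UNIV_measurable continuous_on_diff c continuous_on_coord_avg)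
  qed
  also have "\<dots> \<le> L2_norm (lebesgue_on Omega) (\<lambda>x. \<bar>partial i F x\<bar>)"
    by (rule L2_norm_coord_avg_le[OF pc])
  also have "\<dots> = L2_norm (lebesgue_on Omega) (partial i F)"
    by (simp add: L2_norm_def)
  finally show ?thesis .
qed

lemma coord_avg_diff:
  assumes "continuous_on UNIV F" "continuous_on UNIV G"
  shows "coord_avg i (\<lambda>x. F x - G x) x = coord_avg i F x - coord_avg i G x"
  unfolding coord_avg_def
  by (rule Henstock_Kurzweil_Integration.integral_diff) (auto intro: line_integrable assms)

lemma continuous_foldr_avg:
  "continuous_on UNIV F \<Longrightarrow> continuous_on UNIV (foldr coord_avg l F)"
  by (induction l) auto

lemma integral_foldr_avg:
  "continuous_on UNIV F \<Longrightarrow> (LINT x|lebesgue_on Omega. foldr coord_avg l F x) = (LINT x|lebesgue_on Omega. F x)"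
  by (induction l) (simp_all add: integral_coord_avg continuous_foldr_avg)

text \<open>The outermost average either runs in direction \<open>j\<close> and forgets
  \<open>x $ j\<close>, or runs in another direction and commutes with replacing
  \<open>x $ j\<close>.\<close>

lemma foldr_avg_independent:
  "j \<in> set l \<Longrightarrow> foldr coord_avg l F (face_proj j c x) = foldr coord_avg l F x"
proof (induction l arbitrary: x)
  case (Cons i l)
  show ?case
  proof (cases "i = j")
    case True
    then show ?thesis by (simp add: coord_avg_def)
  next
    case False
    have "face_proj i t (face_proj j c x) = face_proj j c (face_proj i t x)" for t
      using False by (simp add: vec_eq_iff)
    with Cons False show ?thesis by (simp add: coord_avg_def)
  qed
qed simp

text \<open>With \<open>G\<close> the inner average and \<open>A\<close> the outer one,
  \<open>F - A G = (F - A F) + A (F - G)\<close>, and \<open>A\<close> does not increase the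
  \<open>L2\<close> norm; each direction therefore adds one derivative norm.\<close>

lemma L2_norm_foldr_avg_deviation:
  assumes F: "C_k (Suc 0) F"
  shows "L2_norm (lebesgue_on Omega) (\<lambda>x. F x - foldr coord_avg l F x) \<le>
    (\<Sum>i\<leftarrow>l. L2_norm (lebesgue_on Omega) (partial i F))"
proof (induction l)
  case (Cons i l)
  let ?M = "lebesgue_on Omega" and ?G = "foldr coord_avg l F"
  note c = C1_continuous[OF F] and Gc = continuous_foldr_avg[OF C1_continuous[OF F], of l]
  have FG: "continuous_on UNIV (\<lambda>x. F x - ?G x)" by (intro continuous_intros c Gc)
  have "L2_norm ?M (\<lambda>x. F x - coord_avg i ?G x) =
      L2_norm ?M (\<lambda>x. (F x - coord_avg i F x) + coord_avg i (\<lambda>x. F x - ?G x) x)"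
    by (simp add: coord_avg_diff[OF c Gc])
  also have "\<dots> \<le> L2_norm ?M (\<lambda>x. F x - coord_avg i F x) + L2_norm ?M (coord_avg i (\<lambda>x. F x - ?G x))"
    by (intro L2_norm_triangle continuous_L2 continuous_on_diff continuous_on_coord_avg c Gc)
  also have "\<dots> \<le> L2_norm ?M (partial i F) + L2_norm ?M (\<lambda>x. F x - ?G x)"
    by (intro add_mono L2_norm_coord_avg_deviation F L2_norm_coord_avg_le FG)
  finally show ?case using Cons.IH by simp
qed (simp add: L2_norm_def)

text \<open>The coordinates of \<open>x\<close> are exchanged for those of \<open>y\<close> one at a
  time; \<open>S\<close> holds those that may still differ.\<close>

lemma face_proj_invariant_constant:
  fixes G :: "real^'d \<Rightarrow> real"
  assumes inv: "\<And>j c x. G (face_proj j c x) = G x"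
  shows "G x = G y"
proof -
  have "G x = G y" if "finite S" "\<And>j. j \<notin> S \<Longrightarrow> x $ j = y $ j" for S x y
    using that
  proof (induction S arbitrary: x)
    case empty
    then have "x = y" by (simp add: vec_eq_iff)
    then show ?case by simp
  next
    case (insert j S)
    have "G (face_proj j (y $ j) x) = G y"
      by (rule insert.IH) (use insert.prems in auto)
    then show ?case by (simp add: inv)
  qed
  from this[of UNIV] show ?thesis by simp
qed

text \<open>Averaging over every coordinate in turn leaves a constant. It has the same integral as
  \<open>F\<close>, and the cube has volume 1, so the constant is the mean of
  \<open>F\<close>.\<close>

lemma Poincare_C1:
  fixes F :: "real^'d \<Rightarrow> real"
  assumes F: "C_k (Suc 0) F"
  shows "L2_norm (lebesgue_on Omega) F \<le>
    (\<Sum>i\<in>UNIV. L2_norm (lebesgue_on Omega) (partial i F)) + \<bar>LINT x|lebesgue_on Omega. F x\<bar>"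
proof -
  let ?M = "lebesgue_on (Omega :: (real^'d) set)"
  note c = C1_continuous[OF F]
  obtain l :: "'d list" where l: "set l = UNIV" "distinct l"
    using finite_distinct_list[of "UNIV :: 'd set"] by auto
  let ?G = "foldr coord_avg l F"
  have const: "?G x = ?G 0" for x
    by (rule face_proj_invariant_constant) (simp add: foldr_avg_independent l)
  have "(LINT x|?M. F x) = (LINT x|?M. ?G x)"
    by (rule integral_foldr_avg[OF c, symmetric])
  also have "\<dots> = (LINT x|?M. ?G 0)"
    by (intro arg_cong[where f = "integral\<^sup>L ?M"] ext) (rule const)
  also have "\<dots> = ?G 0" by simp
  finally have G: "?G = (\<lambda>x. LINT x|?M. F x)" using const by auto
  have "L2_norm ?M F \<le> L2_norm ?M (\<lambda>x. F x - ?G x) + L2_norm ?M ?G"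
    by (intro L2_norm_triangle_sub continuous_L2 c continuous_foldr_avg)
  also have "L2_norm ?M ?G = \<bar>LINT x|?M. F x\<bar>"
    unfolding G by (simp add: L2_norm_def)
  also have "L2_norm ?M (\<lambda>x. F x - ?G x) \<le> (\<Sum>i\<leftarrow>l. L2_norm ?M (partial i F))"
    by (rule L2_norm_foldr_avg_deviation[OF F])
  also have "\<dots> = (\<Sum>i\<in>UNIV. L2_norm ?M (partial i F))"
    using l by (simp add: sum_list_distinct_conv_sum_set)
  finally show ?thesis by simp
qed

lemma L2_norm_weak_partial_sum_le:
  fixes f :: "real^'d \<Rightarrow> real"
  assumes "f \<in> H1"
  shows "(\<Sum>i\<in>UNIV. L2_norm (lebesgue_on Omega) (weak_partial i f)) \<le> real CARD('d) * L2_norm (lebesgue_on Omega) (grad f)"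
  using sum_bounded_above[of UNIV "\<lambda>i. L2_norm (lebesgue_on Omega) (weak_partial i f)", OF L2_norm_weak_partial_le[OF assms]]
  by simp

lemma integral_L2_inner: "(LINT x|M. f x) = L2_inner M f (\<lambda>_. 1)" for f :: "'a \<Rightarrow> real"
  by (simp add: L2_inner_def)

lemma normal_mult_L2:
  assumes h: "h \<in> L2 boundary_measure"
  shows "(\<lambda>x. outer_normal x $ i * h x) \<in> L2 boundary_measure"
    and "L2_norm boundary_measure (\<lambda>x. outer_normal x $ i * h x) \<le> L2_norm boundary_measure h"
proof -
  have [measurable]: "h \<in> borel_measurable borel" using L2_measurable[OF h] by simp
  have m: "(\<lambda>x. outer_normal x $ i * h x) \<in> borel_measurable boundary_measure" by measurable
  have le: "AE x in boundary_measure. norm (outer_normal x $ i * h x) \<le> norm (h x)"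
    using norm_outer_normal_component[of _ i] by (intro AE_I2) (simp add: abs_mult mult_left_le_one_le)
  show "(\<lambda>x. outer_normal x $ i * h x) \<in> L2 boundary_measure" by (rule L2_bound[OF h m le])
  show "L2_norm boundary_measure (\<lambda>x. outer_normal x $ i * h x) \<le> L2_norm boundary_measure h"
    by (rule L2_norm_mono[OF h le m])
qed

text \<open>All four statements are limits along one sequence from \<open>H1_approximation\<close>.
  In Green's formula the second factor is still C1 here.\<close>

lemma
  fixes f :: "real^'d \<Rightarrow> real"
  assumes f: "f \<in> H1"
  shows Poincare_H1: "L2_norm (lebesgue_on Omega) f \<le>
      real CARD('d) * L2_norm (lebesgue_on Omega) (grad f) + \<bar>LINT x|lebesgue_on Omega. f x\<bar>"
    and Friedrichs_H1: "(L2_norm (lebesgue_on Omega) f)\<^sup>2 \<le>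
      (L2_norm boundary_measure (boundary_trace f))\<^sup>2 + (L2_norm (lebesgue_on Omega) (grad f))\<^sup>2"
    and trace_inequality: "L2_norm boundary_measure (boundary_trace f) \<le> 2 * real CARD('d) * H1_norm f"
    and Green_C1_H1: "C_k (Suc 0) G \<Longrightarrow>
      L2_inner (lebesgue_on Omega) (weak_partial i f) G + L2_inner (lebesgue_on Omega) f (partial i G) =
      L2_inner boundary_measure (\<lambda>x. outer_normal x $ i * boundary_trace f x) G"
proof -
  let ?M = "lebesgue_on (Omega :: (real^'d) set)"
  obtain F where F: "\<And>m :: nat. C_k (Suc 0) (F m)"
    and l0: "(\<lambda>m. L2_norm ?M (\<lambda>x. F m x - f x)) \<longlonglongrightarrow> 0"
    and l1: "\<And>i. (\<lambda>m. L2_norm ?M (\<lambda>x. partial i (F m) x - weak_partial i f x)) \<longlonglongrightarrow> 0"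
    and lb: "(\<lambda>m. L2_norm boundary_measure (\<lambda>x. F m x - boundary_trace f x)) \<longlonglongrightarrow> 0"
    using H1_approximation[OF f] by blast
  note fL = H1_L2[OF f] and wL = weak_partial_L2[OF f] and bL = boundary_trace_L2[OF f]
  have FL: "F m \<in> L2 ?M" for m by (intro continuous_L2 C1_continuous F)
  have pL: "partial i (F m) \<in> L2 ?M" for i m using F[of m] by (intro continuous_L2) auto
  have BL: "F m \<in> L2 boundary_measure" for m by (intro continuous_boundary_L2 C1_continuous F)
  note t0 = L2_norm_tendsto[OF FL fL l0] and t1 = L2_norm_tendsto[OF pL wL l1] and tb = L2_norm_tendsto[OF BL bL lb]
  have tm: "(\<lambda>m. LINT x|?M. F m x) \<longlonglongrightarrow> (LINT x|?M. f x)"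
    unfolding integral_L2_inner by (rule L2_inner_tendsto[OF FL fL l0]) (auto simp: L2_norm_def)

  have "L2_norm ?M f \<le> (\<Sum>i\<in>UNIV. L2_norm ?M (weak_partial i f)) + \<bar>LINT x|?M. f x\<bar>"
    by (rule LIMSEQ_le[OF t0 tendsto_add[OF tendsto_sum[OF t1] tendsto_rabs[OF tm]]])
       (use Poincare_C1[OF F] in auto)
  then show "L2_norm ?M f \<le> real CARD('d) * L2_norm ?M (grad f) + \<bar>LINT x|?M. f x\<bar>"
    using L2_norm_weak_partial_sum_le[OF f] by simp

  show "(L2_norm ?M f)\<^sup>2 \<le> (L2_norm boundary_measure (boundary_trace f))\<^sup>2 + (L2_norm ?M (grad f))\<^sup>2"
    unfolding grad_L2(2)[OF f]
    by (rule LIMSEQ_le[OF tendsto_power[OF t0] tendsto_add[OF tendsto_power[OF tb] tendsto_sum[OF tendsto_power[OF t1]]]])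
       (use Friedrichs_C1[OF F] in auto)

  have "(L2_norm boundary_measure (boundary_trace f))\<^sup>2 \<le>
     3 * real CARD('d) * (L2_norm ?M f)\<^sup>2 + (L2_norm ?M (grad f))\<^sup>2"
    unfolding grad_L2(2)[OF f]
    by (rule LIMSEQ_le[OF tendsto_power[OF tb] tendsto_add[OF tendsto_mult[OF tendsto_const tendsto_power[OF t0]] tendsto_sum[OF tendsto_power[OF t1]]]])
       (use trace_inequality_C1[OF F] in auto)
  \<comment> \<open>Both \<open>3 d\<close> and \<open>1\<close> are at most
    \<open>(2 d)\<^sup>2\<close> because \<open>d \<ge> 1\<close>, which gives the constant
    \<open>2 d\<close> after taking roots.\<close>
  also have "\<dots> \<le> 4 * (real CARD('d))\<^sup>2 * (L2_norm ?M f)\<^sup>2 + 4 * (real CARD('d))\<^sup>2 * (L2_norm ?M (grad f))\<^sup>2"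
  proof -
    have d: "1 \<le> real CARD('d)" by (simp add: Suc_le_eq)
    then have "real CARD('d) \<le> (real CARD('d))\<^sup>2" by (simp add: self_le_power)
    with d have "3 * real CARD('d) \<le> 4 * (real CARD('d))\<^sup>2" "1 \<le> 4 * (real CARD('d))\<^sup>2" by linarith+
    from mult_right_mono[OF this(1), of "(L2_norm ?M f)\<^sup>2"] mult_right_mono[OF this(2), of "(L2_norm ?M (grad f))\<^sup>2"]
    show ?thesis by simp
  qed
  also have "\<dots> = (2 * real CARD('d) * H1_norm f)\<^sup>2"
    by (simp add: H1_norm_def power_mult_distrib algebra_simps)
  finally show "L2_norm boundary_measure (boundary_trace f) \<le> 2 * real CARD('d) * H1_norm f"
    by (rule power2_le_imp_le) simp

  assume G: "C_k (Suc 0) G"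
  have GL: "G \<in> L2 ?M" by (intro continuous_L2 C1_continuous G)
  have pGL: "partial i G \<in> L2 ?M" using G by (intro continuous_L2) auto
  have GbL: "G \<in> L2 boundary_measure" by (intro continuous_boundary_L2 C1_continuous G)
  note nL = normal_mult_L2[where i = i]
  have eq: "L2_inner ?M (partial i (F m)) G + L2_inner ?M (F m) (partial i G) =
      L2_inner boundary_measure (\<lambda>x. outer_normal x $ i * F m x) G" for m
  proof -
    have d: "F m differentiable at x" "G differentiable at x" for x using F[of m] G by auto
    have "L2_inner ?M (partial i (F m)) G + L2_inner ?M (F m) (partial i G) =
        (LINT x|?M. partial i (F m) x * G x + F m x * partial i G x)"
      using L2_inner_integrable[OF pL GL, of i m] L2_inner_integrable[OF FL pGL, of m] by (simp add: L2_inner_def)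
    also have "\<dots> = (LINT x|?M. partial i (\<lambda>x. F m x * G x) x)"
      by (simp add: partial_mult d)
    also have "\<dots> = (LINT x|boundary_measure. outer_normal x $ i * (F m x * G x))"
      by (rule Green_C1[OF C1_mult[OF F G]])
    finally show ?thesis by (simp add: L2_inner_def mult.assoc)
  qed
  have c0: "(\<lambda>m :: nat. L2_norm N (\<lambda>x. (h :: _ \<Rightarrow> real) x - h x)) \<longlonglongrightarrow> 0" for N h by (simp add: L2_norm_def)
  have A: "(\<lambda>m. L2_inner ?M (partial i (F m)) G + L2_inner ?M (F m) (partial i G)) \<longlonglongrightarrow>
      L2_inner ?M (weak_partial i f) G + L2_inner ?M f (partial i G)"
    by (intro tendsto_add L2_inner_tendsto[OF pL wL l1 GL GL c0] L2_inner_tendsto[OF FL fL l0 pGL pGL c0])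
  have "(\<lambda>m. L2_norm boundary_measure (\<lambda>x. outer_normal x $ i * F m x - outer_normal x $ i * boundary_trace f x)) \<longlonglongrightarrow> 0"
  proof (rule tendsto_0_le[OF lb L2_norm_nonneg])
    show "L2_norm boundary_measure (\<lambda>x. outer_normal x $ i * F m x - outer_normal x $ i * boundary_trace f x) \<le>
        L2_norm boundary_measure (\<lambda>x. F m x - boundary_trace f x)" for m
      using nL(2)[OF L2_diff[OF BL bL]] by (simp add: right_diff_distrib)
  qed
  from L2_inner_tendsto[OF nL(1)[OF BL] nL(1)[OF bL] this GbL GbL c0]
  have B: "(\<lambda>m. L2_inner ?M (partial i (F m)) G + L2_inner ?M (F m) (partial i G)) \<longlonglongrightarrow>
      L2_inner boundary_measure (\<lambda>x. outer_normal x $ i * boundary_trace f x) G"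
    unfolding eq .
  show "L2_inner ?M (weak_partial i f) G + L2_inner ?M f (partial i G) =
      L2_inner boundary_measure (\<lambda>x. outer_normal x $ i * boundary_trace f x) G"
    by (rule LIMSEQ_unique[OF A B])
qed

text \<open>The second of two successive limits: \<open>f\<close> is now fixed in \<open>H1\<close>,
  and only \<open>g\<close> is approximated.\<close>

lemma Green_H1:
  fixes f g :: "real^'d \<Rightarrow> real"
  assumes f: "f \<in> H1" and g: "g \<in> H1"
  shows "L2_inner (lebesgue_on Omega) (weak_partial i f) g + L2_inner (lebesgue_on Omega) f (weak_partial i g) =
      L2_inner boundary_measure (\<lambda>x. outer_normal x $ i * boundary_trace f x) (boundary_trace g)"
proof -
  let ?M = "lebesgue_on (Omega :: (real^'d) set)"
  obtain G where G: "\<And>m :: nat. C_k (Suc 0) (G m)"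
    and l0: "(\<lambda>m. L2_norm ?M (\<lambda>x. G m x - g x)) \<longlonglongrightarrow> 0"
    and l1: "\<And>i. (\<lambda>m. L2_norm ?M (\<lambda>x. partial i (G m) x - weak_partial i g x)) \<longlonglongrightarrow> 0"
    and lb: "(\<lambda>m. L2_norm boundary_measure (\<lambda>x. G m x - boundary_trace g x)) \<longlonglongrightarrow> 0"
    using H1_approximation[OF g] by blast
  note fL = H1_L2[OF f] and wL = weak_partial_L2[OF f, of i] and bL = normal_mult_L2(1)[OF boundary_trace_L2[OF f], of i]
  note gL = H1_L2[OF g] and wgL = weak_partial_L2[OF g] and bgL = boundary_trace_L2[OF g]
  have GL: "G m \<in> L2 ?M" for m by (intro continuous_L2 C1_continuous G)
  have pL: "partial i (G m) \<in> L2 ?M" for i m using G[of m] by (intro continuous_L2) auto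
  have BL: "G m \<in> L2 boundary_measure" for m by (intro continuous_boundary_L2 C1_continuous G)
  have c0: "(\<lambda>m :: nat. L2_norm N (\<lambda>x. (h :: _ \<Rightarrow> real) x - h x)) \<longlonglongrightarrow> 0" for N h by (simp add: L2_norm_def)
  have A: "(\<lambda>m. L2_inner ?M (weak_partial i f) (G m) + L2_inner ?M f (partial i (G m))) \<longlonglongrightarrow>
      L2_inner ?M (weak_partial i f) g + L2_inner ?M f (weak_partial i g)"
    by (intro tendsto_add L2_inner_tendsto[OF wL wL c0 GL gL l0] L2_inner_tendsto[OF fL fL c0 pL wgL l1])
  have B: "(\<lambda>m. L2_inner ?M (weak_partial i f) (G m) + L2_inner ?M f (partial i (G m))) \<longlonglongrightarrow>
      L2_inner boundary_measure (\<lambda>x. outer_normal x $ i * boundary_trace f x) (boundary_trace g)"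
    unfolding Green_C1_H1[OF f G] by (rule L2_inner_tendsto[OF bL bL c0 BL bgL lb])
  show ?thesis by (rule LIMSEQ_unique[OF A B])
qed

lemma integral_weak_partial:
  fixes f :: "real^'d \<Rightarrow> real"
  assumes f: "f \<in> H1"
  shows "(LINT x|lebesgue_on Omega. weak_partial i f x) = (LINT x|boundary_measure. outer_normal x $ i * boundary_trace f x)"
proof -
  have C: "C_k (Suc 0) (\<lambda>x :: real^'d. 1)" using C1_coord[of 0 i 1] by simp
  have p: "partial i (\<lambda>x :: real^'d. 1) = (\<lambda>x. 0)" using partial_coord[of i 0 i 1] by auto
  show ?thesis
    using Green_C1_H1[OF f C, of i] unfolding p by (simp add: L2_inner_def)
qed

section \<open>The first-order system\<close>

lemma H1_vec_component: "v \<in> H1_vec \<Longrightarrow> component v i \<in> H1"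
  by (simp add: H1_vec_def)

lemma H1_vec_norm_nonneg [simp]: "H1_vec_norm v \<ge> 0"
  by (simp add: H1_vec_norm_def sum_nonneg)

lemma H1_norm_component_le: "H1_norm (component v i) \<le> H1_vec_norm v"
  unfolding H1_vec_norm_def
  by (rule real_le_rsqrt) (rule member_le_sum, auto)

lemma H1_vec_L2:
  fixes v :: "real^'d \<Rightarrow> real^'d"
  assumes v: "v \<in> H1_vec"
  shows "v \<in> L2 (lebesgue_on Omega)" "L2_norm (lebesgue_on Omega) v \<le> H1_vec_norm v"
proof -
  let ?M = "lebesgue_on (Omega :: (real^'d) set)"
  have n: "(norm (v x))\<^sup>2 = (\<Sum>i\<in>UNIV. (norm (component v i x))\<^sup>2)" for x
    by (simp only: power2_norm_eq_inner) (simp add: inner_vec_def)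
  have cL: "component v i \<in> L2 ?M" for i by (intro H1_L2 H1_vec_component v)
  note int = L2_integrable_square[OF cL]
  show "v \<in> L2 ?M"
  proof (rule L2I)
    show "v \<in> borel_measurable ?M" by (rule borel_measurable_vec) (rule L2_measurable[OF cL])
    show "integrable ?M (\<lambda>x. (norm (v x))\<^sup>2)" unfolding n using int by auto
  qed
  have "(L2_norm ?M v)\<^sup>2 = (\<Sum>i\<in>UNIV. (L2_norm ?M (component v i))\<^sup>2)"
    unfolding L2_norm_square n using int by simp
  also have "\<dots> \<le> (\<Sum>i\<in>UNIV. (H1_norm (component v i))\<^sup>2)"
    by (intro sum_mono power_mono L2_norm_le_H1_norm) auto
  also have "\<dots> = (H1_vec_norm v)\<^sup>2" by (simp add: H1_vec_norm_def sum_nonneg)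
  finally show "L2_norm ?M v \<le> H1_vec_norm v" by (rule power2_le_imp_le) simp
qed

lemma divergence_L2:
  fixes v :: "real^'d \<Rightarrow> real^'d"
  assumes v: "v \<in> H1_vec"
  shows "divergence v \<in> L2 (lebesgue_on Omega)"
    "L2_norm (lebesgue_on Omega) (divergence v) \<le> real CARD('d) * H1_vec_norm v"
proof -
  let ?M = "lebesgue_on (Omega :: (real^'d) set)"
  note c = H1_vec_component[OF v]
  have wL: "weak_partial i (component v i) \<in> L2 ?M" for i by (rule weak_partial_L2[OF c])
  show "divergence v \<in> L2 ?M" unfolding divergence_def [abs_def] by (rule L2_sum) (rule wL)
  have "L2_norm ?M (divergence v) \<le> (\<Sum>i\<in>UNIV. L2_norm ?M (weak_partial i (component v i)))"
    unfolding divergence_def [abs_def] by (rule L2_norm_sum_le) (rule wL)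
  also have "\<dots> \<le> (\<Sum>i\<in>(UNIV :: 'd set). H1_vec_norm v)"
    by (intro sum_mono order.trans[OF L2_norm_weak_partial_le[OF c] order.trans[OF L2_norm_grad_le_H1_norm H1_norm_component_le]])
  finally show "L2_norm ?M (divergence v) \<le> real CARD('d) * H1_vec_norm v" by simp
qed

definition normal_trace :: "(real^'d \<Rightarrow> real^'d) \<Rightarrow> real^'d \<Rightarrow> real" where
  "normal_trace v x = outer_normal x \<bullet> boundary_trace_vec v x"

lemma normal_trace_sum: "normal_trace v = (\<lambda>x. \<Sum>i\<in>UNIV. outer_normal x $ i * boundary_trace (component v i) x)"
  by (simp add: normal_trace_def [abs_def] inner_vec_def boundary_trace_vec_def)

lemma normal_trace_L2:
  fixes v :: "real^'d \<Rightarrow> real^'d"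
  assumes v: "v \<in> H1_vec"
  shows "normal_trace v \<in> L2 boundary_measure"
    "L2_norm boundary_measure (normal_trace v) \<le> 2 * (real CARD('d))\<^sup>2 * H1_vec_norm v"
proof -
  note c = H1_vec_component[OF v]
  note nL = normal_mult_L2[OF boundary_trace_L2[OF c]]
  show "normal_trace v \<in> L2 boundary_measure" unfolding normal_trace_sum by (rule L2_sum) (rule nL)
  have "L2_norm boundary_measure (normal_trace v) \<le>
      (\<Sum>i\<in>UNIV. L2_norm boundary_measure (\<lambda>x. outer_normal x $ i * boundary_trace (component v i) x))"
    unfolding normal_trace_sum by (rule L2_norm_sum_le) (rule nL)
  also have "\<dots> \<le> (\<Sum>i\<in>(UNIV :: 'd set). 2 * real CARD('d) * H1_vec_norm v)"
  proof (rule sum_mono)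
    fix i
    have "L2_norm boundary_measure (\<lambda>x. outer_normal x $ i * boundary_trace (component v i) x) \<le> 2 * real CARD('d) * H1_norm (component v i)"
      by (rule order.trans[OF nL(2) trace_inequality[OF c]])
    also have "\<dots> \<le> 2 * real CARD('d) * H1_vec_norm v"
      by (intro mult_left_mono H1_norm_component_le) simp
    finally show "L2_norm boundary_measure (\<lambda>x. outer_normal x $ i * boundary_trace (component v i) x) \<le> 2 * real CARD('d) * H1_vec_norm v" .
  qed
  finally show "L2_norm boundary_measure (normal_trace v) \<le> 2 * (real CARD('d))\<^sup>2 * H1_vec_norm v"
    by (simp add: power2_eq_square)
qed

lemma Green_vector:
  fixes f :: "real^'d \<Rightarrow> real"
  assumes f: "f \<in> H1" and v: "v \<in> H1_vec"
  shows "L2_inner (lebesgue_on Omega) (grad f) v + L2_inner (lebesgue_on Omega) f (divergence v) =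
    L2_inner boundary_measure (boundary_trace f) (normal_trace v)"
proof -
  let ?M = "lebesgue_on (Omega :: (real^'d) set)"
  note c = H1_vec_component[OF v]
  have "L2_inner ?M (grad f) v = (LINT x|?M. (\<Sum>i\<in>UNIV. weak_partial i f x \<bullet> component v i x))"
    by (simp add: L2_inner_def inner_vec_def grad_def)
  also have "\<dots> = (\<Sum>i\<in>UNIV. L2_inner ?M (weak_partial i f) (component v i))"
    unfolding L2_inner_def
    by (rule Bochner_Integration.integral_sum) (rule L2_inner_integrable[OF weak_partial_L2[OF f] H1_L2[OF c]])
  finally have 1: "L2_inner ?M (grad f) v = (\<Sum>i\<in>UNIV. L2_inner ?M (weak_partial i f) (component v i))" .
  have "L2_inner ?M f (divergence v) = (LINT x|?M. (\<Sum>i\<in>UNIV. f x \<bullet> weak_partial i (component v i) x))"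
    by (simp add: L2_inner_def divergence_def sum_distrib_left)
  also have "\<dots> = (\<Sum>i\<in>UNIV. L2_inner ?M f (weak_partial i (component v i)))"
    unfolding L2_inner_def
    by (rule Bochner_Integration.integral_sum) (rule L2_inner_integrable[OF H1_L2[OF f] weak_partial_L2[OF c]])
  finally have 2: "L2_inner ?M f (divergence v) = (\<Sum>i\<in>UNIV. L2_inner ?M f (weak_partial i (component v i)))" .
  have "L2_inner boundary_measure (boundary_trace f) (normal_trace v) =
      (LINT x|boundary_measure. (\<Sum>i\<in>UNIV. (outer_normal x $ i * boundary_trace f x) \<bullet> boundary_trace (component v i) x))"
    by (simp add: L2_inner_def normal_trace_sum sum_distrib_left mult_ac)
  also have "\<dots> = (\<Sum>i\<in>UNIV. L2_inner boundary_measure (\<lambda>x. outer_normal x $ i * boundary_trace f x) (boundary_trace (component v i)))"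
    unfolding L2_inner_def
    by (rule Bochner_Integration.integral_sum)
       (rule L2_inner_integrable[OF normal_mult_L2(1)[OF boundary_trace_L2[OF f]] boundary_trace_L2[OF c]])
  finally show ?thesis
    unfolding 1 2 by (simp add: sum.distrib[symmetric] Green_H1[OF f c])
qed

lemma divergence_theorem:
  fixes v :: "real^'d \<Rightarrow> real^'d"
  assumes v: "v \<in> H1_vec"
  shows "(LINT x|lebesgue_on Omega. divergence v x) = (LINT x|boundary_measure. normal_trace v x)"
proof -
  let ?M = "lebesgue_on (Omega :: (real^'d) set)"
  note c = H1_vec_component[OF v]
  have "(LINT x|?M. divergence v x) = (\<Sum>i\<in>UNIV. LINT x|?M. weak_partial i (component v i) x)"
    unfolding divergence_def
    by (rule Bochner_Integration.integral_sum) (rule Om.L2_integrable[OF weak_partial_L2[OF c]])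
  also have "\<dots> = (\<Sum>i\<in>UNIV. LINT x|boundary_measure. outer_normal x $ i * boundary_trace (component v i) x)"
    by (simp only: integral_weak_partial[OF c])
  also have "\<dots> = (LINT x|boundary_measure. normal_trace v x)"
    unfolding normal_trace_sum
    by (rule Bochner_Integration.integral_sum[symmetric])
       (rule bd.L2_integrable[OF normal_mult_L2(1)[OF boundary_trace_L2[OF c]]])
  finally show ?thesis .
qed

text \<open>Here \<open>q\<close> stands for \<open>\<phi>\<^sub>k\<^sub>+\<^sub>1\<close>, or for 0
  in the last equation. The gradient is paired with \<open>F\<close>, and Green's formula moves the
  remaining derivative onto \<open>v\<close>, where the divergence residual takes over. The boundary
  product is kept as it is because the three boundary conditions treat it differently.\<close>

lemma energy_estimate:
  fixes f q :: "real^'d \<Rightarrow> real" and v :: "real^'d \<Rightarrow> real^'d"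
  assumes f: "f \<in> H1" and v: "v \<in> H1_vec" and q: "q \<in> L2 (lebesgue_on Omega)"
    and F: "L2_norm (lebesgue_on Omega) (\<lambda>x. grad f x - v x) \<le> \<epsilon>"
    and G: "L2_norm (lebesgue_on Omega) (\<lambda>x. divergence v x - q x) \<le> \<epsilon>"
  shows "(L2_norm (lebesgue_on Omega) (grad f))\<^sup>2 \<le>
    (2 * \<epsilon> + L2_norm (lebesgue_on Omega) q) * H1_norm f + L2_inner boundary_measure (boundary_trace f) (normal_trace v)"
proof -
  let ?M = "lebesgue_on (Omega :: (real^'d) set)"
  let ?F = "\<lambda>x. grad f x - v x" and ?G = "\<lambda>x. divergence v x - q x"
  note fL = H1_L2[OF f] and gL = grad_L2(1)[OF f] and vL = H1_vec_L2(1)[OF v] and dL = divergence_L2(1)[OF v]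
  note FL = L2_diff[OF gL vL] and GL = L2_diff[OF dL q]
  have "(L2_norm ?M (grad f))\<^sup>2 = L2_inner ?M ?F (grad f) + L2_inner ?M v (grad f)"
    by (simp add: L2_inner_diff_left[OF gL vL gL] L2_inner_self)
  also have "L2_inner ?M v (grad f) = L2_inner boundary_measure (boundary_trace f) (normal_trace v) - L2_inner ?M f (divergence v)"
    using Green_vector[OF f v] by (simp add: L2_inner_commute)
  also have "L2_inner ?M f (divergence v) = L2_inner ?M f ?G + L2_inner ?M f q"
    by (simp add: L2_inner_diff_right[OF fL dL q])
  finally have "(L2_norm ?M (grad f))\<^sup>2 = L2_inner ?M ?F (grad f) - L2_inner ?M f ?G - L2_inner ?M f q
      + L2_inner boundary_measure (boundary_trace f) (normal_trace v)" by simp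
  moreover have "\<bar>L2_inner ?M ?F (grad f)\<bar> \<le> \<epsilon> * H1_norm f"
    by (rule order.trans[OF L2_Cauchy_Schwarz[OF FL gL] mult_mono'[OF F L2_norm_grad_le_H1_norm]]) auto
  moreover have "\<bar>L2_inner ?M f ?G\<bar> \<le> H1_norm f * \<epsilon>"
    by (rule order.trans[OF L2_Cauchy_Schwarz[OF fL GL] mult_mono'[OF L2_norm_le_H1_norm G]]) auto
  moreover have "\<bar>L2_inner ?M f q\<bar> \<le> H1_norm f * L2_norm ?M q"
    by (rule order.trans[OF L2_Cauchy_Schwarz[OF fL q] mult_right_mono[OF L2_norm_le_H1_norm]]) auto
  ultimately show ?thesis by (simp add: algebra_simps)
qed

section \<open>Absorption of a linear term and downward recursion\<close>

lemma H1_norm_le_grad: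
  fixes f :: "real^'d \<Rightarrow> real"
  assumes "f \<in> H1"
  shows "H1_norm f \<le> (real CARD('d) + 1) * L2_norm (lebesgue_on Omega) (grad f) + \<bar>LINT x|lebesgue_on Omega. f x\<bar>"
proof -
  have "H1_norm f \<le> L2_norm (lebesgue_on Omega) f + L2_norm (lebesgue_on Omega) (grad f)"
    unfolding H1_norm_def by (rule sqrt_sum_squares_le_sum) auto
  with Poincare_H1[OF assms] show ?thesis by (simp add: algebra_simps)
qed

text \<open>Absorbs one factor of the unknown: the energy estimate bounds the square of a norm by an
  expression linear in that norm. If \<open>x > A + B\<close>, then
  \<open>x\<^sup>2 > A x + B x \<ge> A x + B\<^sup>2\<close>.\<close>

lemma quadratic_bound:
  fixes x A B :: real
  assumes "x\<^sup>2 \<le> A * x + B\<^sup>2" "0 \<le> A" "0 \<le> B" "0 \<le> x" shows "x \<le> A + B"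
proof (rule ccontr)
  assume "\<not> x \<le> A + B"
  then have x: "x > A + B" by simp
  have "B\<^sup>2 \<le> B * x" using x assms by (simp add: power2_eq_square mult_left_mono)
  moreover have "x * x > (A + B) * x" using x assms by (intro mult_strict_right_mono) auto
  ultimately show False using assms(1) by (simp add: power2_eq_square algebra_simps)
qed

text \<open>The induction proves the sharper factor \<open>(2 L) ^ (n - k) - 1\<close>. The
  \<open>- 1\<close> matches the terminal value and cancels the new summand \<open>e\<close> at each
  step; doubling \<open>L\<close> restores it.\<close>

lemma backward_recursion_bound:
  fixes h :: "nat \<Rightarrow> real"
  assumes L: "L \<ge> 1" and e: "e \<ge> 0" and hn: "h n \<le> 0"
    and step: "\<And>k. k < n \<Longrightarrow> h k \<le> L * (e + h (Suc k))"
    and k: "k \<le> n"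
  shows "h k \<le> (2 * L) ^ n * e"
proof -
  have "h k \<le> ((2 * L) ^ (n - k) - 1) * e"
    using k
  proof (induction k rule: inc_induct)
    case base
    then show ?case using hn by simp
  next
    case (step k)
    have p: "1 \<le> (2 * L) ^ (n - Suc k)" using L by (intro one_le_power) simp
    have "h k \<le> L * (e + h (Suc k))" by (rule assms(4)[OF step(2)])
    also have "\<dots> \<le> L * (e + ((2 * L) ^ (n - Suc k) - 1) * e)"
      using step.IH L by (intro mult_left_mono add_left_mono) auto
    also have "\<dots> = (L * (2 * L) ^ (n - Suc k)) * e" by (simp add: algebra_simps)
    also have "\<dots> \<le> (2 * (L * (2 * L) ^ (n - Suc k)) - 1) * e"
    proof (rule mult_right_mono[OF _ e])
      have "1 * 1 \<le> L * (2 * L) ^ (n - Suc k)" using L p by (intro mult_mono) auto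
      then show "L * (2 * L) ^ (n - Suc k) \<le> 2 * (L * (2 * L) ^ (n - Suc k)) - 1" by linarith
    qed
    also have "2 * (L * (2 * L) ^ (n - Suc k)) = (2 * L) ^ (n - k)"
      using step(2) by (simp add: Suc_diff_Suc[symmetric])
    finally show ?case .
  qed
  also have "\<dots> \<le> (2 * L) ^ n * e"
  proof (rule mult_right_mono[OF _ e])
    have "(2 * L) ^ (n - k) \<le> (2 * L) ^ n" using L by (intro power_increasing) auto
    then show "(2 * L) ^ (n - k) - 1 \<le> (2 * L) ^ n" by simp
  qed
  finally show ?thesis .
qed

text \<open>Encodes \<open>\<phi>\<^sub>n = 0\<close>, so that the last equation of the system has
  the same shape as the others.\<close>

definition next_phi :: "nat \<Rightarrow> 'd state \<Rightarrow> nat \<Rightarrow> real^'d \<Rightarrow> real" where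
  "next_phi n u k = (if Suc k < n then phi u (Suc k) else (\<lambda>_. 0))"

text \<open>Continued by 0 from \<open>n\<close> on, which provides the terminal value of the
  downward recursion.\<close>

definition phi_norm :: "nat \<Rightarrow> 'd::finite state \<Rightarrow> nat \<Rightarrow> real" where
  "phi_norm n u k = (if k < n then H1_norm (phi u k) else 0)"

lemma P_op_alt: "P_op n u k = (\<lambda>x. (grad (phi u k) x - psi u k x, divergence (psi u k) x - next_phi n u k x))"
  by (auto simp: P_op_def next_phi_def)

lemma state_norm_nonneg [simp]: "state_norm n u \<ge> 0"
  by (simp add: state_norm_def sum_nonneg)

lemma state_norm_ge:
  assumes "k < n"
  shows "H1_norm (phi u k) \<le> state_norm n u" "H1_vec_norm (psi u k) \<le> state_norm n u"
proof -
  have "H1_norm (phi u k) + H1_vec_norm (psi u k) \<le> state_norm n u"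
    unfolding state_norm_def
    by (rule member_le_sum[where f = "\<lambda>k. H1_norm (phi u k) + H1_vec_norm (psi u k)"]) (use assms in auto)
  then show "H1_norm (phi u k) \<le> state_norm n u" "H1_vec_norm (psi u k) \<le> state_norm n u"
    using H1_norm_nonneg[of "phi u k"] H1_vec_norm_nonneg[of "psi u k"] by linarith+
qed

lemma phi_norm_nonneg [simp]: "phi_norm n u k \<ge> 0"
  by (simp add: phi_norm_def)

lemma phi_norm_le: "phi_norm n u k \<le> state_norm n u"
  by (simp add: phi_norm_def state_norm_ge)

section \<open>Norms and residuals of a fixed state\<close>

context
  fixes n :: nat and u :: "'d::finite state"
  assumes u: "u \<in> H1_states n"
begin

lemma phi_H1: "k < n \<Longrightarrow> phi u k \<in> H1" and psi_H1_vec: "k < n \<Longrightarrow> psi u k \<in> H1_vec"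
  using u by (auto simp: H1_states_def)

lemma next_phi_L2: "next_phi n u k \<in> L2 (lebesgue_on Omega)"
  by (auto simp: next_phi_def intro: H1_L2 phi_H1)

lemma next_phi_norm_le: "L2_norm (lebesgue_on Omega) (next_phi n u k) \<le> phi_norm n u (Suc k)"
  by (auto simp: next_phi_def phi_norm_def L2_norm_le_H1_norm) (simp add: L2_norm_def)

lemma gradient_residual_L2: "k < n \<Longrightarrow> (\<lambda>x. grad (phi u k) x - psi u k x) \<in> L2 (lebesgue_on Omega)"
  by (intro L2_diff grad_L2(1) H1_vec_L2(1) phi_H1 psi_H1_vec)

lemma divergence_residual_L2: "k < n \<Longrightarrow> (\<lambda>x. divergence (psi u k) x - next_phi n u k x) \<in> L2 (lebesgue_on Omega)"
  by (intro L2_diff divergence_L2(1) next_phi_L2 psi_H1_vec)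

lemma P_op_L2:
  assumes k: "k < n"
  shows "P_op n u k \<in> L2 (lebesgue_on Omega)"
    "(L2_norm (lebesgue_on Omega) (P_op n u k))\<^sup>2 =
      (L2_norm (lebesgue_on Omega) (\<lambda>x. grad (phi u k) x - psi u k x))\<^sup>2 +
      (L2_norm (lebesgue_on Omega) (\<lambda>x. divergence (psi u k) x - next_phi n u k x))\<^sup>2"
proof -
  let ?M = "lebesgue_on (Omega :: (real^'d) set)"
  let ?F = "\<lambda>x. grad (phi u k) x - psi u k x" and ?G = "\<lambda>x. divergence (psi u k) x - next_phi n u k x"
  note FL = gradient_residual_L2[OF k] and GL = divergence_residual_L2[OF k]
  have n: "(norm (P_op n u k x))\<^sup>2 = (norm (?F x))\<^sup>2 + (norm (?G x))\<^sup>2" for x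
    unfolding P_op_alt by (simp add: norm_prod_def)
  note i = L2_integrable_square[OF FL] L2_integrable_square[OF GL]
  show "P_op n u k \<in> L2 ?M"
  proof (rule L2I)
    show "P_op n u k \<in> borel_measurable ?M"
      unfolding P_op_alt by (rule borel_measurable_Pair[OF L2_measurable[OF FL] L2_measurable[OF GL]])
    show "integrable ?M (\<lambda>x. (norm (P_op n u k x))\<^sup>2)"
      unfolding n by (rule Bochner_Integration.integrable_add[OF i])
  qed
  show "(L2_norm ?M (P_op n u k))\<^sup>2 = (L2_norm ?M ?F)\<^sup>2 + (L2_norm ?M ?G)\<^sup>2"
    unfolding L2_norm_square n by (rule Bochner_Integration.integral_add[OF i])
qed

lemma P_op_norm_le:
  assumes k: "k < n"
  shows "L2_norm (lebesgue_on Omega) (P_op n u k) \<le> (real CARD('d) + 3) * state_norm n u"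
proof -
  let ?M = "lebesgue_on (Omega :: (real^'d) set)" and ?s = "state_norm n u"
  let ?F = "\<lambda>x. grad (phi u k) x - psi u k x" and ?G = "\<lambda>x. divergence (psi u k) x - next_phi n u k x"
  note s = state_norm_ge[OF k, of u]
  have "L2_norm ?M ?F \<le> L2_norm ?M (grad (phi u k)) + L2_norm ?M (psi u k)"
    by (intro L2_norm_triangle_diff grad_L2(1) H1_vec_L2(1) phi_H1 psi_H1_vec k)
  also have "\<dots> \<le> ?s + ?s"
    using s by (intro add_mono order.trans[OF L2_norm_grad_le_H1_norm] order.trans[OF H1_vec_L2(2)[OF psi_H1_vec[OF k]]])
  finally have F: "L2_norm ?M ?F \<le> 2 * ?s" by simp
  have "L2_norm ?M ?G \<le> L2_norm ?M (divergence (psi u k)) + L2_norm ?M (next_phi n u k)"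
    by (intro L2_norm_triangle_diff divergence_L2(1) next_phi_L2 psi_H1_vec k)
  also have "\<dots> \<le> real CARD('d) * ?s + ?s"
    using s by (intro add_mono order.trans[OF divergence_L2(2)[OF psi_H1_vec[OF k]]] mult_left_mono
        order.trans[OF next_phi_norm_le phi_norm_le]) auto
  finally have G: "L2_norm ?M ?G \<le> real CARD('d) * ?s + ?s" .
  \<comment> \<open>The gradient residual contributes 2 and the divergence residual
    \<open>d + 1\<close> to the constant.\<close>
  have "L2_norm ?M (P_op n u k) \<le> L2_norm ?M ?F + L2_norm ?M ?G"
    by (rule power2_le_imp_le) (simp_all add: P_op_L2(2)[OF k] power2_sum)
  with F G show ?thesis by (simp add: algebra_simps)
qed

lemma S_op_alt:
  "S_op Dirichlet u k = boundary_trace (phi u k)"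
  "S_op Neumann u k = normal_trace (psi u k)"
  "S_op Robin u k = (\<lambda>x. boundary_trace (phi u k) x + normal_trace (psi u k) x)"
  by (auto simp: normal_trace_def)

lemma phi_trace_L2: "k < n \<Longrightarrow> boundary_trace (phi u k) \<in> L2 boundary_measure"
  by (intro boundary_trace_L2 phi_H1)

lemma psi_trace_L2: "k < n \<Longrightarrow> normal_trace (psi u k) \<in> L2 boundary_measure"
  by (intro normal_trace_L2 psi_H1_vec)

lemma S_op_L2: "k < n \<Longrightarrow> S_op \<alpha> u k \<in> L2 boundary_measure"
  by (cases \<alpha>) (auto simp only: S_op_alt intro: phi_trace_L2 psi_trace_L2 L2_add)

lemma phi_trace_norm_le:
  "k < n \<Longrightarrow> L2_norm boundary_measure (boundary_trace (phi u k)) \<le> 2 * real CARD('d) * phi_norm n u k"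
  using trace_inequality[OF phi_H1] by (simp add: phi_norm_def)

lemma psi_trace_norm_le:
  assumes "k < n"
  shows "L2_norm boundary_measure (normal_trace (psi u k)) \<le> 2 * (real CARD('d))\<^sup>2 * state_norm n u"
  by (rule order.trans[OF normal_trace_L2(2)[OF psi_H1_vec[OF assms]]])
     (intro mult_left_mono state_norm_ge assms, simp)

lemma S_op_norm_le:
  assumes k: "k < n"
  shows "L2_norm boundary_measure (S_op \<alpha> u k) \<le> (2 * real CARD('d) + 2 * (real CARD('d))\<^sup>2) * state_norm n u"
proof -
  have 1: "L2_norm boundary_measure (boundary_trace (phi u k)) \<le> 2 * real CARD('d) * state_norm n u"
    by (rule order.trans[OF phi_trace_norm_le[OF k]]) (intro mult_left_mono phi_norm_le, simp)
  note 2 = psi_trace_norm_le[OF k]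
  have "L2_norm boundary_measure (\<lambda>x. boundary_trace (phi u k) x + normal_trace (psi u k) x) \<le>
     L2_norm boundary_measure (boundary_trace (phi u k)) + L2_norm boundary_measure (normal_trace (psi u k))"
    by (intro L2_norm_triangle phi_trace_L2 psi_trace_L2 k)
  moreover have "0 \<le> 2 * real CARD('d) * state_norm n u" "0 \<le> 2 * (real CARD('d))\<^sup>2 * state_norm n u"
    by auto
  ultimately show ?thesis
    using 1 2 by (cases \<alpha>) (auto simp only: S_op_alt distrib_right)
qed

lemma mean_phi_le:
  assumes "k < n"
  shows "\<bar>LINT x|lebesgue_on Omega. phi u k x\<bar> \<le> state_norm n u"
proof -
  have "\<bar>L2_inner (lebesgue_on Omega) (phi u k) (\<lambda>_. 1)\<bar> \<le> L2_norm (lebesgue_on Omega) (phi u k) * L2_norm (lebesgue_on (Omega :: (real^'d) set)) (\<lambda>_. 1 :: real)"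
    by (rule L2_Cauchy_Schwarz[OF H1_L2[OF phi_H1[OF assms]] Om.L2_const])
  also have "\<dots> = L2_norm (lebesgue_on Omega) (phi u k)" by (simp add: L2_norm_def)
  also have "\<dots> \<le> state_norm n u"
    by (rule order.trans[OF L2_norm_le_H1_norm state_norm_ge(1)[OF assms]])
  finally show ?thesis by (simp add: integral_L2_inner)
qed

lemma B_form_diagonal:
  "B_form n lam mu \<alpha> u u =
    (\<Sum>k<n. (L2_norm (lebesgue_on Omega) (\<lambda>x. grad (phi u k) x - psi u k x))\<^sup>2 +
      (L2_norm (lebesgue_on Omega) (\<lambda>x. divergence (psi u k) x - next_phi n u k x))\<^sup>2)
    + lam * (\<Sum>k<n. (L2_norm boundary_measure (S_op \<alpha> u k))\<^sup>2)
    + (if \<alpha> = Neumann then mu * (LINT x|lebesgue_on Omega. phi u 0 x)\<^sup>2 else 0)"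
  by (simp add: B_form_def L2_inner_self P_op_L2(2) power2_eq_square[of "LINT x|_. _ x"])

text \<open>All summands of the form on the diagonal are nonnegative, so each is at most
  \<open>\<epsilon>\<^sup>2\<close>. From here on the form enters only through \<epsilon>.\<close>

lemma residual_bounds:
  fixes \<alpha> :: bc
  assumes lam: "lam > 0" and mu: "mu > 0"
  defines "\<epsilon> \<equiv> sqrt (B_form n lam mu \<alpha> u u)"
  shows "0 \<le> \<epsilon>"
    and "k < n \<Longrightarrow> L2_norm (lebesgue_on Omega) (\<lambda>x. grad (phi u k) x - psi u k x) \<le> \<epsilon>"
    and "k < n \<Longrightarrow> L2_norm (lebesgue_on Omega) (\<lambda>x. divergence (psi u k) x - next_phi n u k x) \<le> \<epsilon>"
    and "k < n \<Longrightarrow> L2_norm boundary_measure (S_op \<alpha> u k) \<le> \<epsilon> / sqrt lam"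
    and "\<alpha> = Neumann \<Longrightarrow> \<bar>LINT x|lebesgue_on Omega. phi u 0 x\<bar> \<le> \<epsilon> / sqrt mu"
proof -
  let ?M = "lebesgue_on (Omega :: (real^'d) set)"
  define p where "p k = (L2_norm ?M (\<lambda>x. grad (phi u k) x - psi u k x))\<^sup>2 +
      (L2_norm ?M (\<lambda>x. divergence (psi u k) x - next_phi n u k x))\<^sup>2" for k
  define s where "s k = (L2_norm boundary_measure (S_op \<alpha> u k))\<^sup>2" for k
  define m where "m = (if \<alpha> = Neumann then mu * (LINT x|?M. phi u 0 x)\<^sup>2 else 0)"
  have B: "B_form n lam mu \<alpha> u u = sum p {..<n} + lam * sum s {..<n} + m"
    unfolding B_form_diagonal p_def s_def m_def ..
  have nn: "0 \<le> p k" "0 \<le> s k" "0 \<le> m" for k using mu by (auto simp: p_def s_def m_def)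
  have sn: "0 \<le> sum p {..<n}" "0 \<le> lam * sum s {..<n}" using nn lam by (auto intro!: sum_nonneg mult_nonneg_nonneg)
  show e: "0 \<le> \<epsilon>" unfolding \<epsilon>_def B using sn nn by simp
  have e2: "\<epsilon>\<^sup>2 = sum p {..<n} + lam * sum s {..<n} + m" unfolding \<epsilon>_def B using sn nn by simp
  have ple: "p k \<le> \<epsilon>\<^sup>2" if "k < n" for k
  proof -
    have "p k \<le> sum p {..<n}" using that nn by (intro member_le_sum) auto
    then show ?thesis using sn nn(3) e2 by linarith
  qed
  show "L2_norm ?M (\<lambda>x. grad (phi u k) x - psi u k x) \<le> \<epsilon>" if "k < n"
    by (rule power2_le_imp_le[OF order.trans[OF _ ple[OF that]] e]) (simp add: p_def)
  show "L2_norm ?M (\<lambda>x. divergence (psi u k) x - next_phi n u k x) \<le> \<epsilon>" if "k < n"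
    by (rule power2_le_imp_le[OF order.trans[OF _ ple[OF that]] e]) (simp add: p_def)
  show "L2_norm boundary_measure (S_op \<alpha> u k) \<le> \<epsilon> / sqrt lam" if "k < n"
  proof (rule power2_le_imp_le)
    have "lam * s k \<le> lam * sum s {..<n}" using that nn lam by (intro mult_left_mono member_le_sum) auto
    then have "lam * s k \<le> \<epsilon>\<^sup>2" using sn nn(3) e2 by linarith
    then show "(L2_norm boundary_measure (S_op \<alpha> u k))\<^sup>2 \<le> (\<epsilon> / sqrt lam)\<^sup>2"
      using lam by (simp add: power_divide s_def field_simps)
  qed (use e lam in simp)
  show "\<bar>LINT x|?M. phi u 0 x\<bar> \<le> \<epsilon> / sqrt mu" if "\<alpha> = Neumann"
  proof (rule power2_le_imp_le)
    have "mu * (LINT x|?M. phi u 0 x)\<^sup>2 \<le> \<epsilon>\<^sup>2" using that sn nn(3) e2 by (simp add: m_def)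
    then show "\<bar>LINT x|?M. phi u 0 x\<bar>\<^sup>2 \<le> (\<epsilon> / sqrt mu)\<^sup>2"
      using mu by (simp add: power_divide field_simps)
  qed (use e mu in simp)
qed

lemma energy_estimate_state:
  fixes \<alpha> :: bc
  assumes "lam > 0" "mu > 0" and k: "k < n"
  defines "\<epsilon> \<equiv> sqrt (B_form n lam mu \<alpha> u u)"
  shows "(L2_norm (lebesgue_on Omega) (grad (phi u k)))\<^sup>2 \<le>
    (2 * \<epsilon> + phi_norm n u (Suc k)) * phi_norm n u k
    + L2_inner boundary_measure (boundary_trace (phi u k)) (normal_trace (psi u k))"
proof -
  have "(L2_norm (lebesgue_on Omega) (grad (phi u k)))\<^sup>2 \<le>
    (2 * \<epsilon> + L2_norm (lebesgue_on Omega) (next_phi n u k)) * H1_norm (phi u k)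
    + L2_inner boundary_measure (boundary_trace (phi u k)) (normal_trace (psi u k))"
    unfolding \<epsilon>_def
    by (rule energy_estimate[OF phi_H1[OF k] psi_H1_vec[OF k] next_phi_L2])
       (rule residual_bounds(2,3)[OF assms(1,2) k])+
  moreover have "(2 * \<epsilon> + L2_norm (lebesgue_on Omega) (next_phi n u k)) * H1_norm (phi u k) \<le>
      (2 * \<epsilon> + phi_norm n u (Suc k)) * phi_norm n u k"
    using k next_phi_norm_le[of k] by (auto simp: phi_norm_def[of n u k] intro: mult_right_mono)
  ultimately show ?thesis by linarith
qed

text \<open>Once the potentials are controlled the fluxes follow: \<open>\<psi>\<^sub>k\<close> is
  \<open>grad \<phi>\<^sub>k\<close> and its divergence is
  \<open>\<phi>\<^sub>k\<^sub>+\<^sub>1\<close>, each up to a residual of norm at most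
  \<epsilon>.\<close>

lemma psi_Hdiv_le:
  fixes \<alpha> :: bc
  assumes "lam > 0" "mu > 0" and k: "k < n"
  defines "\<epsilon> \<equiv> sqrt (B_form n lam mu \<alpha> u u)"
  shows "(Hdiv_norm (psi u k))\<^sup>2 \<le> (\<epsilon> + phi_norm n u k)\<^sup>2 + (\<epsilon> + phi_norm n u (Suc k))\<^sup>2"
proof -
  let ?M = "lebesgue_on (Omega :: (real^'d) set)"
  note r = residual_bounds(2,3)[OF assms(1,2) k, of \<alpha>, folded \<epsilon>_def]
  have "L2_norm ?M (psi u k) \<le> L2_norm ?M (\<lambda>x. psi u k x - grad (phi u k) x) + L2_norm ?M (grad (phi u k))"
    by (intro L2_norm_triangle_sub grad_L2(1) H1_vec_L2(1) phi_H1 psi_H1_vec k)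
  also have "\<dots> \<le> \<epsilon> + phi_norm n u k"
    using r(1) L2_norm_grad_le_H1_norm[of "phi u k"] k by (simp add: L2_norm_minus_commute phi_norm_def)
  finally have 1: "L2_norm ?M (psi u k) \<le> \<epsilon> + phi_norm n u k" .
  have "L2_norm ?M (divergence (psi u k)) \<le> L2_norm ?M (\<lambda>x. divergence (psi u k) x - next_phi n u k x) + L2_norm ?M (next_phi n u k)"
    by (intro L2_norm_triangle_sub divergence_L2(1) next_phi_L2 psi_H1_vec k)
  also have "\<dots> \<le> \<epsilon> + phi_norm n u (Suc k)"
    using r(2) next_phi_norm_le[of k] by simp
  finally have 2: "L2_norm ?M (divergence (psi u k)) \<le> \<epsilon> + phi_norm n u (Suc k)" .
  have "(Hdiv_norm (psi u k))\<^sup>2 = (L2_norm ?M (psi u k))\<^sup>2 + (L2_norm ?M (divergence (psi u k)))\<^sup>2"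
    by (simp add: Hdiv_norm_def)
  also have "\<dots> \<le> (\<epsilon> + phi_norm n u k)\<^sup>2 + (\<epsilon> + phi_norm n u (Suc k))\<^sup>2"
    using 1 2 by (intro add_mono power_mono) auto
  finally show ?thesis .
qed

end


text \<open>Cauchy-Schwarz term by term, together with the trace inequality for the boundary
  operators.\<close>

lemma B_form_bounded:
  assumes lam: "lam > 0" and mu: "mu > 0" and n: "n \<ge> 1"
  shows "\<exists>C>0. \<forall>u \<in> H1_states n. \<forall>w \<in> H1_states n. \<forall>\<alpha>.
    B_form n lam mu \<alpha> (u :: 'd::finite state) w \<le> C * state_norm n u * state_norm n w"
proof -
  let ?M = "lebesgue_on (Omega :: (real^'d) set)"
  define p where "p = real CARD('d) + 3"
  define s where "s = 2 * real CARD('d) + 2 * (real CARD('d))\<^sup>2"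
  have pos: "p > 0" "s \<ge> 0" by (simp_all add: p_def s_def)
  \<comment> \<open>The share \<open>mu\<close> of the mean value term is included throughout, so
    that one constant serves all three boundary conditions.\<close>
  define C where "C = real n * p\<^sup>2 + lam * (real n * s\<^sup>2) + mu"
  have C: "C > 0" unfolding C_def using pos lam mu by (intro add_nonneg_pos add_nonneg_nonneg mult_nonneg_nonneg) auto
  have "B_form n lam mu \<alpha> u w \<le> C * state_norm n u * state_norm n w"
    if u: "u \<in> H1_states n" and w: "w \<in> H1_states n" for \<alpha> and u w :: "'d state"
  proof -
    let ?x = "state_norm n u * state_norm n w"
    have P: "L2_inner ?M (P_op n u k) (P_op n w k) \<le> p\<^sup>2 * ?x" if "k < n" for k
    proof -
      have "L2_inner ?M (P_op n u k) (P_op n w k) \<le> L2_norm ?M (P_op n u k) * L2_norm ?M (P_op n w k)"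
        by (rule L2_inner_le[OF P_op_L2(1)[OF u that] P_op_L2(1)[OF w that]])
      also have "\<dots> \<le> (p * state_norm n u) * (p * state_norm n w)"
        unfolding p_def by (intro mult_mono' P_op_norm_le u w that) auto
      finally show ?thesis by (simp add: power2_eq_square mult_ac)
    qed
    have S: "L2_inner boundary_measure (S_op \<alpha> u k) (S_op \<alpha> w k) \<le> s\<^sup>2 * ?x" if "k < n" for k
    proof -
      have "L2_inner boundary_measure (S_op \<alpha> u k) (S_op \<alpha> w k) \<le>
          L2_norm boundary_measure (S_op \<alpha> u k) * L2_norm boundary_measure (S_op \<alpha> w k)"
        by (rule L2_inner_le[OF S_op_L2[OF u that] S_op_L2[OF w that]])
      also have "\<dots> \<le> (s * state_norm n u) * (s * state_norm n w)"
        unfolding s_def by (intro mult_mono' S_op_norm_le u w that) auto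
      finally show ?thesis by (simp add: power2_eq_square mult_ac)
    qed
    have m: "mu * (LINT x|?M. phi u 0 x) * (LINT x|?M. phi w 0 x) \<le> mu * ?x"
    proof -
      have "\<bar>(LINT x|?M. phi u 0 x) * (LINT x|?M. phi w 0 x)\<bar> \<le> ?x"
        unfolding abs_mult using n by (intro mult_mono' mean_phi_le u w) auto
      then have "mu * ((LINT x|?M. phi u 0 x) * (LINT x|?M. phi w 0 x)) \<le> mu * ?x"
        using mu by (intro mult_left_mono) auto
      then show ?thesis by (simp only: mult.assoc)
    qed
    have "(\<Sum>k<n. L2_inner ?M (P_op n u k) (P_op n w k)) \<le> (\<Sum>k<n. p\<^sup>2 * ?x)"
      by (rule sum_mono) (use P in auto)
    moreover have "(\<Sum>k<n. L2_inner boundary_measure (S_op \<alpha> u k) (S_op \<alpha> w k)) \<le> (\<Sum>k<n. s\<^sup>2 * ?x)"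
      by (rule sum_mono) (use S in auto)
    then have "lam * (\<Sum>k<n. L2_inner boundary_measure (S_op \<alpha> u k) (S_op \<alpha> w k)) \<le> lam * (\<Sum>k<n. s\<^sup>2 * ?x)"
      using lam by (intro mult_left_mono) auto
    moreover have "(if \<alpha> = Neumann then mu * (LINT x|?M. phi u 0 x) * (LINT x|?M. phi w 0 x) else 0) \<le> mu * ?x"
      using m mu by auto
    ultimately have "B_form n lam mu \<alpha> u w \<le> (\<Sum>k<n. p\<^sup>2 * ?x) + lam * (\<Sum>k<n. s\<^sup>2 * ?x) + mu * ?x"
      unfolding B_form_def by linarith
    also have "\<dots> = C * state_norm n u * state_norm n w"
      by (simp add: C_def algebra_simps)
    finally show ?thesis .
  qed
  with C show ?thesis by blast
qed

text \<open>The normal trace is itself a residual, so the boundary product is at most a multiple of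
  \<epsilon> times the norm of \<open>\<phi>\<^sub>k\<close>. What the gradient leaves open is the
  mean, which the inequality of Poincare asks for.\<close>

lemma recursive_estimate_Neumann:
  assumes lam: "lam > 0" and mu: "mu > 0"
  shows "\<exists>L\<ge>1. \<forall>u \<in> H1_states n. \<forall>k<n.
    phi_norm n (u :: 'd::finite state) k \<le> L * (sqrt (B_form n lam mu Neumann u u) + phi_norm n u (Suc k))"
proof -
  let ?M = "lebesgue_on (Omega :: (real^'d) set)"
  define d where "d = real CARD('d)"
  define T where "T = sqrt (measure boundary_measure (space (boundary_measure :: (real^'d) measure)))"
  \<comment> \<open>The 2 comes from the two interior residuals, the rest from the boundary product
    by way of the trace inequality.\<close>
  define K where "K = 2 + 2 * d / sqrt lam"
  \<comment> \<open>A bound for all means: \<open>1 / sqrt mu\<close> serves \<open>k = 0\<close>,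
    the other two terms serve \<open>k > 0\<close>. The factor \<open>T\<close> passes from the
    \<open>L2\<close> to the \<open>L1\<close> norm on the boundary.\<close>
  define K2 where "K2 = 1 / sqrt mu + T / sqrt lam + 1"
  define L where "L = 2 * (d + 1)\<^sup>2 * (K + 1) + 2 * K2"
  have d: "d \<ge> 0" and T: "T \<ge> 0" by (simp_all add: d_def T_def)
  have K: "K \<ge> 0" and K2: "K2 \<ge> 0" using lam mu d T by (simp_all add: K_def K2_def)
  have dd: "1 \<le> (d + 1)\<^sup>2" using d by (intro one_le_power) simp
  have "1 * 1 \<le> (d + 1)\<^sup>2 * (K + 1)" using dd K by (intro mult_mono) auto
  then have L: "L \<ge> 1" unfolding L_def using K2 by (simp add: mult.assoc)
  have "phi_norm n u k \<le> L * (sqrt (B_form n lam mu Neumann u u) + phi_norm n u (Suc k))"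
    if u: "u \<in> H1_states n" and k: "k < n" for k and u :: "'d state"
  proof -
    define \<epsilon> where "\<epsilon> = sqrt (B_form n lam mu Neumann u u)"
    let ?h = "phi_norm n u k" and ?h' = "phi_norm n u (Suc k)"
    define g where "g = L2_norm ?M (grad (phi u k))"
    note r = residual_bounds[OF u lam mu, where \<alpha> = Neumann, folded \<epsilon>_def]
    have g0: "g \<ge> 0" by (simp add: g_def)
    have "L2_inner boundary_measure (boundary_trace (phi u k)) (normal_trace (psi u k)) \<le>
        (2 * d * ?h) * (\<epsilon> / sqrt lam)"
      unfolding d_def
      by (rule order.trans[OF L2_inner_le[OF phi_trace_L2[OF u k] psi_trace_L2[OF u k]]])
         (intro mult_mono' phi_trace_norm_le u k r(4)[OF k, unfolded S_op_alt(2)[OF u]] L2_norm_nonneg)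
    moreover have "(2 * d * ?h) * (\<epsilon> / sqrt lam) + (2 * \<epsilon> + ?h') * ?h = (K * \<epsilon> + ?h') * ?h"
      by (simp add: K_def algebra_simps)
    ultimately have g: "g\<^sup>2 \<le> (K * \<epsilon> + ?h') * ?h"
      using energy_estimate_state[OF u lam mu k, of Neumann, folded \<epsilon>_def g_def] by linarith
    have mean: "\<bar>LINT x|?M. phi u k x\<bar> \<le> K2 * \<epsilon>"
    proof (cases k)
      case 0
      \<comment> \<open>No preceding equation contains \<open>\<phi>\<^sub>0\<close>; its mean is
        controlled by the \<open>mu\<close> term of the form.\<close>
      have "\<bar>LINT x|?M. phi u k x\<bar> \<le> 1 / sqrt mu * \<epsilon>" using r(5) by (simp add: 0)
      also have "\<dots> \<le> K2 * \<epsilon>"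
        using r(1) T lam by (intro mult_right_mono) (auto simp: K2_def)
      finally show ?thesis .
    next
      case (Suc j)
      then have j: "j < n" using k by simp
      let ?G = "\<lambda>x. divergence (psi u j) x - next_phi n u j x"
      have nx: "next_phi n u j = phi u k" using k by (simp add: next_phi_def Suc)
      note dL = divergence_L2(1)[OF psi_H1_vec[OF u j]] and GL = divergence_residual_L2[OF u j]
      \<comment> \<open>The preceding divergence equation is integrated:
        \<open>\<phi>\<^sub>k\<close> is the divergence of the preceding flux minus a residual, and
        the integral of that divergence is the total normal flux.\<close>
      have "(LINT x|?M. ?G x) = (LINT x|?M. divergence (psi u j) x) - (LINT x|?M. next_phi n u j x)"
        by (rule Bochner_Integration.integral_diff[OF Om.L2_integrable[OF dL] Om.L2_integrable[OF next_phi_L2[OF u]]])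
      then have "(LINT x|?M. phi u k x) = (LINT x|boundary_measure. normal_trace (psi u j) x) - (LINT x|?M. ?G x)"
        by (simp add: nx divergence_theorem[OF psi_H1_vec[OF u j]])
      moreover have "\<bar>LINT x|boundary_measure. normal_trace (psi u j) x\<bar> \<le> T * (\<epsilon> / sqrt lam)"
      proof -
        have "\<bar>LINT x|boundary_measure. normal_trace (psi u j) x\<bar> \<le> (LINT x|boundary_measure. norm (normal_trace (psi u j) x))"
          using integral_norm_bound[of boundary_measure "normal_trace (psi u j)"] by simp
        also have "\<dots> \<le> T * L2_norm boundary_measure (normal_trace (psi u j))"
          unfolding T_def by (rule bd.L1_le_L2[OF psi_trace_L2[OF u j]])
        also have "\<dots> \<le> T * (\<epsilon> / sqrt lam)"
          using r(4)[OF j, unfolded S_op_alt(2)[OF u]] T by (rule mult_left_mono)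
        finally show ?thesis .
      qed
      moreover have "\<bar>LINT x|?M. ?G x\<bar> \<le> \<epsilon>"
      proof -
        have "\<bar>LINT x|?M. ?G x\<bar> \<le> (LINT x|?M. norm (?G x))"
          using integral_norm_bound[of ?M ?G] by simp
        also have "\<dots> \<le> L2_norm ?M ?G"
          using Om.L1_le_L2[OF GL] by simp
        also have "\<dots> \<le> \<epsilon>" by (rule r(3)[OF j])
        finally show ?thesis .
      qed
      ultimately have "\<bar>LINT x|?M. phi u k x\<bar> \<le> T * (\<epsilon> / sqrt lam) + \<epsilon>" by linarith
      also have "\<dots> = (T / sqrt lam + 1) * \<epsilon>" by (simp add: algebra_simps)
      also have "\<dots> \<le> K2 * \<epsilon>"
        using r(1) mu by (intro mult_right_mono) (auto simp: K2_def)
      finally show ?thesis .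
    qed
    have hg: "?h \<le> (d + 1) * g + K2 * \<epsilon>"
      using H1_norm_le_grad[OF phi_H1[OF u k]] mean k by (simp add: phi_norm_def d_def g_def)
    have "?h\<^sup>2 \<le> ((d + 1) * g + K2 * \<epsilon>)\<^sup>2"
      using hg by (intro power_mono) auto
    also have "\<dots> \<le> 2 * ((d + 1) * g)\<^sup>2 + 2 * (K2 * \<epsilon>)\<^sup>2"
      using sum_squares_bound[of "(d + 1) * g" "K2 * \<epsilon>"] by (simp only: power2_sum)
    \<comment> \<open>The last term is enlarged to the square of \<open>2 K2 \<epsilon>\<close>, the
      shape that \<open>quadratic_bound\<close> takes.\<close>
    also have "\<dots> \<le> (2 * (d + 1)\<^sup>2) * ((K * \<epsilon> + ?h') * ?h) + (2 * K2 * \<epsilon>)\<^sup>2"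
    proof (rule add_mono)
      show "2 * ((d + 1) * g)\<^sup>2 \<le> (2 * (d + 1)\<^sup>2) * ((K * \<epsilon> + ?h') * ?h)"
        using mult_left_mono[OF g, of "2 * (d + 1)\<^sup>2"] by (simp add: power_mult_distrib)
    qed (simp add: power_mult_distrib)
    finally have "?h\<^sup>2 \<le> (2 * (d + 1)\<^sup>2 * (K * \<epsilon> + ?h')) * ?h + (2 * K2 * \<epsilon>)\<^sup>2" by (simp only: mult.assoc)
    then have "?h \<le> 2 * (d + 1)\<^sup>2 * (K * \<epsilon> + ?h') + 2 * K2 * \<epsilon>"
      by (rule quadratic_bound) (use r(1) K K2 in auto)
    also have "\<dots> \<le> 2 * (d + 1)\<^sup>2 * ((K + 1) * (\<epsilon> + ?h')) + 2 * K2 * (\<epsilon> + ?h')"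
    proof (intro add_mono mult_left_mono)
      have "0 \<le> K * ?h'" using K by simp
      then show "K * \<epsilon> + ?h' \<le> (K + 1) * (\<epsilon> + ?h')" using r(1) by (simp add: algebra_simps)
    qed (use K2 in auto)
    also have "\<dots> = L * (\<epsilon> + ?h')" by (simp add: L_def algebra_simps)
    finally show ?thesis by (simp add: \<epsilon>_def)
  qed
  with L show ?thesis by blast
qed

text \<open>The boundary product equals the product of the trace with the Robin residual minus the
  squared trace norm. The negative term moves to the left, where it supplies the boundary norm that
  Friedrichs adds to the gradient.\<close>

lemma recursive_estimate_Robin:
  assumes lam: "lam > 0" and mu: "mu > 0"
  shows "\<exists>L\<ge>1. \<forall>u \<in> H1_states n. \<forall>k<n.
    phi_norm n (u :: 'd::finite state) k \<le> L * (sqrt (B_form n lam mu Robin u u) + phi_norm n u (Suc k))"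
proof -
  let ?M = "lebesgue_on (Omega :: (real^'d) set)"
  define d where "d = real CARD('d)"
  define K where "K = 2 + 2 * d / sqrt lam"
  have d: "d \<ge> 0" by (simp add: d_def)
  have K: "K \<ge> 0" using lam d by (simp add: K_def)
  have "phi_norm n u k \<le> (2 * (K + 1)) * (sqrt (B_form n lam mu Robin u u) + phi_norm n u (Suc k))"
    if u: "u \<in> H1_states n" and k: "k < n" for k and u :: "'d state"
  proof -
    define \<epsilon> where "\<epsilon> = sqrt (B_form n lam mu Robin u u)"
    let ?h = "phi_norm n u k" and ?h' = "phi_norm n u (Suc k)"
    let ?b = "boundary_trace (phi u k)" and ?N = "normal_trace (psi u k)"
    define g where "g = L2_norm ?M (grad (phi u k))"
    define b where "b = L2_norm boundary_measure ?b"
    note r = residual_bounds[OF u lam mu, where \<alpha> = Robin, folded \<epsilon>_def]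
    note bL = phi_trace_L2[OF u k] and NL = psi_trace_L2[OF u k]
    have "L2_inner boundary_measure ?b (\<lambda>x. ?b x + ?N x) = b\<^sup>2 + L2_inner boundary_measure ?b ?N"
      unfolding L2_inner_commute[of _ ?b "\<lambda>x. ?b x + ?N x"] L2_inner_add_left[OF bL NL bL]
      by (simp add: L2_inner_self b_def L2_inner_commute[of _ ?N ?b])
    moreover have "L2_inner boundary_measure ?b (\<lambda>x. ?b x + ?N x) \<le> (2 * d * ?h) * (\<epsilon> / sqrt lam)"
      unfolding d_def
      by (rule order.trans[OF L2_inner_le[OF bL L2_add[OF bL NL]]])
         (intro mult_mono' phi_trace_norm_le u k r(4)[OF k, unfolded S_op_alt(3)[OF u]] L2_norm_nonneg)
    moreover have "(2 * d * ?h) * (\<epsilon> / sqrt lam) + (2 * \<epsilon> + ?h') * ?h = (K * \<epsilon> + ?h') * ?h"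
      by (simp add: K_def algebra_simps)
    ultimately have gb: "g\<^sup>2 + b\<^sup>2 \<le> (K * \<epsilon> + ?h') * ?h"
      using energy_estimate_state[OF u lam mu k, of Robin, folded \<epsilon>_def g_def] by linarith
    have "?h\<^sup>2 = (L2_norm ?M (phi u k))\<^sup>2 + g\<^sup>2"
      using k by (simp add: phi_norm_def H1_norm_def g_def)
    also have "\<dots> \<le> 2 * (g\<^sup>2 + b\<^sup>2)"
    proof -
      have "(L2_norm ?M (phi u k))\<^sup>2 \<le> b\<^sup>2 + g\<^sup>2"
        using Friedrichs_H1[OF phi_H1[OF u k]] by (simp add: g_def b_def)
      moreover have "0 \<le> b\<^sup>2" by simp
      ultimately show ?thesis unfolding distrib_left by linarith
    qed
    \<comment> \<open>No mean value occurs here, so \<open>quadratic_bound\<close> is applied with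
      \<open>B = 0\<close>.\<close>
    also have "\<dots> \<le> (2 * (K * \<epsilon> + ?h')) * ?h + 0\<^sup>2" using gb by (simp add: algebra_simps)
    finally have "?h \<le> 2 * (K * \<epsilon> + ?h') + 0"
      by (rule quadratic_bound) (use r(1) K in auto)
    also have "\<dots> \<le> 2 * ((K + 1) * (\<epsilon> + ?h'))"
    proof -
      have "0 \<le> K * ?h'" using K by simp
      then show ?thesis using r(1) by (simp add: algebra_simps)
    qed
    finally show ?thesis by (simp only: \<epsilon>_def mult.assoc)
  qed
  moreover have "2 * (K + 1) \<ge> 1" using K by simp
  ultimately show ?thesis by blast
qed

text \<open>The recursion bounds all potentials by \<open>D * \<epsilon>\<close>, linearly in
  \<epsilon>; squaring returns the form itself on the right-hand side.\<close>

lemma coercive_from_recursion: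
  assumes lam: "lam > 0" and mu: "mu > 0" and n: "n \<ge> 1" and L: "L \<ge> 1"
    and rec: "\<And>u k. u \<in> H1_states n \<Longrightarrow> k < n \<Longrightarrow>
      phi_norm n (u :: 'd::finite state) k \<le> L * (sqrt (B_form n lam mu \<alpha> u u) + phi_norm n u (Suc k))"
  shows "\<exists>C>0. \<forall>u \<in> H1_states n. B_form n lam mu \<alpha> (u :: 'd state) u
    \<ge> C * (\<Sum>k<n. (H1_norm (phi u k))\<^sup>2 + (Hdiv_norm (psi u k))\<^sup>2)"
proof -
  define D where "D = (2 * L) ^ n"
  \<comment> \<open>Each \<open>k\<close> contributes three squares, one from
    \<open>\<phi>\<^sub>k\<close> and two from the \<open>H(div)\<close> norm of
    \<open>\<psi>\<^sub>k\<close>, all at most \<open>((1 + D) \<epsilon>)\<^sup>2\<close>.\<close>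
  define K where "K = real n * (3 * (1 + D)\<^sup>2)"
  have D: "D \<ge> 0" using L by (simp add: D_def)
  have K: "K > 0" unfolding K_def using D n by (intro mult_pos_pos) (auto intro!: zero_less_power)
  have "B_form n lam mu \<alpha> u u \<ge> (1 / K) * (\<Sum>k<n. (H1_norm (phi u k))\<^sup>2 + (Hdiv_norm (psi u k))\<^sup>2)"
    if u: "u \<in> H1_states n" for u :: "'d state"
  proof -
    define \<epsilon> where "\<epsilon> = sqrt (B_form n lam mu \<alpha> u u)"
    note r = residual_bounds(1)[OF u lam mu, where \<alpha> = \<alpha>, folded \<epsilon>_def]
    have h: "phi_norm n u k \<le> D * \<epsilon>" if "k \<le> n" for k
      unfolding D_def
      by (rule backward_recursion_bound[OF L r _ _ that])
         (use rec[OF u] in \<open>auto simp: \<epsilon>_def phi_norm_def[of n u n]\<close>)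
    have "(H1_norm (phi u k))\<^sup>2 + (Hdiv_norm (psi u k))\<^sup>2 \<le> 3 * (1 + D)\<^sup>2 * \<epsilon>\<^sup>2" if k: "k < n" for k
    proof -
      have le: "\<epsilon> + phi_norm n u j \<le> (1 + D) * \<epsilon>" if "j \<le> n" for j
        using h[OF that] by (simp add: algebra_simps)
      have sq: "(\<epsilon> + phi_norm n u j)\<^sup>2 \<le> (1 + D)\<^sup>2 * \<epsilon>\<^sup>2" if "j \<le> n" for j
        unfolding power_mult_distrib[symmetric] using r by (intro power_mono le that) auto
      have "(H1_norm (phi u k))\<^sup>2 \<le> (\<epsilon> + phi_norm n u k)\<^sup>2"
        using k r by (intro power_mono) (auto simp: phi_norm_def)
      then show ?thesis
        using psi_Hdiv_le[OF u lam mu k, of \<alpha>, folded \<epsilon>_def] sq[of k] sq[of "Suc k"] k by simp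
    qed
    then have "(\<Sum>k<n. (H1_norm (phi u k))\<^sup>2 + (Hdiv_norm (psi u k))\<^sup>2) \<le> (\<Sum>k<n. 3 * (1 + D)\<^sup>2 * \<epsilon>\<^sup>2)"
      by (intro sum_mono) auto
    also have "\<dots> = K * \<epsilon>\<^sup>2" by (simp add: K_def)
    also have "\<epsilon>\<^sup>2 = B_form n lam mu \<alpha> u u" using r by (simp add: \<epsilon>_def)
    finally show ?thesis using K by (simp add: pos_divide_le_eq mult.commute)
  qed
  with K show ?thesis by (intro exI[of _ "1 / K"]) auto
qed

text \<open>The normal trace is bounded by a multiple of \<open>E\<close> and need not be small, so
  the boundary product is only of first order in \<epsilon>. The recursion is therefore run for the
  squares of the potential norms, with \<epsilon> as its additive term.\<close>

lemma coercive_Dirichlet: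
  assumes lam: "lam > 0" and mu: "mu > 0" and n: "n \<ge> 1" and E: "E > 0"
  shows "\<exists>C>0. \<forall>u \<in> H1_states n. state_norm n u \<le> E \<longrightarrow>
    sqrt (B_form n lam mu Dirichlet (u :: 'd::finite state) u)
      \<ge> C * (\<Sum>k<n. (H1_norm (phi u k))\<^sup>2 + (Hdiv_norm (psi u k))\<^sup>2)"
proof -
  let ?M = "lebesgue_on (Omega :: (real^'d) set)"
  obtain CB where CB: "CB > 0" "\<And>u w \<alpha>. u \<in> H1_states n \<Longrightarrow> w \<in> H1_states n \<Longrightarrow>
      B_form n lam mu \<alpha> (u :: 'd state) w \<le> CB * state_norm n u * state_norm n w"
    using B_form_bounded[OF lam mu n] by blast
  define d where "d = real CARD('d)"
  \<comment> \<open>A cap for \<epsilon>: continuity of the form gives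
    \<open>\<epsilon>\<^sup>2 \<le> CB * E\<^sup>2\<close>, so
    \<open>\<epsilon>\<^sup>2 \<le> K * \<epsilon>\<close> and quadratic terms become
    linear.\<close>
  define K where "K = sqrt CB * E"
  \<comment> \<open>Within the bracket: the interior residuals, the boundary product, the squared
    boundary norm. The factor 2 clears the half left by Young's inequality; the 4 is the coefficient
    of \<open>(h (Suc k))\<^sup>2\<close>.\<close>
  define L where "L = 2 * (4 * E + 4 * d\<^sup>2 * E / sqrt lam + K / lam) + 4"
  define D where "D = (2 * L) ^ n"
  define C where "C = real n * (5 * D + 4 * K)"
  have K: "K > 0" using CB E by (simp add: K_def)
  have L: "L \<ge> 1" unfolding L_def using E K lam by (simp add: add_increasing)
  have D: "D > 0" using L by (simp add: D_def)
  have C: "C > 0" using n D K by (simp add: C_def)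
  have "sqrt (B_form n lam mu Dirichlet u u) \<ge> (1 / C) * (\<Sum>k<n. (H1_norm (phi u k))\<^sup>2 + (Hdiv_norm (psi u k))\<^sup>2)"
    if u: "u \<in> H1_states n" and uE: "state_norm n u \<le> E" for u :: "'d state"
  proof -
    define \<epsilon> where "\<epsilon> = sqrt (B_form n lam mu Dirichlet u u)"
    define h where "h k = phi_norm n u k" for k
    note r = residual_bounds[OF u lam mu, where \<alpha> = Dirichlet, folded \<epsilon>_def]
    have h0: "0 \<le> h k" and hE: "h k \<le> E" for k
      using phi_norm_le[of n u k] uE by (simp_all add: h_def)
    have "B_form n lam mu Dirichlet u u \<le> CB * E * E"
      by (rule order.trans[OF CB(2)[OF u u]]) (use CB(1) uE E in \<open>intro mult_mono, auto\<close>)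
    then have "\<epsilon> \<le> sqrt (CB * E * E)" unfolding \<epsilon>_def by (rule real_sqrt_le_mono)
    also have "\<dots> = K" using E by (simp add: K_def real_sqrt_mult)
    finally have eK: "\<epsilon>\<^sup>2 \<le> K * \<epsilon>" using r(1) by (simp add: power2_eq_square mult_right_mono)
    have rec: "(h k)\<^sup>2 \<le> L * (\<epsilon> + (h (Suc k))\<^sup>2)" if k: "k < n" for k
    proof -
      let ?b = "boundary_trace (phi u k)" and ?N = "normal_trace (psi u k)"
      define g where "g = L2_norm ?M (grad (phi u k))"
      define b where "b = L2_norm boundary_measure ?b"
      have b: "b \<le> \<epsilon> / sqrt lam" using r(4)[OF k] by (simp only: S_op_alt(1)[OF u] b_def)
      have "b\<^sup>2 \<le> (\<epsilon> / sqrt lam)\<^sup>2" using b by (intro power_mono) (simp_all add: b_def)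
      also have "\<dots> = \<epsilon>\<^sup>2 / lam" using lam by (simp add: power_divide)
      also have "\<dots> \<le> K / lam * \<epsilon>" using eK lam by (simp add: divide_right_mono)
      finally have b2: "b\<^sup>2 \<le> K / lam * \<epsilon>" .
      have "L2_norm boundary_measure ?N \<le> 2 * d\<^sup>2 * E"
        unfolding d_def by (rule order.trans[OF psi_trace_norm_le[OF u k]]) (intro mult_left_mono uE, simp)
      then have "L2_inner boundary_measure ?b ?N \<le> (\<epsilon> / sqrt lam) * (2 * d\<^sup>2 * E)"
        using b by (intro order.trans[OF L2_inner_le[OF phi_trace_L2[OF u k] psi_trace_L2[OF u k]]] mult_mono')
          (simp_all add: b_def)
      then have g: "g\<^sup>2 \<le> 2 * \<epsilon> * h k + h (Suc k) * h k + 2 * d\<^sup>2 * E / sqrt lam * \<epsilon>"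
        using energy_estimate_state[OF u lam mu k, of Dirichlet, folded \<epsilon>_def g_def h_def]
        by (simp add: algebra_simps)
      have "\<epsilon> * h k \<le> E * \<epsilon>" using mult_left_mono[OF hE r(1), of k] by (simp add: mult.commute)
      \<comment> \<open>Young's inequality, weighted so that only half of
        \<open>(h k)\<^sup>2\<close> appears and can be moved to the left.\<close>
      moreover have "2 * (h (Suc k) * h k) \<le> (h k)\<^sup>2 / 2 + 2 * (h (Suc k))\<^sup>2"
        using zero_le_power2[of "h k - 2 * h (Suc k)"] by (simp add: power2_diff field_simps)
      moreover have "(h k)\<^sup>2 = (L2_norm ?M (phi u k))\<^sup>2 + g\<^sup>2"
        using k by (simp add: h_def phi_norm_def H1_norm_def g_def)
      moreover have "(L2_norm ?M (phi u k))\<^sup>2 \<le> b\<^sup>2 + g\<^sup>2"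
        using Friedrichs_H1[OF phi_H1[OF u k]] by (simp add: g_def b_def)
      ultimately have "(h k)\<^sup>2 / 2 \<le> 4 * (E * \<epsilon>) + 2 * (h (Suc k))\<^sup>2 + 2 * (2 * d\<^sup>2 * E / sqrt lam * \<epsilon>) + K / lam * \<epsilon>"
        using g b2 by linarith
      then have "(h k)\<^sup>2 \<le> (L - 4) * \<epsilon> + 4 * (h (Suc k))\<^sup>2"
        by (simp add: L_def algebra_simps)
      also have "\<dots> \<le> L * \<epsilon> + L * (h (Suc k))\<^sup>2"
        using r(1) E K lam by (intro add_mono mult_right_mono) (auto simp: L_def add_increasing)
      finally show ?thesis by (simp add: distrib_left)
    qed
    have y: "(h k)\<^sup>2 \<le> D * \<epsilon>" if "k \<le> n" for k
      unfolding D_def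
      by (rule backward_recursion_bound[where h = "\<lambda>k. (h k)\<^sup>2", OF L r(1) _ rec that])
         (simp add: h_def phi_norm_def)
    \<comment> \<open>One \<open>D\<close> comes from \<open>\<phi>\<^sub>k\<close>; each of the two
      squares in the \<open>H(div)\<close> bound contributes \<open>2 K + 2 D\<close>.\<close>
    have "(H1_norm (phi u k))\<^sup>2 + (Hdiv_norm (psi u k))\<^sup>2 \<le> (5 * D + 4 * K) * \<epsilon>" if k: "k < n" for k
    proof -
      have sq: "(\<epsilon> + h j)\<^sup>2 \<le> 2 * (K * \<epsilon>) + 2 * (D * \<epsilon>)" if "j \<le> n" for j
      proof -
        have "(\<epsilon> + h j)\<^sup>2 \<le> 2 * \<epsilon>\<^sup>2 + 2 * (h j)\<^sup>2"
          using sum_squares_bound[of \<epsilon> "h j"] by (simp add: power2_sum)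
        then show ?thesis using eK y[OF that] by linarith
      qed
      have "(H1_norm (phi u k))\<^sup>2 \<le> D * \<epsilon>" using y[of k] k by (simp add: h_def phi_norm_def)
      then show ?thesis
        using psi_Hdiv_le[OF u lam mu k, of Dirichlet, folded \<epsilon>_def h_def] sq[of k] sq[of "Suc k"] k
        by (simp add: algebra_simps)
    qed
    then have "(\<Sum>k<n. (H1_norm (phi u k))\<^sup>2 + (Hdiv_norm (psi u k))\<^sup>2) \<le> (\<Sum>k<n. (5 * D + 4 * K) * \<epsilon>)"
      by (intro sum_mono) auto
    also have "\<dots> = C * \<epsilon>" by (simp add: C_def)
    finally show ?thesis using C by (simp add: pos_divide_le_eq mult.commute \<epsilon>_def)
  qed
  with C show ?thesis by (intro exI[of _ "1 / C"]) auto
qed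

theorem lemma3p1:
  fixes n :: nat and lam mu :: real
  assumes "n \<ge> 1" and "lam > 0" and "mu > 0"
  shows "(\<exists>C\<^sub>B>0. \<forall>u \<in> H1_states n. \<forall>w \<in> H1_states n. \<forall>\<alpha>.
            B_form n lam mu \<alpha> (u :: 'd::finite state) w \<le> C\<^sub>B * state_norm n u * state_norm n w)
    \<and> (\<forall>\<alpha> \<in> {Neumann, Robin}. \<exists>C>0. \<forall>u \<in> H1_states n.
            B_form n lam mu \<alpha> (u :: 'd state) u
              \<ge> C * (\<Sum>k<n. (H1_norm (phi u k))\<^sup>2 + (Hdiv_norm (psi u k))\<^sup>2))
    \<and> (\<forall>E>0. \<exists>C\<^sub>E>0. \<forall>u \<in> H1_states n. state_norm n u \<le> E \<longrightarrow>
            sqrt (B_form n lam mu Dirichlet (u :: 'd state) u)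
              \<ge> C\<^sub>E * (\<Sum>k<n. (H1_norm (phi u k))\<^sup>2 + (Hdiv_norm (psi u k))\<^sup>2))"
proof (intro conjI ballI allI impI)
  show "\<exists>C\<^sub>B>0. \<forall>u \<in> H1_states n. \<forall>w \<in> H1_states n. \<forall>\<alpha>.
            B_form n lam mu \<alpha> (u :: 'd state) w \<le> C\<^sub>B * state_norm n u * state_norm n w"
    by (rule B_form_bounded[OF assms(2,3,1)])
  fix \<alpha> assume \<alpha>: "\<alpha> \<in> {Neumann, Robin}"
  then obtain L where "L \<ge> 1" "\<And>u k. u \<in> H1_states n \<Longrightarrow> k < n \<Longrightarrow>
      phi_norm n (u :: 'd state) k \<le> L * (sqrt (B_form n lam mu \<alpha> u u) + phi_norm n u (Suc k))"
    using recursive_estimate_Neumann[OF assms(2,3), of n, where 'd = 'd]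
      recursive_estimate_Robin[OF assms(2,3), of n, where 'd = 'd] by blast
  then show "\<exists>C>0. \<forall>u \<in> H1_states n. B_form n lam mu \<alpha> (u :: 'd state) u
      \<ge> C * (\<Sum>k<n. (H1_norm (phi u k))\<^sup>2 + (Hdiv_norm (psi u k))\<^sup>2)"
    by (rule coercive_from_recursion[OF assms(2,3,1)])
next
  fix E :: real assume "E > 0"
  then show "\<exists>C\<^sub>E>0. \<forall>u \<in> H1_states n. state_norm n u \<le> E \<longrightarrow>
            sqrt (B_form n lam mu Dirichlet (u :: 'd state) u)
              \<ge> C\<^sub>E * (\<Sum>k<n. (H1_norm (phi u k))\<^sup>2 + (Hdiv_norm (psi u k))\<^sup>2)"
    by (rule coercive_Dirichlet[OF assms(2,3,1)])
qed

end
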